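(* Let $G$ be an oriented three-dimensional unimodular Lie group with Lie algebra $\mathfrak g$ and $(H,\mathcal G_g,\delta)$ a generalized Einstein structure on $G$. Let $L\in\mathrm{End}\,\mathfrak g$ be the $g$-symmetric endomorphism defined by $[u,v]=L(u\times v)$. If $L$ is diagonalizable, then there exist an oriented $g$-orthonormal basis $(v_1,v_2,v_3)$ of $\mathfrak g$ and $\alpha_1,\alpha_2,\alpha_3,h\in\mathbb R$ such that $[v_a,v_b]=\alpha_c\varepsilon_cv_c$ for every cyclic permutation $(a,b,c)$ of $(1,2,3)$ and $H=h\,\mathrm{vol}_g$, where $\varepsilon_a=g(v_a,v_a)$ satisfies $\varepsilon_1=\varepsilon_2$. The values that $(\alpha_1,\alpha_2,\alpha_3,h)$ can take are the following: (1) $\alpha_1=\alpha_2=\alpha_3=h=0$, in which case $\mathfrak g$ is abelian; the divergence $\delta$ can be an arbitrary element of $E^*$. (2) $\alpha_1=\alpha_2=\alpha_3=\pm h\neq0$, and $\mathfrak g$ is isomorphic to $\mathfrak{so}(2,1)$ or $\mathfrak{so}(3)$, the case $\mathfrak{so}(3)$ occurring precisely when $g$ is definite. Furthermore $\delta|_{E_\pm}=0$ (with the corresponding sign: $\delta|_{E_+}=0$ if $\alpha_a=h$, $\delta|_{E_-}=0$ if $\alpha_a=-h$). (3) There exists a cyclic permutation $\sigma\in\mathfrak S_3$ (including the identity) such that $\alpha_{\sigma(1)}=\alpha_{\sigma(2)}\neq0$ and $h=\alpha_{\sigma(3)}=0$. In this case $[\mathfrak g,\mathfrak g]$ is abelian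 of dimension $2$, so $\mathfrak g$ is metabelian. More precisely, $\mathfrak g$ is isomorphic to $\mathfrak e(2)$ ($g$ definite on $[\mathfrak g,\mathfrak g]$) or $\mathfrak e(1,1)$ ($g$ indefinite on $[\mathfrak g,\mathfrak g]$). The components of $\delta$ satisfy $\delta_{\sigma(1)}=\delta_{\sigma(2)}=\delta_{\sigma(1)+3}=\delta_{\sigma(2)+3}=0$. If $L$ is not diagonalizable, then $H=0$ and there is an oriented $g$-orthonormal basis $(v_1,v_2,v_3)$ with $\varepsilon_1=\varepsilon_2=-\varepsilon_3$ in which $L$ is represented by one of the matrices $L_3(\alpha,0)$, $L_4(\alpha,0)$, $L_5(0)$ below, $\alpha\in\mathbb{R}$, and: (1') If $L$ takes the form $L_3(0,0)$ or $L_4(0,0)$, then $\mathfrak g$ is isomorphic to the Heisenberg algebra, and $\delta_1=\delta_4=0$, $\delta_2=\delta_3$, $\delta_5=\delta_6$. (2') If $L$ takes the form $L_3(\alpha,0)$ or $L_4(\alpha,0)$ with $\alpha\ne0$, then $\mathfrak g\cong\mathfrak e(1,1)$, and $-\frac12\varepsilon_1\delta_1=-\frac12\varepsilon_1\delta_4=\alpha$, $\delta_2=\delta_3=\delta_5=\delta_6=0$. (3') If $L$ takes the form $L_5(0)$, then $\mathfrak g\cong\mathfrak e(1,1)$, and $\varepsilon_1\delta_1=-\varepsilon_3\delta_3=\varepsilon_1\delta_4=-\varepsilon_3\delta_6=-\sqrt2$, $\delta_2=\delta_5=0$.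
   Context: A Lie group is called unimodular here if its Lie algebra satisfies $\mathrm{tr}\,\mathrm{ad}_X=0$ for all $X$. $\mathfrak e(p,q)=\mathfrak{so}(p,q)\ltimes\mathbb R^{p,q}$, $\mathfrak e(2)=\mathfrak e(2,0)$. Left-invariant tensors are identified with tensors on $\mathfrak g$; $g$ is a left-invariant pseudo-Riemannian metric, $\mathrm{vol}_g$ its volume form (equal to $1$ on oriented orthonormal bases), the cross product is defined by $g(u\times v,w)=\mathrm{vol}_g(u,v,w)$. The normal forms are (acting on column vectors, $Lv_b=\sum_aL^a{}_bv_a$) $$L_3(\alpha,0)=\begin{pmatrix}0&0&0\\0&\frac12+\alpha&\frac12\\0&-\frac12&-\frac12+\alpha\end{pmatrix},\ L_4(\alpha,0)=\begin{pmatrix}0&0&0\\0&-\frac12+\alpha&-\frac12\\0&\frac12&\frac12+\alpha\end{pmatrix},\ L_5(0)=\frac1{\sqrt2}\begin{pmatrix}0&1&0\\1&0&1\\0&-1&0\end{pmatrix}.$$ Let $E=\mathfrak g\oplus\mathfrak g^*$, with scalar product $\langle X+\xi,Y+\eta\rangle=\frac12(\xi(Y)+\eta(X))$. For $H\in\bigwedge^3\mathfrak g^*$ the Dorfman bracket is $[X+\xi,Y+\eta]_H=[X,Y]-\mathrm{ad}_X^*\eta+\mathrm{ad}_Y^*\xi+H(X,Y,\cdot)$, where $\mathrm{ad}_X^*\eta=\eta\circ\mathrm{ad}_X$. Put $gX=g(X,\cdot)$, $\mathcal G_g(X+\xi,Y+\eta)=\frac12(g(X,Y)+g^{-1}(\xi,\eta))$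 and $E_\pm=\{X\pm gX:X\in\mathfrak g\}$. For $\delta\in E^*$ and an orthonormal basis $(v_a)$, $\delta_a=\delta(v_a+gv_a)$ and $\delta_{a+3}=\delta(v_a-gv_a)$, $a=1,2,3$. A left-invariant generalized connection is a linear map $D:E\to\mathfrak{so}(E)$, $u\mapsto D_u$. Its torsion is $T(u,v)=D_uv-D_vu-[u,v]_H+(Du)^*v$, where $Du$ is $w\mapsto D_wu$ and $*$ is the adjoint for $\langle\cdot,\cdot\rangle$. $D$ is Levi-Civita if $T=0$ and $D_uE_\pm\subset E_\pm$ for all $u$. Its divergence is $\delta_D(v)=\mathrm{tr}(u\mapsto D_uv)$. Given $\delta\in E^*$, choose a Levi-Civita $D$ with $\delta_D=\delta$ (one exists), put $R(u,v)w=D_uD_vw-D_vD_uw-D_{[u,v]_H}w$ and, for $u_\pm\in E_\pm$, $Ric^+_\delta(u_-,u_+)=\mathrm{tr}(E_+\ni w\mapsto R(w,u_-)u_+\in E_+)$, $Ric^-_\delta(u_+,u_-)=\mathrm{tr}(E_-\ni w\mapsto R(w,u_+)u_-\in E_-)$; these are known to be independent of the choice of $D$. $(H,\mathcal G_g,\delta)$ is a generalized Einstein structure if $Ric^+_\delta=0$ and $Ric^-_\delta=0$. *)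

theory Defs
  imports "HOL-Analysis.Analysis"
begin

text \<open>
  The distribution has no Lie groups. Since all tensors are left-invariant, an oriented Lie group
  enters only through its Lie algebra, given here by a bracket on a type \<open>'a\<close>, and an orientation
  of that vector space. The class \<open>euclidean_space\<close> only serves to make \<open>'a\<close> a finite-dimensional
  real vector space, and the dual space the library type \<open>'a \<Rightarrow>\<^sub>L real\<close>; its inner product is never
  used, the metric \<open>g\<close> is a separate bilinear form.
\<close>

definition lie_algebra :: "('a::real_vector \<Rightarrow> 'a \<Rightarrow> 'a) \<Rightarrow> bool" where
  "lie_algebra br \<longleftrightarrow> bilinear br \<and> (\<forall>x. br x x = 0) \<and>
     (\<forall>x y z. br x (br y z) + br y (br z x) + br z (br x y) = 0)"

text \<open>
  The trace of an endomorphism \<open>f\<close> of a finite-dimensional subspace \<open>S\<close>, as the sum of the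
  diagonal coefficients in a basis of \<open>S\<close>; it does not depend on the basis chosen.
\<close>

definition trace_on :: "'a::real_vector set \<Rightarrow> ('a \<Rightarrow> 'a) \<Rightarrow> real" where
  "trace_on S f =
     (let B = (SOME B. independent B \<and> span B = S) in \<Sum>b\<in>B. representation B (f b) b)"

definition unimodular :: "('a::real_vector \<Rightarrow> 'a \<Rightarrow> 'a) \<Rightarrow> bool" where
  "unimodular br \<longleftrightarrow> (\<forall>x. trace_on UNIV (br x) = 0)"

definition derived_algebra :: "('a::real_vector \<Rightarrow> 'a \<Rightarrow> 'a) \<Rightarrow> 'a set" where
  "derived_algebra br = span {br x y | x y. True}"

definition abelian_on :: "'a::real_vector set \<Rightarrow> ('a \<Rightarrow> 'a \<Rightarrow> 'a) \<Rightarrow> bool" where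
  "abelian_on S br \<longleftrightarrow> (\<forall>x\<in>S. \<forall>y\<in>S. br x y = 0)"

text \<open>The bracket \<open>br\<close> on \<open>'a\<close> is isomorphic to the Lie algebra with carrier \<open>S\<close> and bracket \<open>br'\<close>.\<close>

definition lie_isomorphic ::
    "('a::real_vector \<Rightarrow> 'a \<Rightarrow> 'a) \<Rightarrow> 'b::real_vector set \<Rightarrow> ('b \<Rightarrow> 'b \<Rightarrow> 'b) \<Rightarrow> bool" where
  "lie_isomorphic br S br' \<longleftrightarrow>
     (\<exists>f. linear f \<and> inj f \<and> range f = S \<and> (\<forall>x y. f (br x y) = br' (f x) (f y)))"


text \<open>
  The vector \<open>s\<close> of signs encodes the signature \<open>(p,q)\<close>: the scalar product of \<open>\<real>\<^sup>p\<^sup>,\<^sup>q\<close> is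
  \<open>diag_form s\<close>, where \<open>s\<close> has \<open>p\<close> entries \<open>1\<close> and \<open>q\<close> entries \<open>-1\<close>.
\<close>

definition diag_form :: "real^'n \<Rightarrow> real^'n \<Rightarrow> real^'n \<Rightarrow> real" where
  "diag_form s x y = (\<Sum>i\<in>UNIV. s $ i * x $ i * y $ i)"

definition so_carrier :: "real^'n \<Rightarrow> (real^'n^'n) set" where
  "so_carrier s = {A. \<forall>x y. diag_form s (A *v x) y + diag_form s x (A *v y) = 0}"

definition commutator :: "real^'n^'n \<Rightarrow> real^'n^'n \<Rightarrow> real^'n^'n" where
  "commutator A B = A ** B - B ** A"

definition e_carrier :: "real^'n \<Rightarrow> ((real^'n^'n) \<times> (real^'n)) set" where
  "e_carrier s = so_carrier s \<times> UNIV"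

definition e_bracket ::
    "(real^'n^'n) \<times> (real^'n) \<Rightarrow> (real^'n^'n) \<times> (real^'n) \<Rightarrow> (real^'n^'n) \<times> (real^'n)" where
  "e_bracket p q = (commutator (fst p) (fst q), fst p *v snd q - fst q *v snd p)"

definition is_so3 :: "('a::real_vector \<Rightarrow> 'a \<Rightarrow> 'a) \<Rightarrow> bool" where
  "is_so3 br \<longleftrightarrow> lie_isomorphic br (so_carrier (vector [1, 1, 1] :: real^3)) commutator"

definition is_so21 :: "('a::real_vector \<Rightarrow> 'a \<Rightarrow> 'a) \<Rightarrow> bool" where
  "is_so21 br \<longleftrightarrow> lie_isomorphic br (so_carrier (vector [1, 1, -1] :: real^3)) commutator"

definition is_e2 :: "('a::real_vector \<Rightarrow> 'a \<Rightarrow> 'a) \<Rightarrow> bool" where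
  "is_e2 br \<longleftrightarrow> lie_isomorphic br (e_carrier (vector [1, 1] :: real^2)) e_bracket"

definition is_e11 :: "('a::real_vector \<Rightarrow> 'a \<Rightarrow> 'a) \<Rightarrow> bool" where
  "is_e11 br \<longleftrightarrow> lie_isomorphic br (e_carrier (vector [1, -1] :: real^2)) e_bracket"

definition heisenberg_bracket :: "real^3 \<Rightarrow> real^3 \<Rightarrow> real^3" where
  "heisenberg_bracket x y = vector [0, 0, x $ 1 * y $ 2 - x $ 2 * y $ 1]"

definition is_heisenberg :: "('a::real_vector \<Rightarrow> 'a \<Rightarrow> 'a) \<Rightarrow> bool" where
  "is_heisenberg br \<longleftrightarrow> lie_isomorphic br UNIV heisenberg_bracket"


definition pseudo_metric :: "('a::real_vector \<Rightarrow> 'a \<Rightarrow> real) \<Rightarrow> bool" where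
  "pseudo_metric g \<longleftrightarrow> bilinear g \<and> (\<forall>x y. g x y = g y x) \<and> (\<forall>x. (\<forall>y. g x y = 0) \<longrightarrow> x = 0)"

definition definite_on :: "'a::real_vector set \<Rightarrow> ('a \<Rightarrow> 'a \<Rightarrow> real) \<Rightarrow> bool" where
  "definite_on S g \<longleftrightarrow>
     (\<forall>x\<in>S. x \<noteq> 0 \<longrightarrow> g x x > 0) \<or> (\<forall>x\<in>S. x \<noteq> 0 \<longrightarrow> g x x < 0)"

definition indefinite_on :: "'a::real_vector set \<Rightarrow> ('a \<Rightarrow> 'a \<Rightarrow> real) \<Rightarrow> bool" where
  "indefinite_on S g \<longleftrightarrow> (\<exists>x\<in>S. g x x > 0) \<and> (\<exists>x\<in>S. g x x < 0)"

definition three_form :: "('a::real_vector \<Rightarrow> 'a \<Rightarrow> 'a \<Rightarrow> real) \<Rightarrow> bool" where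
  "three_form \<omega> \<longleftrightarrow>
     (\<forall>y z. linear (\<lambda>x. \<omega> x y z)) \<and> (\<forall>x z. linear (\<lambda>y. \<omega> x y z)) \<and> (\<forall>x y. linear (\<omega> x y)) \<and>
     (\<forall>x y. \<omega> x x y = 0 \<and> \<omega> x y y = 0 \<and> \<omega> x y x = 0)"

text \<open>
  An orientation of a three-dimensional space is represented by a nonzero 3-form \<open>\<omega>\<close>; a basis is
  oriented if \<open>\<omega>\<close> is positive on it. Only the sign of \<open>\<omega>\<close> matters.
\<close>

definition orientation :: "('a::real_vector \<Rightarrow> 'a \<Rightarrow> 'a \<Rightarrow> real) \<Rightarrow> bool" where
  "orientation \<omega> \<longleftrightarrow> three_form \<omega> \<and> (\<exists>x y z. \<omega> x y z \<noteq> 0)"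

text \<open>Bases are indexed by the type \<open>3\<close>, whose elements are \<open>1\<close>, \<open>2\<close> and \<open>3\<close> (which equals \<open>0\<close>).\<close>

definition oriented_onb ::
    "('a::real_vector \<Rightarrow> 'a \<Rightarrow> real) \<Rightarrow> ('a \<Rightarrow> 'a \<Rightarrow> 'a \<Rightarrow> real) \<Rightarrow> (3 \<Rightarrow> 'a) \<Rightarrow> bool" where
  "oriented_onb g \<omega> v \<longleftrightarrow>
     (\<forall>a. g (v a) (v a) = 1 \<or> g (v a) (v a) = -1) \<and> (\<forall>a b. a \<noteq> b \<longrightarrow> g (v a) (v b) = 0) \<and>
     \<omega> (v 1) (v 2) (v 3) > 0"

definition volume_form ::
    "('a::real_vector \<Rightarrow> 'a \<Rightarrow> real) \<Rightarrow> ('a \<Rightarrow> 'a \<Rightarrow> 'a \<Rightarrow> real) \<Rightarrow> 'a \<Rightarrow> 'a \<Rightarrow> 'a \<Rightarrow> real" where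
  "volume_form g \<omega> =
     (THE \<mu>. three_form \<mu> \<and> (\<forall>v. oriented_onb g \<omega> v \<longrightarrow> \<mu> (v 1) (v 2) (v 3) = 1))"

definition cross_product ::
    "('a::real_vector \<Rightarrow> 'a \<Rightarrow> real) \<Rightarrow> ('a \<Rightarrow> 'a \<Rightarrow> 'a \<Rightarrow> real) \<Rightarrow> 'a \<Rightarrow> 'a \<Rightarrow> 'a" where
  "cross_product g \<omega> u v = (THE x. \<forall>w. g x w = volume_form g \<omega> u v w)"

definition structure_endo ::
    "('a::real_vector \<Rightarrow> 'a \<Rightarrow> 'a) \<Rightarrow> ('a \<Rightarrow> 'a \<Rightarrow> real) \<Rightarrow> ('a \<Rightarrow> 'a \<Rightarrow> 'a \<Rightarrow> real) \<Rightarrow> 'a \<Rightarrow> 'a" where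
  "structure_endo br g \<omega> =
     (THE L. linear L \<and> (\<forall>u v. g (L u) v = g u (L v)) \<and>
        (\<forall>u v. br u v = L (cross_product g \<omega> u v)))"

definition diagonalizable :: "('a::real_vector \<Rightarrow> 'a) \<Rightarrow> bool" where
  "diagonalizable L \<longleftrightarrow>
     (\<exists>B. independent B \<and> span B = UNIV \<and> (\<forall>b\<in>B. \<exists>c. L b = c *\<^sub>R b))"

text \<open>\<open>M $ a $ b\<close> is the entry in row \<open>a\<close> and column \<open>b\<close>.\<close>

definition represented_by :: "('a::real_vector \<Rightarrow> 'a) \<Rightarrow> (3 \<Rightarrow> 'a) \<Rightarrow> real^3^3 \<Rightarrow> bool" where
  "represented_by L v M \<longleftrightarrow> (\<forall>b. L (v b) = (\<Sum>a\<in>UNIV. M $ a $ b *\<^sub>R v a))"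

text \<open>\<open>L3 \<alpha>\<close>, \<open>L4 \<alpha>\<close> and \<open>L5\<close> are the normal forms \<open>L\<^sub>3(\<alpha>,0)\<close>, \<open>L\<^sub>4(\<alpha>,0)\<close> and \<open>L\<^sub>5(0)\<close>.\<close>

definition L3 :: "real \<Rightarrow> real^3^3" where
  "L3 \<alpha> = vector [vector [0, 0, 0],
                  vector [0, 1/2 + \<alpha>, 1/2],
                  vector [0, -1/2, -1/2 + \<alpha>]]"

definition L4 :: "real \<Rightarrow> real^3^3" where
  "L4 \<alpha> = vector [vector [0, 0, 0],
                  vector [0, -1/2 + \<alpha>, -1/2],
                  vector [0, 1/2, 1/2 + \<alpha>]]"

definition L5 :: "real^3^3" where
  "L5 = (1 / sqrt 2) *\<^sub>R vector [vector [0, 1, 0],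
                                  vector [1, 0, 1],
                                  vector [0, -1, 0]]"

definition cyclic :: "(3 \<Rightarrow> 3) \<Rightarrow> bool" where
  "cyclic \<sigma> \<longleftrightarrow> (\<sigma> 1, \<sigma> 2, \<sigma> 3) \<in> {(1, 2, 3), (2, 3, 1), (3, 1, 2)}"


type_synonym 'a gen = "'a \<times> ('a \<Rightarrow>\<^sub>L real)"

definition pairing :: "'a::euclidean_space gen \<Rightarrow> 'a gen \<Rightarrow> real" where
  "pairing u v = (blinfun_apply (snd u) (fst v) + blinfun_apply (snd v) (fst u)) / 2"

definition ad_star :: "('a::euclidean_space \<Rightarrow> 'a \<Rightarrow> 'a) \<Rightarrow> 'a \<Rightarrow> ('a \<Rightarrow>\<^sub>L real) \<Rightarrow> ('a \<Rightarrow>\<^sub>L real)" where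
  "ad_star br x \<eta> = Blinfun (\<lambda>y. blinfun_apply \<eta> (br x y))"

definition dorfman ::
    "('a::euclidean_space \<Rightarrow> 'a \<Rightarrow> 'a) \<Rightarrow> ('a \<Rightarrow> 'a \<Rightarrow> 'a \<Rightarrow> real) \<Rightarrow> 'a gen \<Rightarrow> 'a gen \<Rightarrow> 'a gen" where
  "dorfman br H u v =
     (br (fst u) (fst v),
      - ad_star br (fst u) (snd v) + ad_star br (fst v) (snd u) + Blinfun (H (fst u) (fst v)))"

definition flat :: "('a::euclidean_space \<Rightarrow> 'a \<Rightarrow> real) \<Rightarrow> 'a \<Rightarrow> ('a \<Rightarrow>\<^sub>L real)" where
  "flat g x = Blinfun (g x)"

text \<open>
  The generalized metric \<open>\<G>\<^sub>g\<close> and the metric \<open>g\<close> determine each other. It enters the theory through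
  the subspaces \<open>E\<^sub>\<plusminus>\<close>, which are defined in terms of \<open>g\<close>, so \<open>g\<close> is used as the parameter.
\<close>

definition E_plus :: "('a::euclidean_space \<Rightarrow> 'a \<Rightarrow> real) \<Rightarrow> 'a gen set" where
  "E_plus g = {(x, flat g x) | x. True}"

definition E_minus :: "('a::euclidean_space \<Rightarrow> 'a \<Rightarrow> real) \<Rightarrow> 'a gen set" where
  "E_minus g = {(x, - flat g x) | x. True}"

definition gen_connection :: "('a::euclidean_space gen \<Rightarrow> 'a gen \<Rightarrow> 'a gen) \<Rightarrow> bool" where
  "gen_connection D \<longleftrightarrow> bilinear D \<and> (\<forall>u v w. pairing (D u v) w + pairing v (D u w) = 0)"

definition pairing_adjoint :: "('a::euclidean_space gen \<Rightarrow> 'a gen) \<Rightarrow> 'a gen \<Rightarrow> 'a gen" where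
  "pairing_adjoint f = (THE f'. \<forall>v w. pairing (f' v) w = pairing v (f w))"

definition torsion ::
    "('a::euclidean_space \<Rightarrow> 'a \<Rightarrow> 'a) \<Rightarrow> ('a \<Rightarrow> 'a \<Rightarrow> 'a \<Rightarrow> real) \<Rightarrow> ('a gen \<Rightarrow> 'a gen \<Rightarrow> 'a gen)
      \<Rightarrow> 'a gen \<Rightarrow> 'a gen \<Rightarrow> 'a gen" where
  "torsion br H D u v = D u v - D v u - dorfman br H u v + pairing_adjoint (\<lambda>w. D w u) v"

definition levi_civita ::
    "('a::euclidean_space \<Rightarrow> 'a \<Rightarrow> 'a) \<Rightarrow> ('a \<Rightarrow> 'a \<Rightarrow> real) \<Rightarrow> ('a \<Rightarrow> 'a \<Rightarrow> 'a \<Rightarrow> real)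
      \<Rightarrow> ('a gen \<Rightarrow> 'a gen \<Rightarrow> 'a gen) \<Rightarrow> bool" where
  "levi_civita br g H D \<longleftrightarrow> gen_connection D \<and> (\<forall>u v. torsion br H D u v = 0) \<and>
     (\<forall>u. D u ` E_plus g \<subseteq> E_plus g \<and> D u ` E_minus g \<subseteq> E_minus g)"

definition gen_divergence :: "('a::euclidean_space gen \<Rightarrow> 'a gen \<Rightarrow> 'a gen) \<Rightarrow> 'a gen \<Rightarrow> real" where
  "gen_divergence D v = trace_on UNIV (\<lambda>u. D u v)"

definition gen_curvature ::
    "('a::euclidean_space \<Rightarrow> 'a \<Rightarrow> 'a) \<Rightarrow> ('a \<Rightarrow> 'a \<Rightarrow> 'a \<Rightarrow> real) \<Rightarrow> ('a gen \<Rightarrow> 'a gen \<Rightarrow> 'a gen)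
      \<Rightarrow> 'a gen \<Rightarrow> 'a gen \<Rightarrow> 'a gen \<Rightarrow> 'a gen" where
  "gen_curvature br H D u v w = D u (D v w) - D v (D u w) - D (dorfman br H u v) w"

text \<open>
  Such a connection always exists, and the generalized Ricci tensors below do not depend on
  which one is chosen.
\<close>

definition lc_connection ::
    "('a::euclidean_space \<Rightarrow> 'a \<Rightarrow> 'a) \<Rightarrow> ('a \<Rightarrow> 'a \<Rightarrow> real) \<Rightarrow> ('a \<Rightarrow> 'a \<Rightarrow> 'a \<Rightarrow> real)
      \<Rightarrow> ('a gen \<Rightarrow> real) \<Rightarrow> 'a gen \<Rightarrow> 'a gen \<Rightarrow> 'a gen" where
  "lc_connection br g H \<delta> = (SOME D. levi_civita br g H D \<and> gen_divergence D = \<delta>)"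

definition Ric_plus ::
    "('a::euclidean_space \<Rightarrow> 'a \<Rightarrow> 'a) \<Rightarrow> ('a \<Rightarrow> 'a \<Rightarrow> real) \<Rightarrow> ('a \<Rightarrow> 'a \<Rightarrow> 'a \<Rightarrow> real)
      \<Rightarrow> ('a gen \<Rightarrow> real) \<Rightarrow> 'a gen \<Rightarrow> 'a gen \<Rightarrow> real" where
  "Ric_plus br g H \<delta> um up =
     trace_on (E_plus g) (\<lambda>w. gen_curvature br H (lc_connection br g H \<delta>) w um up)"

definition Ric_minus ::
    "('a::euclidean_space \<Rightarrow> 'a \<Rightarrow> 'a) \<Rightarrow> ('a \<Rightarrow> 'a \<Rightarrow> real) \<Rightarrow> ('a \<Rightarrow> 'a \<Rightarrow> 'a \<Rightarrow> real)
      \<Rightarrow> ('a gen \<Rightarrow> real) \<Rightarrow> 'a gen \<Rightarrow> 'a gen \<Rightarrow> real" where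
  "Ric_minus br g H \<delta> up um =
     trace_on (E_minus g) (\<lambda>w. gen_curvature br H (lc_connection br g H \<delta>) w up um)"

definition gen_einstein ::
    "('a::euclidean_space \<Rightarrow> 'a \<Rightarrow> 'a) \<Rightarrow> ('a \<Rightarrow> 'a \<Rightarrow> real) \<Rightarrow> ('a \<Rightarrow> 'a \<Rightarrow> 'a \<Rightarrow> real)
      \<Rightarrow> ('a gen \<Rightarrow> real) \<Rightarrow> bool" where
  "gen_einstein br g H \<delta> \<longleftrightarrow> pseudo_metric g \<and> three_form H \<and> linear \<delta> \<and>
     (\<forall>um\<in>E_minus g. \<forall>up\<in>E_plus g. Ric_plus br g H \<delta> um up = 0 \<and> Ric_minus br g H \<delta> up um = 0)"

text \<open>\<open>comp_plus g \<delta> v a\<close> is \<open>\<delta>\<^sub>a\<close> and \<open>comp_minus g \<delta> v a\<close> is \<open>\<delta>\<close> with index \<open>a+3\<close>.\<close>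

definition comp_plus ::
    "('a::euclidean_space \<Rightarrow> 'a \<Rightarrow> real) \<Rightarrow> ('a gen \<Rightarrow> real) \<Rightarrow> (3 \<Rightarrow> 'a) \<Rightarrow> 3 \<Rightarrow> real" where
  "comp_plus g \<delta> v a = \<delta> (v a, flat g (v a))"

definition comp_minus ::
    "('a::euclidean_space \<Rightarrow> 'a \<Rightarrow> real) \<Rightarrow> ('a gen \<Rightarrow> real) \<Rightarrow> (3 \<Rightarrow> 'a) \<Rightarrow> 3 \<Rightarrow> real" where
  "comp_minus g \<delta> v a = \<delta> (v a, - flat g (v a))"


definition adapted_basis ::
    "('a::real_vector \<Rightarrow> 'a \<Rightarrow> 'a) \<Rightarrow> ('a \<Rightarrow> 'a \<Rightarrow> real) \<Rightarrow> ('a \<Rightarrow> 'a \<Rightarrow> 'a \<Rightarrow> real)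
      \<Rightarrow> ('a \<Rightarrow> 'a \<Rightarrow> 'a \<Rightarrow> real) \<Rightarrow> (3 \<Rightarrow> 'a) \<Rightarrow> (3 \<Rightarrow> real) \<Rightarrow> real \<Rightarrow> bool" where
  "adapted_basis br g \<omega> H v \<alpha> h \<longleftrightarrow> oriented_onb g \<omega> v \<and>
     (\<forall>\<sigma>. cyclic \<sigma> \<longrightarrow>
        br (v (\<sigma> 1)) (v (\<sigma> 2)) = (\<alpha> (\<sigma> 3) * g (v (\<sigma> 3)) (v (\<sigma> 3))) *\<^sub>R v (\<sigma> 3)) \<and>
     H = (\<lambda>x y z. h * volume_form g \<omega> x y z) \<and>
     g (v 1) (v 1) = g (v 2) (v 2)"

definition values1 :: "(3 \<Rightarrow> real) \<Rightarrow> real \<Rightarrow> bool" where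
  "values1 \<alpha> h \<longleftrightarrow> \<alpha> 1 = 0 \<and> \<alpha> 2 = 0 \<and> \<alpha> 3 = 0 \<and> h = 0"

definition values2 :: "(3 \<Rightarrow> real) \<Rightarrow> real \<Rightarrow> bool" where
  "values2 \<alpha> h \<longleftrightarrow> \<alpha> 1 = \<alpha> 2 \<and> \<alpha> 2 = \<alpha> 3 \<and> (\<alpha> 1 = h \<or> \<alpha> 1 = - h) \<and> h \<noteq> 0"

definition values3 :: "(3 \<Rightarrow> 3) \<Rightarrow> (3 \<Rightarrow> real) \<Rightarrow> real \<Rightarrow> bool" where
  "values3 \<sigma> \<alpha> h \<longleftrightarrow>
     cyclic \<sigma> \<and> \<alpha> (\<sigma> 1) = \<alpha> (\<sigma> 2) \<and> \<alpha> (\<sigma> 2) \<noteq> 0 \<and> h = 0 \<and> \<alpha> (\<sigma> 3) = 0"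

end

(*
  The form (u,v,w) |-> <[u,v]_H, w> on E is totally skew. Vanishing torsion and D E+- <= E+- force
  D_u v = pr_+ [u,v]_H for u in E-, v in E+, and this is all that enters the Ricci tensor: with
  e_a = v_a + g v_a, f_a = v_a - g v_a and B(u,v,w) = <[u,v]_H, w>,
    Ric+(u,w) = delta(pr_+ [u,w]_H) + sum_{a,b} eps_a eps_b B(e_a,u,f_b) B(f_b,w,e_a),
  and Ric- is Ric+ for the metric -g, which exchanges E+ and E-. In an orthonormal basis B is given by
  h and the symmetric matrix g(L v_a, v_b), so that the Einstein condition becomes 18 polynomial
  equations.

  If L is diagonalizable with eigenvalues x, y, z in an orthonormal basis, the equations without delta
  say that XY = XZ = YZ = h^2 for X = x+y-z, Y = x-y+z, Z = y+z-x, which gives the three cases.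
  Otherwise L either has an eigenvector that is not null and a 2x2 block without real distinct
  eigenvalues on its complement, or all its eigenvectors are null and L = l + N with N nilpotent of
  order 3. In both situations the equations force h = 0, the isolated eigenvalue to vanish, and a
  boost brings L to the normal form.
*)
theory Submission
  imports Defs
begin


section \<open>Traces and orthonormal frames\<close>

lemma trace_on_frame:
  fixes f :: "'v::real_vector \<Rightarrow> 'v" and e :: "'i \<Rightarrow> 'v" and \<phi> :: "'i \<Rightarrow> 'v \<Rightarrow> real"
  assumes I: "finite I" and S: "subspace S" and f: "linear f" and fS: "\<And>x. x \<in> S \<Longrightarrow> f x \<in> S"
    and e: "\<And>i. i \<in> I \<Longrightarrow> e i \<in> S" and \<phi>: "\<And>i. i \<in> I \<Longrightarrow> linear (\<phi> i)"
    and frame: "\<And>x. x \<in> S \<Longrightarrow> x = (\<Sum>i\<in>I. \<phi> i x *\<^sub>R e i)"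
  shows "trace_on S f = (\<Sum>i\<in>I. \<phi> i (f (e i)))"
proof -
  define B where "B = (SOME B. independent B \<and> span B = S)"
  obtain B0 where "B0 \<subseteq> S" "independent B0" "S \<subseteq> span B0"
    using maximal_independent_subset[of S] by blast
  then have "independent B0 \<and> span B0 = S"
    by (metis S span_mono span_subspace subset_antisym span_eq_iff)
  then have B: "independent B \<and> span B = S"
    unfolding B_def by (rule someI)
  have "S \<subseteq> span (e ` I)"
  proof
    fix x assume "x \<in> S"
    then have "x = (\<Sum>i\<in>I. \<phi> i x *\<^sub>R e i)" by (rule frame)
    also have "\<dots> \<in> span (e ` I)" by (intro span_sum span_scale span_base) auto
    finally show "x \<in> span (e ` I)" .
  qed
  then have finB: "finite B"
    using B I by (metis finite_imageI independent_span_bound span_superset subset_trans)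
  have BS: "b \<in> S" if "b \<in> B" for b using that B span_base by blast
  let ?r = "\<lambda>x b. representation B x b"
  have lin_r: "?r (\<Sum>i\<in>I. c i *\<^sub>R e i) b = (\<Sum>i\<in>I. c i * ?r (e i) b)" for c b
  proof -
    have "?r (\<Sum>i\<in>I. c i *\<^sub>R e i) b = (\<Sum>i\<in>I. ?r (c i *\<^sub>R e i) b)"
      using representation_sum[of B I "\<lambda>i. c i *\<^sub>R e i"] B e
      by (simp add: subspace_scale[OF S] S)
    also have "\<dots> = (\<Sum>i\<in>I. c i * ?r (e i) b)"
      using B e by (intro sum.cong) (auto simp: representation_scale)
    finally show ?thesis .
  qed
  have "trace_on S f = (\<Sum>b\<in>B. ?r (f b) b)"
    by (simp add: trace_on_def B_def Let_def)
  also have "\<dots> = (\<Sum>b\<in>B. \<Sum>i\<in>I. \<phi> i (f b) * ?r (e i) b)"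
  proof (rule sum.cong)
    fix b assume "b \<in> B"
    then have "f b = (\<Sum>i\<in>I. \<phi> i (f b) *\<^sub>R e i)" by (intro frame fS BS)
    then show "?r (f b) b = (\<Sum>i\<in>I. \<phi> i (f b) * ?r (e i) b)" using lin_r by metis
  qed simp
  also have "\<dots> = (\<Sum>i\<in>I. \<Sum>b\<in>B. \<phi> i (f b) * ?r (e i) b)" by (rule sum.swap)
  also have "\<dots> = (\<Sum>i\<in>I. \<phi> i (f (e i)))"
  proof (rule sum.cong)
    fix i assume i: "i \<in> I"
    have "e i = (\<Sum>b\<in>B. ?r (e i) b *\<^sub>R b)"
      using sum_representation_eq[of B "e i" B] B finB e[OF i] by auto
    then have "\<phi> i (f (e i)) = \<phi> i (f (\<Sum>b\<in>B. ?r (e i) b *\<^sub>R b))" by simp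
    also have "\<dots> = (\<Sum>b\<in>B. ?r (e i) b * \<phi> i (f b))"
      by (simp add: linear_sum[OF f] linear_sum[OF \<phi>[OF i]] linear_scale[OF f] linear_scale[OF \<phi>[OF i]])
    finally show "(\<Sum>b\<in>B. \<phi> i (f b) * ?r (e i) b) = \<phi> i (f (e i))"
      by (simp add: mult.commute)
  qed simp
  finally show ?thesis .
qed

lemma Blinfun_linear [simp]:
  fixes f :: "'a::euclidean_space \<Rightarrow> 'b::real_normed_vector"
  shows "linear f \<Longrightarrow> blinfun_apply (Blinfun f) x = f x"
  by (simp add: bounded_linear_Blinfun_apply linear_conv_bounded_linear)

lemma bilinear_linear_right: "bilinear f \<Longrightarrow> linear (f x)"
  and bilinear_linear_left: "bilinear f \<Longrightarrow> linear (\<lambda>x. f x y)"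
  by (auto simp: bilinear_def)

lemmas bilinear_simps = bilinear_ladd bilinear_radd bilinear_lmul bilinear_rmul
  bilinear_lneg bilinear_rneg bilinear_lsub bilinear_rsub bilinear_lzero bilinear_rzero

lemma bilinear_sum_left: "bilinear f \<Longrightarrow> f (\<Sum>i\<in>I. c i *\<^sub>R e i) y = (\<Sum>i\<in>I. c i *\<^sub>R f (e i) y)"
  using linear_sum[OF bilinear_linear_left] linear_scale[OF bilinear_linear_left]
  by (metis (mono_tags, lifting) sum.cong)

lemma bilinear_sum_right: "bilinear f \<Longrightarrow> f x (\<Sum>i\<in>I. c i *\<^sub>R e i) = (\<Sum>i\<in>I. c i *\<^sub>R f x (e i))"
  using linear_sum[OF bilinear_linear_right] linear_scale[OF bilinear_linear_right]
  by (metis (mono_tags, lifting) sum.cong)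

lemma alternating_skew:
  assumes "bilinear f" "\<And>x. f x x = 0" shows "f x y = - f y x"
proof -
  have "f x y + f y x = 0" using assms(2)[of "x + y"]
    by (simp only: bilinear_simps[OF assms(1)]) (simp add: assms(2) add.commute)
  then show ?thesis by (simp add: eq_neg_iff_add_eq_0)
qed

lemma pairing_bilinear: "bilinear pairing"
  unfolding bilinear_def pairing_def
  by (auto intro!: linearI simp: blinfun.bilinear_simps algebra_simps add_divide_distrib)

lemma pairing_commute: "pairing u v = pairing v u"
  by (simp add: pairing_def)

locale metric_frame =
  fixes g :: "'a::euclidean_space \<Rightarrow> 'a \<Rightarrow> real" and v :: "3 \<Rightarrow> 'a" and \<epsilon> :: "3 \<Rightarrow> real"
  assumes dim3: "DIM('a) = 3"
    and g_bilinear: "bilinear g"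
    and g_commute: "g x y = g y x"
    and sign: "\<epsilon> a * \<epsilon> a = 1"
    and orthonormal: "g (v a) (v b) = (if a = b then \<epsilon> a else 0)"
begin

lemma sign_nonzero: "\<epsilon> a \<noteq> 0"
  using sign[of a] by auto

lemma g_sum_frame: "g (\<Sum>a\<in>UNIV. c a *\<^sub>R v a) (v b) = c b * \<epsilon> b"
  by (simp add: bilinear_sum_left[OF g_bilinear] orthonormal if_distrib cong: if_cong)

lemma inj_frame: "inj v"
  using orthonormal sign_nonzero by (metis injI)

lemma independent_frame: "independent (range v)"
proof (rule independent_if_scalars_zero)
  fix f x assume s: "(\<Sum>x\<in>range v. f x *\<^sub>R x) = 0" and x: "x \<in> range v"
  obtain b where b: "x = v b" using x by auto
  have "(\<Sum>a\<in>UNIV. f (v a) *\<^sub>R v a) = 0"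
    using s by (simp add: sum.reindex[OF inj_frame] o_def)
  then have "f (v b) * \<epsilon> b = 0"
    using g_sum_frame[of "\<lambda>a. f (v a)" b] by (simp add: bilinear_simps[OF g_bilinear])
  then show "f x = 0" using sign_nonzero b by simp
qed simp

lemma span_frame: "span (range v) = UNIV"
proof -
  have "card (range v) = 3" using card_image[OF inj_frame] by simp
  then show ?thesis
    using independent_frame dim3
    by (metis card_ge_dim_independent dim_UNIV subset_UNIV le_refl top.extremum_uniqueI)
qed

lemma frame_expand: "x = (\<Sum>a\<in>UNIV. (\<epsilon> a * g x (v a)) *\<^sub>R v a)"
proof -
  have "x \<in> span (range v)" by (simp add: span_frame)
  then obtain c where "x = (\<Sum>y\<in>range v. c y *\<^sub>R y)"
    by (auto simp: span_finite)
  then have x: "x = (\<Sum>a\<in>UNIV. c (v a) *\<^sub>R v a)"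
    by (simp add: sum.reindex[OF inj_frame] o_def)
  have "\<epsilon> a * g x (v a) = c (v a)" for a
    using g_sum_frame[of "\<lambda>a. c (v a)" a] x sign[of a] by simp
  then show ?thesis using x by simp
qed

lemma g_nondegenerate: "(\<And>a. g x (v a) = 0) \<Longrightarrow> x = 0"
  using frame_expand[of x] by simp

lemma eq_iff_g: "x = y \<longleftrightarrow> (\<forall>a. g x (v a) = g y (v a))"
  using g_nondegenerate[of "x - y"] by (auto simp: bilinear_simps[OF g_bilinear])

lemma g_expand: "g x y = (\<Sum>a\<in>UNIV. \<epsilon> a * g x (v a) * g y (v a))"
proof -
  have "g x y = g (\<Sum>a\<in>UNIV. (\<epsilon> a * g x (v a)) *\<^sub>R v a) y" using frame_expand by metis
  then show ?thesis by (simp add: bilinear_sum_left[OF g_bilinear] g_commute[of y])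
qed

lemma linear_frame_expand:
  assumes "linear f" shows "f x = (\<Sum>a\<in>UNIV. (\<epsilon> a * g x (v a)) *\<^sub>R f (v a))"
proof -
  have "f x = f (\<Sum>a\<in>UNIV. (\<epsilon> a * g x (v a)) *\<^sub>R v a)" using frame_expand by metis
  then show ?thesis by (simp add: linear_sum[OF assms] linear_scale[OF assms])
qed

lemma pseudo_metric: "pseudo_metric g"
  unfolding pseudo_metric_def using g_bilinear g_commute g_nondegenerate by blast

lemma metric_frame_uminus: "metric_frame (\<lambda>x y. - g x y) v (\<lambda>a. - \<epsilon> a)"
proof
  show "bilinear (\<lambda>x y. - g x y)"
    using g_bilinear by (simp add: bilinear_def module_hom_neg linear_compose_neg)
qed (use dim3 g_commute sign orthonormal in auto)

lemma trace_on_UNIV_frame: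
  assumes "linear f"
  shows "trace_on UNIV f = (\<Sum>a\<in>UNIV. \<epsilon> a * g (f (v a)) (v a))"
proof -
  have "linear (\<lambda>x. \<epsilon> a * g x (v a))" for a
    by (rule linearI) (simp_all add: bilinear_simps[OF g_bilinear] algebra_simps)
  then show ?thesis
    using trace_on_frame[of UNIV UNIV f v "\<lambda>a x. \<epsilon> a * g x (v a)"] assms frame_expand by simp
qed

end


section \<open>The Dorfman bracket in an orthonormal frame\<close>

lemma three_form_linear:
  assumes "three_form \<omega>"
  shows "linear (\<lambda>x. \<omega> x y z)" "linear (\<lambda>y. \<omega> x y z)" "linear (\<omega> x y)"
  using assms by (auto simp: three_form_def)

lemmas three_form_add = three_form_linear[THEN linear_add]
  and three_form_scale = three_form_linear[THEN linear_scale]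

lemma three_form_repeat:
  assumes "three_form \<omega>" shows "\<omega> x x y = 0" "\<omega> x y y = 0" "\<omega> x y x = 0"
  using assms unfolding three_form_def by blast+

lemma three_form_skew:
  assumes "three_form \<omega>" shows "\<omega> y x z = - \<omega> x y z" "\<omega> x z y = - \<omega> x y z"
proof -
  have "\<omega> (x + y) (x + y) z = 0" "\<omega> x (y + z) (y + z) = 0" by (rule three_form_repeat[OF assms])+
  then have "\<omega> y x z + \<omega> x y z = 0" "\<omega> x z y + \<omega> x y z = 0"
    unfolding three_form_add[OF assms] by (simp_all add: three_form_repeat[OF assms])
  then show "\<omega> y x z = - \<omega> x y z" "\<omega> x z y = - \<omega> x y z" by linarith+
qed

locale einstein_frame = metric_frame g v \<epsilon>
  for g :: "'a::euclidean_space \<Rightarrow> 'a \<Rightarrow> real" and v :: "3 \<Rightarrow> 'a" and \<epsilon> :: "3 \<Rightarrow> real" +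
  fixes br :: "'a \<Rightarrow> 'a \<Rightarrow> 'a" and H :: "'a \<Rightarrow> 'a \<Rightarrow> 'a \<Rightarrow> real"
  assumes br_bilinear: "bilinear br" and br_alternating: "br x x = 0"
    and H_three_form: "three_form H"
begin

text \<open>
  Replacing \<open>g\<close> by \<open>-g\<close> exchanges \<open>E\<^sub>+\<close> and \<open>E\<^sub>-\<close>, so statements are proved for one sign only.
\<close>

lemma einstein_frame_uminus: "einstein_frame (\<lambda>x y. - g x y) v (\<lambda>a. - \<epsilon> a) br H"
  by (intro einstein_frame.intro metric_frame_uminus einstein_frame_axioms.intro
      br_bilinear br_alternating H_three_form)

lemmas br_skew = alternating_skew[OF br_bilinear br_alternating]

lemmas H_linear = three_form_linear[OF H_three_form]
  and H_skew = three_form_skew[OF H_three_form]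
  and H_add = three_form_add[OF H_three_form]
  and H_scale = three_form_scale[OF H_three_form]

abbreviation dorf :: "'a gen \<Rightarrow> 'a gen \<Rightarrow> 'a gen" where "dorf \<equiv> dorfman br H"

lemma ad_star_apply: "blinfun_apply (ad_star br x \<eta>) y = blinfun_apply \<eta> (br x y)"
  unfolding ad_star_def
  by (rule Blinfun_linear)
    (auto intro!: linearI simp: bilinear_simps[OF br_bilinear] blinfun.bilinear_simps)

lemma flat_apply [simp]: "blinfun_apply (flat g x) y = g x y"
  unfolding flat_def by (rule Blinfun_linear) (rule bilinear_linear_right[OF g_bilinear])

lemma flat_uminus: "flat (\<lambda>x y. - g x y) x = - flat g x"
proof -
  interpret neg: einstein_frame "\<lambda>x y. - g x y" v "\<lambda>a. - \<epsilon> a" br H by (rule einstein_frame_uminus)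
  show ?thesis by (rule blinfun_eqI) (simp add: blinfun.bilinear_simps)
qed

lemma linear_flat: "linear (flat g)"
  by (rule linearI; rule blinfun_eqI) (simp_all add: blinfun.bilinear_simps bilinear_simps[OF g_bilinear])

lemma E_plus_uminus: "E_plus (\<lambda>x y. - g x y) = E_minus g"
  and E_minus_uminus: "E_minus (\<lambda>x y. - g x y) = E_plus g"
  by (simp_all add: E_plus_def E_minus_def flat_uminus)

definition dorfman_form :: "'a gen \<Rightarrow> 'a gen \<Rightarrow> 'a gen \<Rightarrow> real" where
  "dorfman_form u w z = pairing (dorf u w) z"

lemma dorfman_form_eq:
  "dorfman_form u w z = (snd z (br (fst u) (fst w)) - snd w (br (fst u) (fst z)) +
     snd u (br (fst w) (fst z)) + H (fst u) (fst w) (fst z)) / 2"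
  by (simp add: dorfman_form_def dorfman_def pairing_def blinfun.bilinear_simps ad_star_apply H_linear)

lemma pairing_nondegenerate: "(\<And>w. pairing u w = 0) \<Longrightarrow> u = (0 :: 'a gen)"
proof -
  assume *: "\<And>w. pairing u w = 0"
  have "blinfun_apply (snd u) x = 0" for x
    using *[of "(x, 0)"] by (simp add: pairing_def)
  then have 2: "snd u = 0" by (intro blinfun_eqI) simp
  have "g (fst u) x = 0" for x
    using *[of "(0, flat g x)"] by (simp add: pairing_def g_commute)
  then have "fst u = 0" by (intro g_nondegenerate)
  with 2 show "u = 0" by (simp add: prod_eq_iff)
qed

lemma pairing_eqI: "(\<And>w. pairing u w = pairing u' w) \<Longrightarrow> u = (u' :: 'a gen)"
  using pairing_nondegenerate[of "u - u'"] by (simp add: bilinear_simps[OF pairing_bilinear])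

lemma dorfman_form_skew12: "dorfman_form w u z = - dorfman_form u w z"
  unfolding dorfman_form_eq
  by (subst br_skew[of "fst w" "fst u"]) (simp add: H_skew(1)[of "fst w"] blinfun.bilinear_simps field_simps)

lemma dorfman_form_skew23: "dorfman_form u z w = - dorfman_form u w z"
  unfolding dorfman_form_eq
  by (subst br_skew[of "fst z" "fst w"]) (simp add: H_skew(2)[of "fst u" "fst z"] blinfun.bilinear_simps field_simps)

lemma linear_dorfman_form: "linear (\<lambda>u. dorfman_form u w z)" "linear (\<lambda>w. dorfman_form u w z)"
    "linear (dorfman_form u w)"
  by (rule linearI; simp add: dorfman_form_eq bilinear_simps[OF br_bilinear]
      blinfun.bilinear_simps H_add H_scale field_simps)+

lemmas dorfman_form_add = linear_dorfman_form[THEN linear_add]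
  and dorfman_form_scale = linear_dorfman_form[THEN linear_scale]

lemma dorfman_bilinear: "bilinear dorf"
  unfolding bilinear_def
  by (intro conjI allI linearI; rule pairing_eqI;
      simp add: bilinear_simps[OF pairing_bilinear] flip: dorfman_form_def;
      simp add: dorfman_form_add dorfman_form_scale)

definition ep :: "3 \<Rightarrow> 'a gen" where "ep a = (v a, flat g (v a))"
definition em :: "3 \<Rightarrow> 'a gen" where "em a = (v a, - flat g (v a))"

lemma pairing_frame [simp]:
  "pairing (ep a) (ep b) = (if a = b then \<epsilon> a else 0)"
  "pairing (em a) (em b) = (if a = b then - \<epsilon> a else 0)"
  "pairing (ep a) (em b) = 0" "pairing (em a) (ep b) = 0"
  by (simp_all add: pairing_def ep_def em_def orthonormal blinfun.bilinear_simps)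

definition proj_plus :: "'a gen \<Rightarrow> 'a gen" where
  "proj_plus u = (\<Sum>a\<in>UNIV. (\<epsilon> a * pairing u (ep a)) *\<^sub>R ep a)"
definition proj_minus :: "'a gen \<Rightarrow> 'a gen" where
  "proj_minus u = (\<Sum>a\<in>UNIV. (- \<epsilon> a * pairing u (em a)) *\<^sub>R em a)"

lemma linear_proj_plus: "linear proj_plus"
  unfolding proj_plus_def
  by (rule linearI) (simp_all add: bilinear_simps[OF pairing_bilinear] algebra_simps
      sum.distrib scaleR_sum_right)

lemma linear_proj_minus: "linear proj_minus"
  unfolding proj_minus_def
  by (rule linearI) (simp_all add: bilinear_simps[OF pairing_bilinear] algebra_simps
      sum.distrib sum_negf scaleR_sum_right sum_subtractf)

lemma fst_sum': "fst (\<Sum>a\<in>A. c a *\<^sub>R u a) = (\<Sum>a\<in>A. c a *\<^sub>R fst (u a))"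
  and snd_sum': "snd (\<Sum>a\<in>A. c a *\<^sub>R u a) = (\<Sum>a\<in>A. c a *\<^sub>R snd (u a))"
  by (simp_all add: fst_sum snd_sum)

lemma proj_decompose: "u = proj_plus u + proj_minus u"
proof -
  obtain x \<xi> where u: "u = (x, \<xi>)" by (cases u)
  have 1: "pairing u (ep a) = (g x (v a) + blinfun_apply \<xi> (v a)) / 2"
    and 2: "- pairing u (em a) = (g x (v a) - blinfun_apply \<xi> (v a)) / 2" for a
    by (simp_all add: u pairing_def ep_def em_def blinfun.bilinear_simps g_commute algebra_simps
        minus_divide_left)
  have "fst (proj_plus u + proj_minus u) =
      (\<Sum>a\<in>UNIV. (\<epsilon> a * pairing u (ep a) + \<epsilon> a * (- pairing u (em a))) *\<^sub>R v a)"
    unfolding fst_add unfolding proj_plus_def proj_minus_def fst_sum' sum.distrib[symmetric]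
    by (simp add: ep_def em_def algebra_simps)
  also have "\<dots> = (\<Sum>a\<in>UNIV. (\<epsilon> a * g x (v a)) *\<^sub>R v a)"
    unfolding 1 2 by (intro sum.cong refl) (simp add: field_simps)
  also have "\<dots> = x" using frame_expand by simp
  finally have f: "fst (proj_plus u + proj_minus u) = x" .
  have "snd (proj_plus u + proj_minus u) =
      (\<Sum>a\<in>UNIV. (\<epsilon> a * pairing u (ep a) - \<epsilon> a * (- pairing u (em a))) *\<^sub>R flat g (v a))"
    unfolding snd_add unfolding proj_plus_def proj_minus_def snd_sum' sum.distrib[symmetric]
    by (simp add: ep_def em_def algebra_simps)
  also have "\<dots> = (\<Sum>a\<in>UNIV. (\<epsilon> a * blinfun_apply \<xi> (v a)) *\<^sub>R flat g (v a))"
    unfolding 1 2 by (intro sum.cong refl) (simp add: field_simps)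
  also have "\<dots> = \<xi>"
  proof (rule blinfun_eqI)
    fix y
    have "blinfun_apply (\<Sum>a\<in>UNIV. (\<epsilon> a * blinfun_apply \<xi> (v a)) *\<^sub>R flat g (v a)) y =
        (\<Sum>a\<in>UNIV. (\<epsilon> a * g y (v a)) *\<^sub>R blinfun_apply \<xi> (v a))"
      by (simp add: blinfun.sum_left blinfun.bilinear_simps g_commute[of y] algebra_simps)
    also have "\<dots> = blinfun_apply \<xi> y"
      by (rule linear_frame_expand[symmetric]) (simp add: bounded_linear.linear blinfun.bounded_linear_right)
    finally show "blinfun_apply (\<Sum>a\<in>UNIV. (\<epsilon> a * blinfun_apply \<xi> (v a)) *\<^sub>R flat g (v a)) y =
      blinfun_apply \<xi> y" .
  qed
  finally have "proj_plus u + proj_minus u = (x, \<xi>)" using f by (intro prod_eqI) simp_all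
  then show ?thesis using u by simp
qed

lemma subspace_E_plus: "subspace (E_plus g)"
  unfolding subspace_def E_plus_def
  using linear_add[OF linear_flat] linear_scale[OF linear_flat] linear_0[OF linear_flat]
  by (auto simp: zero_prod_def)

lemma subspace_E_minus: "subspace (E_minus g)"
  using einstein_frame.subspace_E_plus[OF einstein_frame_uminus] by (simp add: E_plus_uminus)

lemma ep_in: "ep a \<in> E_plus g" and em_in: "em a \<in> E_minus g"
  by (auto simp: ep_def em_def E_plus_def E_minus_def)

lemma proj_plus_in: "proj_plus u \<in> E_plus g"
  unfolding proj_plus_def by (intro subspace_sum subspace_scale subspace_E_plus ep_in)

lemma proj_minus_in: "proj_minus u \<in> E_minus g"
  unfolding proj_minus_def by (intro subspace_sum subspace_scale subspace_E_minus em_in)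

lemma pairing_plus_minus: "u \<in> E_plus g \<Longrightarrow> w \<in> E_minus g \<Longrightarrow> pairing u w = 0"
  by (auto simp: E_plus_def E_minus_def pairing_def blinfun.bilinear_simps g_commute)

lemma pairing_minus_plus: "u \<in> E_minus g \<Longrightarrow> w \<in> E_plus g \<Longrightarrow> pairing u w = 0"
  using pairing_plus_minus pairing_commute by metis

lemma proj_of_plus: assumes "u \<in> E_plus g" shows "proj_minus u = 0" "proj_plus u = u"
proof -
  show "proj_minus u = 0" by (simp add: proj_minus_def pairing_plus_minus[OF assms em_in])
  then show "proj_plus u = u" using proj_decompose[of u] by simp
qed

lemma proj_of_minus: assumes "u \<in> E_minus g" shows "proj_plus u = 0" "proj_minus u = u"
proof -
  show "proj_plus u = 0" by (simp add: proj_plus_def pairing_minus_plus[OF assms ep_in])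
  then show "proj_minus u = u" using proj_decompose[of u] by simp
qed

lemma E_plusI: "(\<And>a. pairing u (em a) = 0) \<Longrightarrow> u \<in> E_plus g"
  using proj_decompose[of u] proj_plus_in[of u] by (simp add: proj_minus_def)

lemma E_minusI: "(\<And>a. pairing u (ep a) = 0) \<Longrightarrow> u \<in> E_minus g"
  using proj_decompose[of u] proj_minus_in[of u] by (simp add: proj_plus_def)

lemma linear_pairing_left: "linear (\<lambda>u. c * pairing u w)"
  by (rule linearI) (simp_all add: bilinear_simps[OF pairing_bilinear] algebra_simps)

lemma trace_on_E_plus:
  assumes "linear f" "\<And>u. u \<in> E_plus g \<Longrightarrow> f u \<in> E_plus g"
  shows "trace_on (E_plus g) f = (\<Sum>a\<in>UNIV. \<epsilon> a * pairing (f (ep a)) (ep a))"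
proof (rule trace_on_frame)
  fix u assume "u \<in> E_plus g"
  then show "u = (\<Sum>a\<in>UNIV. (\<epsilon> a * pairing u (ep a)) *\<^sub>R ep a)"
    using proj_of_plus(2)[of u] by (simp add: proj_plus_def)
qed (use assms subspace_E_plus ep_in in \<open>auto intro: linear_pairing_left\<close>)

lemma trace_on_gen:
  assumes "linear f"
  shows "trace_on UNIV f = (\<Sum>a\<in>UNIV. \<epsilon> a * pairing (f (ep a)) (ep a)) -
    (\<Sum>a\<in>UNIV. \<epsilon> a * pairing (f (em a)) (em a))"
proof -
  let ?e = "case_sum ep em" and ?s = "case_sum \<epsilon> (\<lambda>a. - \<epsilon> a)"
  have sum_Plus: "(\<Sum>i\<in>(UNIV::(3 + 3) set). F i) = (\<Sum>a\<in>UNIV. F (Inl a)) + (\<Sum>a\<in>UNIV. F (Inr a))"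
    for F :: "3 + 3 \<Rightarrow> 'b::comm_monoid_add"
    by (simp add: UNIV_Plus_UNIV[symmetric] sum.Plus del: UNIV_Plus_UNIV)
  have "trace_on UNIV f = (\<Sum>i\<in>UNIV. ?s i * pairing (f (?e i)) (?e i))"
  proof (rule trace_on_frame)
    fix u show "u = (\<Sum>i\<in>UNIV. (?s i * pairing u (?e i)) *\<^sub>R ?e i)"
      using proj_decompose[of u] by (simp add: sum_Plus proj_plus_def proj_minus_def)
  qed (use assms in \<open>auto intro: linear_pairing_left\<close>)
  then show ?thesis by (simp add: sum_Plus sum_negf)
qed

definition sharp :: "('a gen \<Rightarrow> real) \<Rightarrow> 'a gen" where
  "sharp \<phi> = (\<Sum>a\<in>UNIV. (\<epsilon> a * \<phi> (ep a)) *\<^sub>R ep a) + (\<Sum>a\<in>UNIV. (- \<epsilon> a * \<phi> (em a)) *\<^sub>R em a)"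

lemma pairing_sharp:
  assumes \<phi>: "linear \<phi>" shows "pairing (sharp \<phi>) w = \<phi> w"
proof -
  have "\<phi> w = \<phi> (proj_plus w + proj_minus w)" using proj_decompose by simp
  also have "\<dots> = (\<Sum>a\<in>UNIV. (\<epsilon> a * pairing w (ep a)) *\<^sub>R \<phi> (ep a)) +
      (\<Sum>a\<in>UNIV. (- \<epsilon> a * pairing w (em a)) *\<^sub>R \<phi> (em a))"
    by (simp only: linear_add[OF \<phi>] proj_plus_def proj_minus_def linear_sum[OF \<phi>] linear_scale[OF \<phi>])
  finally show ?thesis
    by (simp only: sharp_def bilinear_simps[OF pairing_bilinear] bilinear_sum_left[OF pairing_bilinear]
        bilinear_sum_right[OF pairing_bilinear] real_scaleR_def pairing_commute[of w] mult_ac)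
qed

lemma pairing_adjoint:
  assumes f: "linear (f :: 'a gen \<Rightarrow> 'a gen)"
  shows "pairing (pairing_adjoint f u) w = pairing u (f w)"
proof -
  define f' where "f' u = sharp (\<lambda>w. pairing u (f w))" for u
  have f': "pairing (f' u) w = pairing u (f w)" for u w
    unfolding f'_def
    by (rule pairing_sharp)
      (intro linearI; simp only: linear_add[OF f] linear_scale[OF f] bilinear_simps[OF pairing_bilinear])
  have "pairing_adjoint f = f'"
    unfolding pairing_adjoint_def
  proof (rule the_equality)
    fix h assume "\<forall>u w. pairing (h u) w = pairing u (f w)"
    then have "pairing (h u) w = pairing (f' u) w" for u w by (simp only: f')
    then show "h = f'" by (intro ext pairing_eqI)
  qed (use f' in blast)
  then show ?thesis using f' by simp
qed

end


section \<open>Levi-Civita connections and the Ricci tensors\<close>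

context einstein_frame
begin

lemma dorfman_form_cyclic: "dorfman_form w z u = dorfman_form u w z"
  using dorfman_form_skew12 dorfman_form_skew23 by (metis minus_minus)

lemma dorfman_form_repeat: "dorfman_form u w u = 0"
  using dorfman_form_skew12[of u w u] dorfman_form_skew23[of w u u] by simp

lemma torsion_pairing:
  assumes "gen_connection D"
  shows "pairing (torsion br H D u w) z =
    pairing (D u w) z + pairing (D w z) u + pairing (D z u) w - dorfman_form u w z"
proof -
  have D: "bilinear D" and so: "pairing (D u w) z = - pairing w (D u z)" for u w z
    using assms unfolding gen_connection_def by (blast, metis eq_neg_iff_add_eq_0)
  have "pairing (pairing_adjoint (\<lambda>w. D w u) w) z = pairing w (D z u)"
    by (rule pairing_adjoint) (rule bilinear_linear_left[OF D])
  moreover have "pairing (D w u) z = - pairing (D w z) u"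
    using so[of w u z] pairing_commute[of u] by simp
  ultimately show ?thesis
    by (simp add: torsion_def bilinear_simps[OF pairing_bilinear] dorfman_form_def pairing_commute[of w])
qed

text \<open>
  The mixed components of a Levi-Civita connection are forced by the torsion. A pure part whose
  cyclic sum vanishes may be added freely; the one chosen here adjusts the divergence.
\<close>

definition lc_form :: "('a gen \<Rightarrow> real) \<Rightarrow> 'a gen \<Rightarrow> 'a gen \<Rightarrow> 'a gen \<Rightarrow> real" where
  "lc_form \<delta> u w z =
     dorfman_form (proj_minus u) (proj_plus w) (proj_plus z) +
     dorfman_form (proj_plus u) (proj_minus w) (proj_minus z) +
     (dorfman_form (proj_plus u) (proj_plus w) (proj_plus z) +
      dorfman_form (proj_minus u) (proj_minus w) (proj_minus z)) / 3 -
     (pairing (proj_plus u) (proj_plus w) * \<delta> (proj_plus z) -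
      \<delta> (proj_plus w) * pairing (proj_plus u) (proj_plus z)) / 2 -
     (pairing (proj_minus u) (proj_minus w) * \<delta> (proj_minus z) -
      \<delta> (proj_minus w) * pairing (proj_minus u) (proj_minus z)) / 2"

lemma linear_lc_form:
  assumes \<delta>: "linear \<delta>"
  shows "linear (\<lambda>u. lc_form \<delta> u w z)" "linear (\<lambda>w. lc_form \<delta> u w z)" "linear (lc_form \<delta> u w)"
  by (rule linearI; simp add: lc_form_def linear_add[OF \<delta>] linear_scale[OF \<delta>]
      linear_add[OF linear_proj_plus] linear_scale[OF linear_proj_plus]
      linear_add[OF linear_proj_minus] linear_scale[OF linear_proj_minus]
      dorfman_form_add dorfman_form_scale bilinear_simps[OF pairing_bilinear]; simp add: field_simps)+

lemma lc_form_skew: "lc_form \<delta> u w z = - lc_form \<delta> u z w"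
  unfolding lc_form_def
    dorfman_form_skew23[of _ "proj_plus z" "proj_plus w"]
    dorfman_form_skew23[of _ "proj_minus z" "proj_minus w"]
  by (simp add: field_simps)

lemma lc_form_cyclic: "lc_form \<delta> u w z + lc_form \<delta> w z u + lc_form \<delta> z u w = dorfman_form u w z"
proof -
  have "dorfman_form u w z = dorfman_form (proj_plus u + proj_minus u) (proj_plus w + proj_minus w)
      (proj_plus z + proj_minus z)"
    using proj_decompose by metis
  also have "\<dots> = lc_form \<delta> u w z + lc_form \<delta> w z u + lc_form \<delta> z u w"
    unfolding lc_form_def dorfman_form_add
      dorfman_form_cyclic[of "_ w" "_ z" "_ u"] dorfman_form_cyclic[of "_ z" "_ u" "_ w"]
      pairing_commute[of "_ z" "_ u"] pairing_commute[of "_ w" "_ u"] pairing_commute[of "_ z" "_ w"]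
    by (simp add: field_simps)
  finally show ?thesis by simp
qed

definition lc_of_divergence :: "('a gen \<Rightarrow> real) \<Rightarrow> 'a gen \<Rightarrow> 'a gen \<Rightarrow> 'a gen" where
  "lc_of_divergence \<delta> u w = sharp (lc_form \<delta> u w)"

lemma pairing_lc_of_divergence:
  "linear \<delta> \<Longrightarrow> pairing (lc_of_divergence \<delta> u w) z = lc_form \<delta> u w z"
  unfolding lc_of_divergence_def by (rule pairing_sharp) (rule linear_lc_form)

lemma proj_frame [simp]:
  "proj_plus (ep a) = ep a" "proj_minus (ep a) = 0" "proj_plus (em a) = 0" "proj_minus (em a) = em a"
  by (simp_all add: proj_of_plus[OF ep_in] proj_of_minus[OF em_in])

lemma dorfman_form_0 [simp]: "dorfman_form 0 u w = 0" "dorfman_form u 0 w = 0" "dorfman_form u w 0 = 0"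
  using linear_dorfman_form[THEN linear_0] by auto

lemma levi_civita_lc_of_divergence:
  assumes \<delta>: "linear \<delta>" shows "levi_civita br g H (lc_of_divergence \<delta>)"
proof -
  note lin = linear_lc_form[OF \<delta>]
  have bil: "bilinear (lc_of_divergence \<delta>)"
    unfolding bilinear_def
    by (intro conjI allI linearI; rule pairing_eqI;
        simp only: bilinear_simps[OF pairing_bilinear] pairing_lc_of_divergence[OF \<delta>]
          lin[THEN linear_add] lin[THEN linear_scale])
  have conn: "gen_connection (lc_of_divergence \<delta>)"
    unfolding gen_connection_def
  proof (intro conjI allI bil)
    fix u w z
    show "pairing (lc_of_divergence \<delta> u w) z + pairing w (lc_of_divergence \<delta> u z) = 0"
      using lc_form_skew[of \<delta> u w z] pairing_commute[of w "lc_of_divergence \<delta> u z"]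
      by (simp add: pairing_lc_of_divergence[OF \<delta>])
  qed
  have "torsion br H (lc_of_divergence \<delta>) u w = 0" for u w
  proof (rule pairing_nondegenerate)
    fix z show "pairing (torsion br H (lc_of_divergence \<delta>) u w) z = 0"
      using lc_form_cyclic by (simp add: torsion_pairing[OF conn] pairing_lc_of_divergence[OF \<delta>])
  qed
  moreover have "lc_of_divergence \<delta> u w \<in> E_plus g" if "w \<in> E_plus g" for u w
    using that by (intro E_plusI)
      (simp add: pairing_lc_of_divergence[OF \<delta>] lc_form_def proj_of_plus
        bilinear_simps[OF pairing_bilinear] linear_0[OF \<delta>])
  moreover have "lc_of_divergence \<delta> u w \<in> E_minus g" if "w \<in> E_minus g" for u w
    using that by (intro E_minusI)
      (simp add: pairing_lc_of_divergence[OF \<delta>] lc_form_def proj_of_minus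
        bilinear_simps[OF pairing_bilinear] linear_0[OF \<delta>])
  ultimately show ?thesis unfolding levi_civita_def using conn by blast
qed

lemma linear_of_proj_plus:
  assumes "linear \<phi>" shows "\<phi> (proj_plus u) = (\<Sum>a\<in>UNIV. (\<epsilon> a * pairing u (ep a)) *\<^sub>R \<phi> (ep a))"
  by (simp only: proj_plus_def linear_sum[OF assms] linear_scale[OF assms])

lemma linear_of_proj_minus:
  assumes "linear \<phi>" shows "\<phi> (proj_minus u) = (\<Sum>a\<in>UNIV. (- \<epsilon> a * pairing u (em a)) *\<^sub>R \<phi> (em a))"
  by (simp only: proj_minus_def linear_sum[OF assms] linear_scale[OF assms])

lemma pairing_proj_ep [simp]: "pairing (proj_plus u) (ep a) = pairing u (ep a)"
  and pairing_proj_em [simp]: "pairing (proj_minus u) (em a) = pairing u (em a)"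
proof -
  have "pairing u w = pairing (proj_plus u) w + pairing (proj_minus u) w" for w
    using proj_decompose[of u] bilinear_ladd[OF pairing_bilinear] by metis
  then show "pairing (proj_plus u) (ep a) = pairing u (ep a)"
    "pairing (proj_minus u) (em a) = pairing u (em a)"
    using pairing_minus_plus[OF proj_minus_in ep_in] pairing_plus_minus[OF proj_plus_in em_in]
    by simp_all
qed

lemma gen_divergence_lc_of_divergence:
  assumes \<delta>: "linear \<delta>" shows "gen_divergence (lc_of_divergence \<delta>) = \<delta>"
proof
  fix w
  have scale: "s * l = D / 2 - (s * p) *\<^sub>R d / 2" if "l = (D * s - p * d) / 2" "s * s = 1" for s l D p d :: real
  proof -
    have "s * l = ((s * s) * D - s * p * d) / 2" by (simp add: that(1) algebra_simps)
    then show ?thesis by (simp add: that(2) diff_divide_distrib)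
  qed
  have "bilinear (lc_of_divergence \<delta>)"
    using levi_civita_lc_of_divergence[OF \<delta>] by (simp add: levi_civita_def gen_connection_def)
  then have "gen_divergence (lc_of_divergence \<delta>) w =
      (\<Sum>a\<in>UNIV. \<epsilon> a * lc_form \<delta> (ep a) w (ep a)) - (\<Sum>a\<in>UNIV. \<epsilon> a * lc_form \<delta> (em a) w (em a))"
    unfolding gen_divergence_def
    by (subst trace_on_gen) (simp_all only: bilinear_linear_left pairing_lc_of_divergence[OF \<delta>])
  also have "(\<Sum>a\<in>UNIV. \<epsilon> a * lc_form \<delta> (ep a) w (ep a)) =
      (\<Sum>a\<in>UNIV. \<delta> (proj_plus w) / 2 - (\<epsilon> a * pairing w (ep a)) *\<^sub>R \<delta> (ep a) / 2)"
  proof (intro sum.cong refl)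
    fix a
    have "lc_form \<delta> (ep a) w (ep a) = (\<delta> (proj_plus w) * \<epsilon> a - pairing w (ep a) * \<delta> (ep a)) / 2"
      by (simp add: lc_form_def dorfman_form_repeat linear_0[OF \<delta>] bilinear_simps[OF pairing_bilinear]
          pairing_commute[of "ep a" "proj_plus w"] field_simps)
    from scale[OF this sign] show "\<epsilon> a * lc_form \<delta> (ep a) w (ep a) =
        \<delta> (proj_plus w) / 2 - (\<epsilon> a * pairing w (ep a)) *\<^sub>R \<delta> (ep a) / 2" .
  qed
  also have "\<dots> = \<delta> (proj_plus w)"
    unfolding sum_subtractf sum_divide_distrib[symmetric] linear_of_proj_plus[OF \<delta>, symmetric] by simp
  also have "(\<Sum>a\<in>UNIV. \<epsilon> a * lc_form \<delta> (em a) w (em a)) =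
      (\<Sum>a\<in>UNIV. (- \<epsilon> a * pairing w (em a)) *\<^sub>R \<delta> (em a) / 2 - \<delta> (proj_minus w) / 2)"
  proof (intro sum.cong refl)
    fix a
    have "lc_form \<delta> (em a) w (em a) = (- \<delta> (proj_minus w) * \<epsilon> a - pairing w (em a) * \<delta> (em a)) / 2"
      by (simp add: lc_form_def dorfman_form_repeat linear_0[OF \<delta>] bilinear_simps[OF pairing_bilinear]
          pairing_commute[of "em a" "proj_minus w"] field_simps)
    from scale[OF this sign] show "\<epsilon> a * lc_form \<delta> (em a) w (em a) =
        (- \<epsilon> a * pairing w (em a)) *\<^sub>R \<delta> (em a) / 2 - \<delta> (proj_minus w) / 2"
      by simp
  qed
  also have "\<dots> = - \<delta> (proj_minus w)"
    unfolding sum_subtractf sum_divide_distrib[symmetric] linear_of_proj_minus[OF \<delta>, symmetric] by simp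
  also have "\<delta> (proj_plus w) - - \<delta> (proj_minus w) = \<delta> w"
    using proj_decompose[of w] linear_add[OF \<delta>] by (metis diff_minus_eq_add)
  finally show "gen_divergence (lc_of_divergence \<delta>) w = \<delta> w" .
qed

lemma lc_connection:
  assumes "linear \<delta>"
  shows "levi_civita br g H (lc_connection br g H \<delta>)" "gen_divergence (lc_connection br g H \<delta>) = \<delta>"
  using someI[of "\<lambda>D. levi_civita br g H D \<and> gen_divergence D = \<delta>",
      OF conjI[OF levi_civita_lc_of_divergence[OF assms] gen_divergence_lc_of_divergence[OF assms]]]
  unfolding lc_connection_def by auto

definition ric_form :: "('a gen \<Rightarrow> real) \<Rightarrow> 'a gen \<Rightarrow> 'a gen \<Rightarrow> real" where
  "ric_form \<delta> u w = (\<Sum>a\<in>UNIV. \<epsilon> a * dorfman_form u w (ep a) * \<delta> (ep a)) +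
     (\<Sum>a\<in>UNIV. \<Sum>b\<in>UNIV. \<epsilon> a * \<epsilon> b * dorfman_form (ep a) u (em b) * dorfman_form (em b) w (ep a))"

lemma trace_curvature:
  assumes \<delta>: "linear \<delta>" and lc: "levi_civita br g H D" and div: "gen_divergence D = \<delta>"
    and um: "um \<in> E_minus g" and up: "up \<in> E_plus g"
  shows "trace_on (E_plus g) (\<lambda>w. gen_curvature br H D w um up) = ric_form \<delta> um up"
proof -
  have conn: "gen_connection D" and T0: "torsion br H D u w = 0"
    and Dp: "w \<in> E_plus g \<Longrightarrow> D u w \<in> E_plus g" and Dm: "w \<in> E_minus g \<Longrightarrow> D u w \<in> E_minus g" for u w
    using lc unfolding levi_civita_def by blast+
  have D: "bilinear D" and so: "pairing (D u w) z = - pairing w (D u z)" for u w z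
    using conn unfolding gen_connection_def by (blast, metis eq_neg_iff_add_eq_0)
  note Dl = bilinear_linear_left[OF D]
  have tor: "pairing (D u w) z + pairing (D w z) u + pairing (D z u) w = dorfman_form u w z" for u w z
    using torsion_pairing[OF conn, of u w z] T0 by (simp add: bilinear_simps[OF pairing_bilinear])
  have mixed: "pairing (D y x) (ep a) = dorfman_form y x (ep a)" if "x \<in> E_plus g" "y \<in> E_minus g" for x y a
    using tor[of y x "ep a"] pairing_plus_minus[OF Dp[OF ep_in] that(2), of x a]
      pairing_minus_plus[OF Dm[OF that(2)] that(1)] by simp
  have pp: "pairing x (proj_plus u) = (\<Sum>b\<in>UNIV. \<epsilon> b * pairing u (ep b) * pairing x (ep b))" for x u
    using linear_of_proj_plus[OF bilinear_linear_right[OF pairing_bilinear]] by simp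
  have mixed': "D y x = proj_plus (dorf y x)" if "x \<in> E_plus g" "y \<in> E_minus g" for x y
  proof -
    have "D y x = proj_plus (D y x)" using proj_of_plus(2)[OF Dp[OF that(1)]] by simp
    then show ?thesis using mixed[OF that] by (simp add: proj_plus_def dorfman_form_def)
  qed
  have linR: "linear (\<lambda>w. gen_curvature br H D w um up)"
    by (rule linearI) (simp_all add: gen_curvature_def bilinear_simps[OF D]
        bilinear_simps[OF dorfman_bilinear] algebra_simps)
  have R_in: "gen_curvature br H D w um up \<in> E_plus g" for w
    unfolding gen_curvature_def by (intro subspace_diff subspace_E_plus Dp up)
  have T1: "(\<Sum>a\<in>UNIV. \<epsilon> a * pairing (D (ep a) (D um up)) (ep a)) =
      (\<Sum>a\<in>UNIV. \<epsilon> a * dorfman_form um up (ep a) * \<delta> (ep a))"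
  proof -
    have "(\<Sum>a\<in>UNIV. \<epsilon> a * dorfman_form um up (ep a) * \<delta> (ep a)) = \<delta> (proj_plus (dorf um up))"
      by (simp add: linear_of_proj_plus[OF \<delta>] dorfman_form_def)
    also have "\<dots> = (\<Sum>a\<in>UNIV. \<epsilon> a * pairing (D (ep a) (D um up)) (ep a))"
      by (simp add: mixed'[OF up um, symmetric] div[symmetric] gen_divergence_def trace_on_gen[OF Dl]
          pairing_plus_minus[OF Dp[OF Dp[OF up]] em_in])
    finally show ?thesis by simp
  qed
  have T2: "pairing (D um (D (ep a) up)) (ep a) =
      - (\<Sum>b\<in>UNIV. \<epsilon> b * dorfman_form um (ep a) (ep b) * pairing (D (ep a) up) (ep b))" for a
    by (simp add: so[of um] mixed'[OF ep_in um] pp dorfman_form_def)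
  have T3: "pairing (D (dorf (ep a) um) up) (ep a) =
      (\<Sum>b\<in>UNIV. \<epsilon> b * dorfman_form (ep a) um (ep b) * pairing (D (ep b) up) (ep a)) -
      (\<Sum>b\<in>UNIV. \<epsilon> b * dorfman_form (ep a) um (em b) * dorfman_form (em b) up (ep a))" for a
  proof -
    let ?\<phi> = "\<lambda>x. pairing (D x up) (ep a)"
    have \<phi>: "linear ?\<phi>"
      by (rule linearI) (simp_all add: bilinear_simps[OF D] bilinear_simps[OF pairing_bilinear])
    have "?\<phi> (dorf (ep a) um) = ?\<phi> (proj_plus (dorf (ep a) um)) + ?\<phi> (proj_minus (dorf (ep a) um))"
      using proj_decompose linear_add[OF \<phi>] by metis
    then show ?thesis
      unfolding linear_of_proj_plus[OF \<phi>] linear_of_proj_minus[OF \<phi>] mixed[OF up em_in]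
      by (simp add: dorfman_form_def sum_negf)
  qed
  have "trace_on (E_plus g) (\<lambda>w. gen_curvature br H D w um up) =
      (\<Sum>a\<in>UNIV. \<epsilon> a * pairing (gen_curvature br H D (ep a) um up) (ep a))"
    by (rule trace_on_E_plus[OF linR R_in])
  also have "\<dots> = (\<Sum>a\<in>UNIV. \<epsilon> a * dorfman_form um up (ep a) * \<delta> (ep a)) +
     (\<Sum>a\<in>UNIV. \<Sum>b\<in>UNIV. \<epsilon> a * \<epsilon> b * dorfman_form um (ep a) (ep b) * pairing (D (ep a) up) (ep b)) -
     (\<Sum>a\<in>UNIV. \<Sum>b\<in>UNIV. \<epsilon> a * \<epsilon> b * dorfman_form (ep a) um (ep b) * pairing (D (ep b) up) (ep a)) +
     (\<Sum>a\<in>UNIV. \<Sum>b\<in>UNIV. \<epsilon> a * \<epsilon> b * dorfman_form (ep a) um (em b) * dorfman_form (em b) up (ep a))"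
    using T1 by (simp add: gen_curvature_def bilinear_simps[OF pairing_bilinear] T2 T3 algebra_simps
        sum.distrib sum_subtractf sum_distrib_left)
  also have "(\<Sum>a\<in>UNIV. \<Sum>b\<in>UNIV. \<epsilon> a * \<epsilon> b * dorfman_form (ep a) um (ep b) * pairing (D (ep b) up) (ep a)) =
     (\<Sum>a\<in>UNIV. \<Sum>b\<in>UNIV. \<epsilon> a * \<epsilon> b * dorfman_form um (ep a) (ep b) * pairing (D (ep a) up) (ep b))"
    by (subst sum.swap) (simp add: dorfman_form_cyclic[of um] mult.commute[of "\<epsilon> _" "\<epsilon> _"])
  finally show ?thesis by (simp add: ric_form_def)
qed

lemma Ric_plus_eq:
  "linear \<delta> \<Longrightarrow> um \<in> E_minus g \<Longrightarrow> up \<in> E_plus g \<Longrightarrow> Ric_plus br g H \<delta> um up = ric_form \<delta> um up"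
  unfolding Ric_plus_def by (rule trace_curvature[OF _ lc_connection])

lemma Ric_minus_eq_Ric_plus: "Ric_minus br g H = Ric_plus br (\<lambda>x y. - g x y) H"
proof -
  have "levi_civita br (\<lambda>x y. - g x y) H D \<longleftrightarrow> levi_civita br g H D" for D
    unfolding levi_civita_def E_plus_uminus E_minus_uminus by blast
  then show ?thesis
    by (intro ext) (simp add: Ric_minus_def Ric_plus_def E_plus_uminus lc_connection_def)
qed

end


section \<open>The Einstein equations in coordinates\<close>

definition levi :: "3 \<Rightarrow> 3 \<Rightarrow> 3 \<Rightarrow> real" where
  "levi a b c = (if a = b \<or> b = c \<or> c = a then 0
     else if (a, b, c) \<in> {(1, 2, 3), (2, 3, 1), (3, 1, 2)} then 1 else -1)"

lemma distinct_3: "(1::3) \<noteq> 2" "(2::3) \<noteq> 1" "(1::3) \<noteq> 3" "(3::3) \<noteq> 1" "(2::3) \<noteq> 3" "(3::3) \<noteq> 2"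
  by auto

lemma levi_simps:
  "levi a a b = 0" "levi a b b = 0" "levi a b a = 0"
  "levi 1 2 3 = 1" "levi 2 3 1 = 1" "levi 3 1 2 = 1"
  "levi 2 1 3 = -1" "levi 3 2 1 = -1" "levi 1 3 2 = -1"
  by (simp_all add: levi_def)

lemma levi_skew: "levi b a c = - levi a b c"
  using exhaust_3[of a] exhaust_3[of b] exhaust_3[of c] by (elim disjE) (simp_all add: levi_simps)

text \<open>
  In an oriented orthonormal basis with signs \<open>\<epsilon>\<close>, \<open>[v\<^sub>a, v\<^sub>b] = L (v\<^sub>a \<times> v\<^sub>b)\<close> has the components
  \<open>structure_coord \<epsilon> M\<close>, where \<open>M\<close> is the matrix of \<open>g (L \<cdot>, \<cdot>)\<close>. The signs \<open>r\<close>, \<open>s\<close>, \<open>t\<close> in \<open>dorfman_coord\<close>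
  select \<open>v\<^sub>a + g v\<^sub>a\<close> or \<open>v\<^sub>a - g v\<^sub>a\<close> in each argument.
\<close>

definition structure_coord :: "(3 \<Rightarrow> real) \<Rightarrow> (3 \<Rightarrow> 3 \<Rightarrow> real) \<Rightarrow> 3 \<Rightarrow> 3 \<Rightarrow> 3 \<Rightarrow> real" where
  "structure_coord \<epsilon> M a b d = (\<Sum>k\<in>UNIV. levi a b k * \<epsilon> k * M k d)"

definition dorfman_coord ::
    "(3 \<Rightarrow> real) \<Rightarrow> (3 \<Rightarrow> 3 \<Rightarrow> real) \<Rightarrow> real \<Rightarrow> real \<Rightarrow> real \<Rightarrow> real \<Rightarrow> 3 \<Rightarrow> 3 \<Rightarrow> 3 \<Rightarrow> real" where
  "dorfman_coord \<epsilon> M h r s t a b c =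
     (r * structure_coord \<epsilon> M b c a + s * structure_coord \<epsilon> M c a b +
      t * structure_coord \<epsilon> M a b c + h * levi a b c) / 2"

definition ric_coord ::
    "(3 \<Rightarrow> real) \<Rightarrow> (3 \<Rightarrow> 3 \<Rightarrow> real) \<Rightarrow> real \<Rightarrow> (3 \<Rightarrow> real) \<Rightarrow> 3 \<Rightarrow> 3 \<Rightarrow> real" where
  "ric_coord \<epsilon> M h P c d =
     (\<Sum>a\<in>UNIV. \<epsilon> a * dorfman_coord \<epsilon> M h (-1) 1 1 c d a * P a) +
     (\<Sum>a\<in>UNIV. \<Sum>b\<in>UNIV. \<epsilon> a * \<epsilon> b * dorfman_coord \<epsilon> M h 1 (-1) (-1) a c b *
        dorfman_coord \<epsilon> M h (-1) 1 1 b d a)"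

locale structure_frame = einstein_frame g v \<epsilon> br H
  for g :: "'a::euclidean_space \<Rightarrow> 'a \<Rightarrow> real" and v :: "3 \<Rightarrow> 'a" and \<epsilon> :: "3 \<Rightarrow> real"
    and br :: "'a \<Rightarrow> 'a \<Rightarrow> 'a" and H :: "'a \<Rightarrow> 'a \<Rightarrow> 'a \<Rightarrow> real" +
  fixes M :: "3 \<Rightarrow> 3 \<Rightarrow> real" and h :: real
  assumes br_frame: "g (br (v a) (v b)) (v d) = structure_coord \<epsilon> M a b d"
    and H_frame: "H (v a) (v b) (v c) = h * levi a b c"
begin

lemma structure_frame_uminus: "structure_frame (\<lambda>x y. - g x y) v (\<lambda>a. - \<epsilon> a) br H M h"
  by (intro structure_frame.intro einstein_frame_uminus structure_frame_axioms.intro)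
    (simp_all add: br_frame H_frame structure_coord_def sum_negf)

lemma dorfman_form_frame:
  "dorfman_form (v a, r *\<^sub>R flat g (v a)) (v b, s *\<^sub>R flat g (v b)) (v c, t *\<^sub>R flat g (v c)) =
    dorfman_coord \<epsilon> M h r s t a b c"
proof -
  have "structure_coord \<epsilon> M a c b = - structure_coord \<epsilon> M c a b"
    by (simp add: structure_coord_def levi_skew[of a c] sum_negf)
  then show ?thesis
    by (simp add: dorfman_form_eq dorfman_coord_def blinfun.bilinear_simps br_frame H_frame
        g_commute[of "v _" "br _ _"])
qed

lemma ric_form_frame: "ric_form \<delta> (em c) (ep d) = ric_coord \<epsilon> M h (\<lambda>a. \<delta> (ep a)) c d"
proof -
  have E: "ep a = (v a, 1 *\<^sub>R flat g (v a))" "em a = (v a, (-1) *\<^sub>R flat g (v a))" for a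
    by (simp_all add: ep_def em_def)
  have "dorfman_form (em c) (ep d) (ep a) = dorfman_coord \<epsilon> M h (-1) 1 1 c d a"
    "dorfman_form (ep a) (em c) (em b) = dorfman_coord \<epsilon> M h 1 (-1) (-1) a c b"
    "dorfman_form (em b) (ep d) (ep a) = dorfman_coord \<epsilon> M h (-1) 1 1 b d a" for a b c d
    unfolding E by (rule dorfman_form_frame)+
  then show ?thesis by (simp only: ric_form_def ric_coord_def)
qed

lemma linear_ric_form: "linear (\<lambda>u. ric_form \<delta> u w)" "linear (\<lambda>w. ric_form \<delta> u w)"
  by (rule linearI; simp add: ric_form_def dorfman_form_add dorfman_form_scale algebra_simps
      sum.distrib sum_distrib_left)+

lemma Ric_plus_zero_iff:
  assumes \<delta>: "linear \<delta>"
  shows "(\<forall>um\<in>E_minus g. \<forall>up\<in>E_plus g. Ric_plus br g H \<delta> um up = 0) \<longleftrightarrow>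
    (\<forall>c d. ric_coord \<epsilon> M h (comp_plus g \<delta> v) c d = 0)"
proof -
  have ep: "(\<lambda>a. \<delta> (ep a)) = comp_plus g \<delta> v" by (simp add: comp_plus_def ep_def fun_eq_iff)
  have "ric_form \<delta> um up = 0"
    if *: "\<And>c d. ric_form \<delta> (em c) (ep d) = 0" and "um \<in> E_minus g" "up \<in> E_plus g" for um up
  proof -
    have "ric_form \<delta> (em c) up = 0" for c
      using linear_of_proj_plus[OF linear_ric_form(2), of \<delta> "em c" up] proj_of_plus(2)[OF that(3)] *
      by simp
    then show ?thesis
      using linear_of_proj_minus[OF linear_ric_form(1)[where w = up], of \<delta> um] proj_of_minus(2)[OF that(2)]
      by simp
  qed
  then show ?thesis
    using Ric_plus_eq[OF \<delta>] em_in ep_in ric_form_frame[of \<delta>] by (metis ep)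
qed

lemma gen_einstein_iff:
  "gen_einstein br g H \<delta> \<longleftrightarrow> linear \<delta> \<and>
    (\<forall>c d. ric_coord \<epsilon> M h (comp_plus g \<delta> v) c d = 0) \<and>
    (\<forall>c d. ric_coord (\<lambda>a. - \<epsilon> a) M h (comp_minus g \<delta> v) c d = 0)"
proof -
  interpret neg: structure_frame "\<lambda>x y. - g x y" v "\<lambda>a. - \<epsilon> a" br H M h
    by (rule structure_frame_uminus)
  have "comp_plus (\<lambda>x y. - g x y) \<delta> v = comp_minus g \<delta> v"
    by (simp add: comp_plus_def comp_minus_def flat_uminus fun_eq_iff)
  moreover have "gen_einstein br g H \<delta> \<longleftrightarrow> linear \<delta> \<and>
    (\<forall>um\<in>E_minus g. \<forall>up\<in>E_plus g. Ric_plus br g H \<delta> um up = 0) \<and>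
    (\<forall>up\<in>E_plus g. \<forall>um\<in>E_minus g. Ric_minus br g H \<delta> up um = 0)"
    unfolding gen_einstein_def using pseudo_metric H_three_form by blast
  ultimately show ?thesis
    using Ric_plus_zero_iff neg.Ric_plus_zero_iff
    by (simp add: Ric_minus_eq_Ric_plus E_plus_uminus E_minus_uminus cong: conj_cong)
qed

end


section \<open>Volume form, cross product and structure endomorphism\<close>

lemma metric_frame_oriented_onb:
  fixes g :: "'a::euclidean_space \<Rightarrow> 'a \<Rightarrow> real"
  assumes "DIM('a) = 3" "pseudo_metric g" "oriented_onb g \<omega> v"
  shows "metric_frame g v (\<lambda>a. g (v a) (v a))"
proof
  show "g (v a) (v a) * g (v a) (v a) = 1" for a
    using assms(3) unfolding oriented_onb_def by (metis mult_1 mult_minus1 minus_minus)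
qed (use assms in \<open>auto simp: pseudo_metric_def oriented_onb_def\<close>)

context metric_frame
begin

lemma linear_eq_frame:
  assumes "linear f" "linear f'" "\<And>a. f (v a) = f' (v a)"
  shows "f = f'"
proof
  fix x show "f x = f' x"
    using linear_frame_expand[OF assms(1), of x] linear_frame_expand[OF assms(2), of x] assms(3) by simp
qed

lemma bilinear_eq_frame:
  assumes "bilinear f" "bilinear f'" "\<And>a b. f (v a) (v b) = f' (v a) (v b)"
  shows "f x y = f' x y"
proof -
  have "f (v a) = f' (v a)" for a
    by (intro linear_eq_frame bilinear_linear_right assms)
  then have "(\<lambda>x. f x y) = (\<lambda>x. f' x y)"
    by (intro linear_eq_frame bilinear_linear_left assms) simp
  then show ?thesis by metis
qed

definition frame_volume :: "'a \<Rightarrow> 'a \<Rightarrow> 'a \<Rightarrow> real" where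
  "frame_volume x y z = det (\<chi> i a. \<epsilon> a * g ((vector [x, y, z] :: 'a^3) $ i) (v a))"

lemma frame_volume_eq:
  "frame_volume x y z = \<epsilon> 1 * \<epsilon> 2 * \<epsilon> 3 *
    (g x (v 1) * (g y (v 2) * g z (v 3) - g y (v 3) * g z (v 2)) -
     g x (v 2) * (g y (v 1) * g z (v 3) - g y (v 3) * g z (v 1)) +
     g x (v 3) * (g y (v 1) * g z (v 2) - g y (v 2) * g z (v 1)))"
  by (simp add: frame_volume_def det_3) algebra

lemma three_form_frame_volume: "three_form frame_volume"
  unfolding three_form_def
  by (intro conjI allI linearI) (simp_all add: frame_volume_eq bilinear_simps[OF g_bilinear] algebra_simps)

lemma three_form_eq_frame_volume:
  assumes \<omega>: "three_form \<omega>"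
  shows "\<omega> x y z = \<omega> (v 1) (v 2) (v 3) * frame_volume x y z"
proof -
  note [simp] = three_form_add[OF \<omega>] three_form_scale[OF \<omega>] three_form_repeat[OF \<omega>]
  note sk = three_form_skew(1)[OF \<omega>, of "v 2" "v 1"] three_form_skew(1)[OF \<omega>, of "v 3" "v 1"]
    three_form_skew(1)[OF \<omega>, of "v 3" "v 2"] three_form_skew(2)[OF \<omega>, of _ "v 3" "v 2"]
    three_form_skew(2)[OF \<omega>, of "v 2" "v 3" "v 1"]
  define E where
    "E u = (\<epsilon> 1 * g u (v 1)) *\<^sub>R v 1 + (\<epsilon> 2 * g u (v 2)) *\<^sub>R v 2 + (\<epsilon> 3 * g u (v 3)) *\<^sub>R v 3" for u
  have "E u = u" for u
    using frame_expand[of u] by (simp add: E_def sum_3)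
  then have "\<omega> x y z = \<omega> (E x) (E y) (E z)" by simp
  also have "\<dots> = \<omega> (v 1) (v 2) (v 3) * frame_volume x y z"
    unfolding E_def by (simp add: sk frame_volume_eq) algebra
  finally show ?thesis .
qed

lemma frame_volume_frame: "frame_volume (v a) (v b) (v c) = levi a b c"
proof -
  note sk = three_form_skew[OF three_form_frame_volume]
  have "frame_volume (v 1) (v 2) (v 3) = (\<epsilon> 1 * \<epsilon> 1) * (\<epsilon> 2 * \<epsilon> 2) * (\<epsilon> 3 * \<epsilon> 3)"
    by (simp add: frame_volume_eq orthonormal distinct_3 mult_ac)
  then have "frame_volume (v 1) (v 2) (v 3) = 1"
    by (simp add: sign)
  then show ?thesis
    using exhaust_3[of a] exhaust_3[of b] exhaust_3[of c]
    by (elim disjE) (simp_all add: levi_simps three_form_repeat[OF three_form_frame_volume]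
      sk(1)[of "v 2" "v 1"] sk(1)[of "v 3" "v 1"] sk(1)[of "v 3" "v 2"] sk(2)[of _ "v 3" "v 2"]
      sk(2)[of "v 2" "v 3" "v 1"])
qed

lemma frame_volume_oriented_onb:
  assumes \<omega>: "three_form \<omega>" "\<omega> (v 1) (v 2) (v 3) > 0" and w: "oriented_onb g \<omega> w"
  shows "frame_volume (w 1) (w 2) (w 3) = 1"
proof -
  define A :: "real^3^3" where "A = (\<chi> i a. \<epsilon> a * g (w i) (v a))"
  define D :: "real^3^3" where "D = (\<chi> a b. if a = b then \<epsilon> a else 0)"
  have vol: "frame_volume (w 1) (w 2) (w 3) = det A"
    by (simp add: frame_volume_def A_def det_3)
  have "(A ** D ** transpose A) $ i $ j = g (w i) (w j)" for i j
  proof -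
    have "(A ** D ** transpose A) $ i $ j = (\<Sum>a\<in>UNIV. A $ i $ a * \<epsilon> a * A $ j $ a)"
      by (simp add: matrix_matrix_mult_def D_def transpose_def if_distrib cong: if_cong)
    also have "\<dots> = g (w i) (w j)"
      unfolding g_expand[of "w i" "w j"] A_def
    proof (intro sum.cong refl)
      fix a
      have "\<epsilon> a * (\<epsilon> a * \<epsilon> a) = \<epsilon> a" by (simp add: sign)
      then show "(\<chi> i a. \<epsilon> a * g (w i) (v a)) $ i $ a * \<epsilon> a * (\<chi> i a. \<epsilon> a * g (w i) (v a)) $ j $ a =
        \<epsilon> a * g (w i) (v a) * g (w j) (v a)" by simp algebra
    qed
    finally show ?thesis .
  qed
  then have "A ** D ** transpose A = (\<chi> i j. g (w i) (w j))" by (simp add: vec_eq_iff)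
  then have "det A * det D * det A = det (\<chi> i j. g (w i) (w j))" by (metis det_mul det_transpose)
  then have "det A ^ 2 * (\<epsilon> 1 * \<epsilon> 2 * \<epsilon> 3) = g (w 1) (w 1) * g (w 2) (w 2) * g (w 3) (w 3)"
    using w by (simp add: oriented_onb_def det_3 D_def distinct_3 power2_eq_square algebra_simps)
  moreover have "\<bar>g (w a) (w a)\<bar> = 1" "\<bar>\<epsilon> a\<bar> = 1" for a
    using w sign[of a] square_eq_1_iff[of "\<epsilon> a"]
    by (auto simp: oriented_onb_def) (metis abs_1 abs_minus_cancel)+
  ultimately have "\<bar>det A ^ 2\<bar> = 1"
    by (metis abs_mult mult_1_right)
  moreover have "det A > 0"
    using three_form_eq_frame_volume[OF \<omega>(1), of "w 1" "w 2" "w 3"] \<omega>(2) w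
    by (simp add: vol oriented_onb_def zero_less_mult_iff)
  ultimately show ?thesis using vol by (simp add: power2_eq_1_iff)
qed

end

locale oriented_frame = metric_frame g v \<epsilon>
  for g :: "'a::euclidean_space \<Rightarrow> 'a \<Rightarrow> real" and v :: "3 \<Rightarrow> 'a" and \<epsilon> :: "3 \<Rightarrow> real" +
  fixes \<omega> :: "'a \<Rightarrow> 'a \<Rightarrow> 'a \<Rightarrow> real"
  assumes \<omega>_three_form: "three_form \<omega>" and \<omega>_pos: "\<omega> (v 1) (v 2) (v 3) > 0"
begin

lemma oriented_onb: "oriented_onb g \<omega> v"
  using \<omega>_pos sign[THEN square_eq_1_iff[THEN iffD1]] by (simp add: oriented_onb_def orthonormal)

lemma volume_form_eq: "volume_form g \<omega> = frame_volume"
  unfolding volume_form_def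
proof (rule the_equality)
  show "three_form frame_volume \<and> (\<forall>w. oriented_onb g \<omega> w \<longrightarrow> frame_volume (w 1) (w 2) (w 3) = 1)"
    using three_form_frame_volume frame_volume_oriented_onb[OF \<omega>_three_form \<omega>_pos] by blast
  fix \<mu> assume \<mu>: "three_form \<mu> \<and> (\<forall>w. oriented_onb g \<omega> w \<longrightarrow> \<mu> (w 1) (w 2) (w 3) = 1)"
  then have "\<mu> (v 1) (v 2) (v 3) = 1" using oriented_onb by blast
  then show "\<mu> = frame_volume"
    using \<mu> three_form_eq_frame_volume[of \<mu>] by (intro ext) (metis mult_1)
qed

lemma g_cross_product: "g (cross_product g \<omega> x y) z = frame_volume x y z"
proof -
  let ?c = "\<Sum>a\<in>UNIV. (\<epsilon> a * frame_volume x y (v a)) *\<^sub>R v a"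
  have c: "\<forall>w. g ?c w = volume_form g \<omega> x y w"
  proof
    fix w
    have "g ?c w = (\<Sum>a\<in>UNIV. (\<epsilon> a * g w (v a)) *\<^sub>R frame_volume x y (v a))"
      by (simp add: bilinear_sum_left[OF g_bilinear] g_commute[of w] mult_ac)
    then show "g ?c w = volume_form g \<omega> x y w"
      using linear_frame_expand[OF three_form_linear(3)[OF three_form_frame_volume, of x y], of w]
      by (simp only: volume_form_eq)
  qed
  have "\<forall>w. g (cross_product g \<omega> x y) w = volume_form g \<omega> x y w"
    unfolding cross_product_def
  proof (rule theI[where P = "\<lambda>u. \<forall>w. g u w = volume_form g \<omega> x y w", OF c])
    fix u assume "\<forall>w. g u w = volume_form g \<omega> x y w"
    then show "u = ?c" using c eq_iff_g[of u ?c] by simp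
  qed
  then show ?thesis by (simp add: volume_form_eq)
qed

lemma bilinear_cross_product: "bilinear (cross_product g \<omega>)"
  unfolding bilinear_def
  by (intro conjI allI linearI)
    (simp_all add: eq_iff_g bilinear_simps[OF g_bilinear] g_cross_product
      three_form_add[OF three_form_frame_volume] three_form_scale[OF three_form_frame_volume])

lemma cross_product_frame: "cross_product g \<omega> (v a) (v b) = (\<Sum>k\<in>UNIV. (levi a b k * \<epsilon> k) *\<^sub>R v k)"
proof -
  have "levi a b c * \<epsilon> c * \<epsilon> c = levi a b c" for c by (simp add: sign mult.assoc)
  then show ?thesis
    by (simp add: eq_iff_g g_sum_frame g_cross_product frame_volume_frame)
qed

lemma frame_cross_product: "\<exists>a b s. v k = s *\<^sub>R cross_product g \<omega> (v a) (v b)"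
proof -
  have "cross_product g \<omega> (v 2) (v 3) = \<epsilon> 1 *\<^sub>R v 1" "cross_product g \<omega> (v 3) (v 1) = \<epsilon> 2 *\<^sub>R v 2"
    "cross_product g \<omega> (v 1) (v 2) = \<epsilon> 3 *\<^sub>R v 3"
    unfolding cross_product_frame by (simp_all add: sum_3 levi_simps)
  then show ?thesis
    using exhaust_3[of k] sign by (metis scaleR_one scaleR_scaleR)
qed

lemma structure_endo_eqI:
  assumes "linear L" "\<And>u w. g (L u) w = g u (L w)" "\<And>u w. br u w = L (cross_product g \<omega> u w)"
  shows "structure_endo br g \<omega> = L"
  unfolding structure_endo_def
proof (rule the_equality)
  fix L' assume L': "linear L' \<and> (\<forall>u v. g (L' u) v = g u (L' v)) \<and>
    (\<forall>u v. br u v = L' (cross_product g \<omega> u v))"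
  have "L' (v k) = L (v k)" for k
    using frame_cross_product[of k] L' assms by (metis linear_scale)
  then show "L' = L"
    using L' assms(1) by (intro linear_eq_frame) simp_all
qed (use assms in blast)

lemma structure_endo:
  assumes br: "bilinear br" "\<And>x. br x x = 0" and unimod: "unimodular br"
  shows "linear (structure_endo br g \<omega>)"
    and "g (structure_endo br g \<omega> x) y = g x (structure_endo br g \<omega> y)"
    and "br x y = structure_endo br g \<omega> (cross_product g \<omega> x y)"
proof -
  define N where "N k = (if k = 1 then br (v 2) (v 3) else if k = 2 then br (v 3) (v 1) else br (v 1) (v 2))"
    for k :: 3
  define L where "L x = (\<Sum>k\<in>UNIV. g x (v k) *\<^sub>R N k)" for x
  have N: "N 1 = br (v 2) (v 3)" "N 2 = br (v 3) (v 1)" "N 3 = br (v 1) (v 2)"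
    by (simp_all add: N_def distinct_3)
  note skew = alternating_skew[OF br]
  have lin: "linear L"
    unfolding L_def
    by (rule linearI) (simp_all add: bilinear_simps[OF g_bilinear] scaleR_add_left sum.distrib scaleR_sum_right)
  have Lv: "L (v k) = \<epsilon> k *\<^sub>R N k" for k
    by (simp add: L_def orthonormal if_distrib[of "\<lambda>x. x *\<^sub>R _"] cong: if_cong)
  have tr: "(\<Sum>d\<in>UNIV. \<epsilon> d * g (br (v a) (v d)) (v d)) = 0" for a
    using unimod trace_on_UNIV_frame[OF bilinear_linear_right[OF br(1)]] by (simp add: unimodular_def)
  have br_N: "br (v a) (v b) = (\<Sum>k\<in>UNIV. levi a b k *\<^sub>R N k)" for a b
    using exhaust_3[of a] exhaust_3[of b]
    by (elim disjE) (simp_all add: sum_3 levi_simps N br(2) skew[of "v 1" "v 3"] skew[of "v 2" "v 1"]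
      skew[of "v 3" "v 2"])
  have "br x y = L (cross_product g \<omega> x y)" for x y
  proof (rule bilinear_eq_frame[OF br(1)])
    show "bilinear (\<lambda>x y. L (cross_product g \<omega> x y))"
      using bilinear_cross_product lin unfolding bilinear_def
      by (auto intro: linear_compose[unfolded o_def])
    fix a b
    show "br (v a) (v b) = L (cross_product g \<omega> (v a) (v b))"
      unfolding br_N cross_product_frame linear_sum[OF lin] linear_scale[OF lin] Lv
      by (simp add: sign mult.assoc)
  qed
  moreover have "g (L x) y = g x (L y)" for x y
  proof (rule bilinear_eq_frame[where f = "\<lambda>x y. g (L x) y" and f' = "\<lambda>x y. g x (L y)"])
    show "bilinear (\<lambda>x y. g (L x) y)" "bilinear (\<lambda>x y. g x (L y))"
      using g_bilinear lin unfolding bilinear_def by (auto intro: linear_compose[unfolded o_def])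
    have t: "\<epsilon> 2 * g (br (v 1) (v 2)) (v 2) + \<epsilon> 3 * g (br (v 1) (v 3)) (v 3) = 0"
      "\<epsilon> 1 * g (br (v 2) (v 1)) (v 1) + \<epsilon> 3 * g (br (v 2) (v 3)) (v 3) = 0"
      "\<epsilon> 1 * g (br (v 3) (v 1)) (v 1) + \<epsilon> 2 * g (br (v 3) (v 2)) (v 2) = 0"
      using tr[of 1] tr[of 2] tr[of 3] by (simp_all add: sum_3 br(2) bilinear_simps[OF g_bilinear])
    have "\<epsilon> 1 * g (N 1) (v 2) = \<epsilon> 2 * g (N 2) (v 1)" "\<epsilon> 1 * g (N 1) (v 3) = \<epsilon> 3 * g (N 3) (v 1)"
      "\<epsilon> 2 * g (N 2) (v 3) = \<epsilon> 3 * g (N 3) (v 2)"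
      using t sign[of 1] sign[of 2] sign[of 3]
      unfolding N skew[of "v 1" "v 3"] skew[of "v 2" "v 1"] skew[of "v 3" "v 2"] bilinear_simps[OF g_bilinear]
      by algebra+
    then show "g (L (v a)) (v b) = g (v a) (L (v b))" for a b
      using exhaust_3[of a] exhaust_3[of b]
      by (elim disjE) (simp_all add: Lv bilinear_simps[OF g_bilinear] g_commute[of "v _" "N _"])
  qed
  ultimately have "structure_endo br g \<omega> = L" by (intro structure_endo_eqI lin)
  with lin \<open>\<And>x y. br x y = L (cross_product g \<omega> x y)\<close> \<open>\<And>x y. g (L x) y = g x (L y)\<close>
  show "linear (structure_endo br g \<omega>)"
    "g (structure_endo br g \<omega> x) y = g x (structure_endo br g \<omega> y)"
    "br x y = structure_endo br g \<omega> (cross_product g \<omega> x y)" by simp_all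
qed

lemma structure_frame:
  assumes br: "bilinear br" "\<And>x. br x x = 0" and L: "linear L" "\<And>u w. br u w = L (cross_product g \<omega> u w)"
    and H: "three_form H"
  shows "structure_frame g v \<epsilon> br H (\<lambda>k d. g (L (v k)) (v d)) (H (v 1) (v 2) (v 3))"
proof
  fix a b d
  show "g (br (v a) (v b)) (v d) = structure_coord \<epsilon> (\<lambda>k d. g (L (v k)) (v d)) a b d"
    unfolding L(2) cross_product_frame linear_sum[OF L(1)] linear_scale[OF L(1)]
    by (simp add: bilinear_sum_left[OF g_bilinear] structure_coord_def)
  show "H (v a) (v b) (v d) = H (v 1) (v 2) (v 3) * levi a b d"
    using three_form_eq_frame_volume[OF H, of "v a" "v b" "v d"] by (simp only: frame_volume_frame)
qed (use assms in auto)

lemma three_form_eq_volume_form: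
  assumes "three_form H" shows "H = (\<lambda>x y z. H (v 1) (v 2) (v 3) * volume_form g \<omega> x y z)"
  using three_form_eq_frame_volume[OF assms] volume_form_eq by (intro ext) metis

end


section \<open>Solving the Einstein equations\<close>

lemma ric_coord_diag:
  assumes e: "\<And>a. \<epsilon> a * \<epsilon> a = 1" and M: "\<And>a b. M a b = (if a = b then \<epsilon> a * l a else 0)"
    and abc: "a \<noteq> b" "b \<noteq> c" "a \<noteq> c"
  shows "ric_coord \<epsilon> M h P a b = levi a b c * \<epsilon> c * P c * (h - l a + l b + l c) / 2"
    and "ric_coord \<epsilon> M h P a a = \<epsilon> b * \<epsilon> c * (l a ^ 2 - (l b - l c) ^ 2 - h ^ 2) / 2"
proof -
  have e2: "\<epsilon> a * (\<epsilon> a * x) = x" for a x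
    by (metis e mult.assoc mult_1)
  have S: "structure_coord \<epsilon> M a b c = levi a b c * l c" for a b c
    by (simp add: structure_coord_def M if_distrib mult.assoc e2 cong: if_cong)
  have D: "dorfman_coord \<epsilon> M h r s t a b c = levi a b c * (r * l a + s * l b + t * l c + h) / 2"
    for r s t a b c
    using exhaust_3[of a] exhaust_3[of b] exhaust_3[of c]
    by (elim disjE) (simp_all add: dorfman_coord_def S levi_simps)
  have R: "ric_coord \<epsilon> M h P c d = (\<Sum>a\<in>UNIV. \<epsilon> a * (levi c d a * (- l c + l d + l a + h) / 2) * P a) +
     (\<Sum>a\<in>UNIV. \<Sum>b\<in>UNIV. \<epsilon> a * \<epsilon> b * (levi a c b * (l a - l c - l b + h) / 2) *
        (levi b d a * (- l b + l d + l a + h) / 2))" for c d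
    by (simp add: ric_coord_def D)
  have "(a, b, c) \<in> {(1,2,3),(2,3,1),(3,1,2),(2,1,3),(3,2,1),(1,3,2)}"
    using exhaust_3[of a] exhaust_3[of b] exhaust_3[of c] abc by auto
  then show "ric_coord \<epsilon> M h P a b = levi a b c * \<epsilon> c * P c * (h - l a + l b + l c) / 2"
    "ric_coord \<epsilon> M h P a a = \<epsilon> b * \<epsilon> c * (l a ^ 2 - (l b - l c) ^ 2 - h ^ 2) / 2"
    unfolding R sum_3
    by (auto simp: levi_simps field_simps power2_eq_square)
qed

lemma structure_coord_frame:
  "structure_coord \<epsilon> M a a d = 0"
  "structure_coord \<epsilon> M 1 2 d = \<epsilon> 3 * M 3 d" "structure_coord \<epsilon> M 2 1 d = - \<epsilon> 3 * M 3 d"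
  "structure_coord \<epsilon> M 2 3 d = \<epsilon> 1 * M 1 d" "structure_coord \<epsilon> M 3 2 d = - \<epsilon> 1 * M 1 d"
  "structure_coord \<epsilon> M 3 1 d = \<epsilon> 2 * M 2 d" "structure_coord \<epsilon> M 1 3 d = - \<epsilon> 2 * M 2 d"
  by (simp_all add: structure_coord_def sum_3 levi_simps)

lemma ric_coord_block:
  fixes s :: real
  assumes e: "\<epsilon> 1 = s" "\<epsilon> 2 = s" "\<epsilon> 3 = -s" "s * s = 1"
    and M: "M 1 1 = s * l" "M 1 2 = 0" "M 1 3 = 0" "M 2 1 = 0" "M 3 1 = 0"
      "M 2 2 = s * a" "M 2 3 = s * b" "M 3 2 = s * b" "M 3 3 = - s * d"
  shows "2 * ric_coord \<epsilon> M h P 1 1 = (a - d) ^ 2 - 4 * b ^ 2 + h ^ 2 - l ^ 2"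
    "2 * ric_coord \<epsilon> M h P 1 2 = s * P 3 * (l - h - a - d)"
    "2 * ric_coord \<epsilon> M h P 1 3 = s * P 2 * (l - h - a - d)"
    "2 * ric_coord \<epsilon> M h P 2 1 = s * (2 * b * P 2 + P 3 * (h + l - a + d))"
    "2 * ric_coord \<epsilon> M h P 2 2 = - 2 * s * b * P 1 - a ^ 2 - 2 * d * l + d ^ 2 + h ^ 2 + l ^ 2"
    "2 * ric_coord \<epsilon> M h P 2 3 = s * P 1 * (h + l - a + d) - 2 * b * (a + d - l)"
    "2 * ric_coord \<epsilon> M h P 3 2 = s * P 1 * (d - a - h - l) - 2 * b * (a + d - l)"
    "2 * ric_coord \<epsilon> M h P 3 3 = - 2 * s * b * P 1 + 2 * a * l - a ^ 2 + d ^ 2 - h ^ 2 - l ^ 2"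
proof -
  have s2: "s * (s * x) = x" for x using e(4) by (metis mult.assoc mult_1)
  note [simp] = structure_coord_frame levi_simps e M s2
  show "2 * ric_coord \<epsilon> M h P 1 1 = (a - d) ^ 2 - 4 * b ^ 2 + h ^ 2 - l ^ 2"
    "2 * ric_coord \<epsilon> M h P 1 2 = s * P 3 * (l - h - a - d)"
    "2 * ric_coord \<epsilon> M h P 1 3 = s * P 2 * (l - h - a - d)"
    "2 * ric_coord \<epsilon> M h P 2 1 = s * (2 * b * P 2 + P 3 * (h + l - a + d))"
    "2 * ric_coord \<epsilon> M h P 2 2 = - 2 * s * b * P 1 - a ^ 2 - 2 * d * l + d ^ 2 + h ^ 2 + l ^ 2"
    "2 * ric_coord \<epsilon> M h P 2 3 = s * P 1 * (h + l - a + d) - 2 * b * (a + d - l)"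
    "2 * ric_coord \<epsilon> M h P 3 2 = s * P 1 * (d - a - h - l) - 2 * b * (a + d - l)"
    "2 * ric_coord \<epsilon> M h P 3 3 = - 2 * s * b * P 1 + 2 * a * l - a ^ 2 + d ^ 2 - h ^ 2 - l ^ 2"
    unfolding ric_coord_def sum_3 dorfman_coord_def
    by (simp_all, simp_all add: field_simps power2_eq_square s2 e(4))
qed

lemma ric_coord_null:
  fixes s :: real
  assumes e: "\<epsilon> 1 = s" "\<epsilon> 2 = s" "\<epsilon> 3 = -s" "s * s = 1"
    and M: "M 1 1 = s * l" "M 1 2 = s * n" "M 1 3 = 0" "M 2 1 = s * n" "M 3 1 = 0"
      "M 2 2 = s * l" "M 2 3 = s * n" "M 3 2 = s * n" "M 3 3 = - s * l"
  shows "2 * ric_coord \<epsilon> M h P 1 1 = - 2 * s * n * P 3 + h ^ 2 - l ^ 2 - 4 * n ^ 2"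
    "2 * ric_coord \<epsilon> M h P 1 2 = - s * P 3 * (h + l) - 2 * l * n"
    "2 * ric_coord \<epsilon> M h P 2 1 = s * (2 * n * P 2 + P 3 * (h + l)) - 2 * l * n"
    "2 * ric_coord \<epsilon> M h P 2 2 = 2 * s * n * (P 3 - P 1) + h ^ 2 - l ^ 2"
    "2 * ric_coord \<epsilon> M h P 3 2 = - s * P 1 * (h + l) - 2 * l * n"
proof -
  have s2: "s * (s * x) = x" for x using e(4) by (metis mult.assoc mult_1)
  note [simp] = structure_coord_frame levi_simps e M s2
  show "2 * ric_coord \<epsilon> M h P 1 1 = - 2 * s * n * P 3 + h ^ 2 - l ^ 2 - 4 * n ^ 2"
    "2 * ric_coord \<epsilon> M h P 1 2 = - s * P 3 * (h + l) - 2 * l * n"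
    "2 * ric_coord \<epsilon> M h P 2 1 = s * (2 * n * P 2 + P 3 * (h + l)) - 2 * l * n"
    "2 * ric_coord \<epsilon> M h P 2 2 = 2 * s * n * (P 3 - P 1) + h ^ 2 - l ^ 2"
    "2 * ric_coord \<epsilon> M h P 3 2 = - s * P 1 * (h + l) - 2 * l * n"
    unfolding ric_coord_def sum_3 dorfman_coord_def
    by (simp_all, simp_all add: field_simps power2_eq_square s2 e(4))
qed

lemma block_einstein:
  fixes s :: real
  assumes e: "\<epsilon> 1 = s" "\<epsilon> 2 = s" "\<epsilon> 3 = -s" "s * s = 1"
    and M: "M 1 1 = s * l" "M 1 2 = 0" "M 1 3 = 0" "M 2 1 = 0" "M 3 1 = 0"
      "M 2 2 = s * a" "M 2 3 = s * b" "M 3 2 = s * b" "M 3 3 = - s * d"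
    and b: "b \<noteq> 0" "(a - d) ^ 2 \<le> 4 * b ^ 2"
    and plus: "\<And>c d. ric_coord \<epsilon> M h P c d = 0"
    and minus: "\<And>c d. ric_coord (\<lambda>a. - \<epsilon> a) M h N c d = 0"
  shows "l = 0" "h = 0" "(a - d) ^ 2 = 4 * b ^ 2"
proof -
  note p = ric_coord_block[OF e M, of h P, unfolded plus]
  note m = ric_coord_block[of "\<lambda>a. - \<epsilon> a" "- s" M "- l" "- a" "- b" "- d" h N, simplified e M minus, simplified]
  have s: "s \<noteq> 0" using e(4) by auto
  define t where "t = a + d - l"
  have 1: "(a - d) ^ 2 - 4 * b ^ 2 = l ^ 2 - h ^ 2" using p(1) by simp
  have 2: "h ^ 2 + l ^ 2 = l * (a + d)" using p(5,8) by (simp add: algebra_simps)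
  have 3: "2 * (s * P 1) * b = - (a - d) * t" using p(5,8) unfolding t_def by algebra
  have 4: "s * P 1 * (a - d) = - 2 * b * t" using p(6,7) unfolding t_def by algebra
  have 5: "s * P 1 * (h + l) = 0" using p(6,7) by algebra
  have 6: "2 * (s * N 1) * b = - (a - d) * t" using m(5,8) e(4) unfolding t_def by algebra
  have 7: "s * N 1 * (l - h) = 0" using m(6,7) e(4) by algebra
  have "t * ((a - d) ^ 2 - 4 * b ^ 2) = 0" using 3 4 by algebra
  then consider "t = 0" | "t \<noteq> 0" "(a - d) ^ 2 = 4 * b ^ 2" by auto
  then have "l = 0 \<and> h = 0"
  proof cases
    case 1
    then have "h ^ 2 = 0" using 2 unfolding t_def by algebra
    moreover from this have "l ^ 2 \<le> 0" using \<open>(a - d) ^ 2 - 4 * b ^ 2 = l ^ 2 - h ^ 2\<close> b(2) by linarith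
    ultimately show ?thesis by simp
  next
    case t: 2
    then have "a - d \<noteq> 0" using b by auto
    then have "P 1 \<noteq> 0" "N 1 \<noteq> 0" using 3 6 t by auto
    then have "h = - l" "h = l" using 5 7 s by auto
    then show ?thesis by simp
  qed
  then show "l = 0" "h = 0" "(a - d) ^ 2 = 4 * b ^ 2" using 1 by auto
qed

lemma block_einstein_divergence:
  fixes s :: real
  assumes e: "\<epsilon> 1 = s" "\<epsilon> 2 = s" "\<epsilon> 3 = -s" "s * s = 1"
    and M: "M 1 1 = 0" "M 1 2 = 0" "M 1 3 = 0" "M 2 1 = 0" "M 3 1 = 0"
      "M 2 2 = s * a" "M 2 3 = s * b" "M 3 2 = s * b" "M 3 3 = - s * d"
    and plus: "\<And>c d. ric_coord \<epsilon> M 0 P c d = 0"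
  shows "P 2 * (a + d) = 0" "P 3 * (a + d) = 0" "2 * b * P 2 = (a - d) * P 3"
    "- 2 * b * (s * P 1) = a ^ 2 - d ^ 2"
proof -
  note p = ric_coord_block[OF e, of M 0 a b d 0 P, unfolded plus, simplified M, simplified]
  have s: "s \<noteq> 0" using e(4) by auto
  show "P 2 * (a + d) = 0" "P 3 * (a + d) = 0" using p(2,3) s by algebra+
  show "2 * b * P 2 = (a - d) * P 3" using p(4) s by (simp add: algebra_simps)
  show "- 2 * b * (s * P 1) = a ^ 2 - d ^ 2" using p(5) by algebra
qed

lemma null_einstein:
  fixes s :: real
  assumes e: "\<epsilon> 1 = s" "\<epsilon> 2 = s" "\<epsilon> 3 = -s" "s * s = 1"
    and M: "M 1 1 = s * l" "M 1 2 = s * n" "M 1 3 = 0" "M 2 1 = s * n" "M 3 1 = 0"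
      "M 2 2 = s * l" "M 2 3 = s * n" "M 3 2 = s * n" "M 3 3 = - s * l"
    and n: "n \<noteq> 0"
    and plus: "\<And>c d. ric_coord \<epsilon> M h P c d = 0"
    and minus: "\<And>c d. ric_coord (\<lambda>a. - \<epsilon> a) M h N c d = 0"
  shows "l = 0" "h = 0"
proof -
  note p = ric_coord_null[OF e M, of h P, unfolded plus]
  note m = ric_coord_null[of "\<lambda>a. - \<epsilon> a" "- s" M "- l" "- n" h N, simplified e M minus, simplified]
  have s: "s \<noteq> 0" using e(4) by auto
  have "(s * P 3 - s * P 1) * (h + l) = 0" using p(2,5) by algebra
  then have 1: "h = l \<or> h = - l" using p(4) by algebra
  moreover have "l = 0" if "h = - l" using p(2) that n by simp
  moreover have "l = 0" if "h = l" using m(2) that n e(4) by simp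
  ultimately show "l = 0" "h = 0" by auto
qed

lemma null_einstein_divergence:
  fixes s :: real
  assumes e: "\<epsilon> 1 = s" "\<epsilon> 2 = s" "\<epsilon> 3 = -s" "s * s = 1"
    and M: "M 1 1 = 0" "M 1 2 = s * n" "M 1 3 = 0" "M 2 1 = s * n" "M 3 1 = 0"
      "M 2 2 = 0" "M 2 3 = s * n" "M 3 2 = s * n" "M 3 3 = 0"
    and n: "n \<noteq> 0"
    and plus: "\<And>c d. ric_coord \<epsilon> M 0 P c d = 0"
  shows "s * P 1 = - 2 * n" "P 2 = 0" "s * P 3 = - 2 * n"
proof -
  have M': "M 1 1 = s * 0" "M 2 2 = s * 0" "M 3 3 = - s * 0" using M by simp_all
  note R = ric_coord_null[OF e M'(1) M(2-5) M'(2) M(7,8) M'(3), of 0 P, unfolded plus]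
  have p: "- 2 * s * n * P 3 - 4 * n ^ 2 = 0" "s * (2 * n * P 2) = 0" "2 * s * n * (P 3 - P 1) = 0"
    using R(1,3,4) by (simp_all only: power_zero_numeral mult_zero_left mult_zero_right add_0_right diff_zero)
  have s: "s \<noteq> 0" using e(4) by auto
  have "(2 * n) * (s * P 3 + 2 * n) = 0" using p(1) by algebra
  then show 3: "s * P 3 = - 2 * n" using n by simp
  show "P 2 = 0" using p(2) n s by simp
  show "s * P 1 = - 2 * n" using p(3) 3 n s by simp
qed

lemma diag_einstein_cases:
  fixes x y z h :: real
  assumes eq: "x ^ 2 - (y - z) ^ 2 - h ^ 2 = 0" "y ^ 2 - (z - x) ^ 2 - h ^ 2 = 0" "z ^ 2 - (x - y) ^ 2 - h ^ 2 = 0"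
  obtains "x = 0" "y = 0" "z = 0" "h = 0" | "x = y" "y = z" "x = h \<or> x = - h" "h \<noteq> 0"
    | "h = 0" "z = 0" "x = y" "y \<noteq> 0" | "h = 0" "x = 0" "y = z" "z \<noteq> 0" | "h = 0" "y = 0" "z = x" "x \<noteq> 0"
proof -
  define X Y Z where "X = x + y - z" and "Y = x - y + z" and "Z = y + z - x"
  have XYZ: "X * Y = h ^ 2" "X * Z = h ^ 2" "Y * Z = h ^ 2"
    using eq unfolding X_def Y_def Z_def by algebra+
  have xyz: "x = (X + Y) / 2" "y = (X + Z) / 2" "z = (Y + Z) / 2"
    unfolding X_def Y_def Z_def by simp_all
  show ?thesis
  proof (cases "h = 0")
    case True
    then have "X = 0 \<and> Y = 0 \<or> X = 0 \<and> Z = 0 \<or> Y = 0 \<and> Z = 0" using XYZ by auto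
    then show ?thesis
    proof (elim disjE conjE)
      assume "X = 0" "Y = 0" then show ?thesis using that(1,4) True xyz by (cases "Z = 0") auto
    next
      assume "X = 0" "Z = 0" then show ?thesis using that(1,5) True xyz by (cases "Y = 0") auto
    next
      assume "Y = 0" "Z = 0" then show ?thesis using that(1,3) True xyz by (cases "X = 0") auto
    qed
  next
    case False
    then have "X \<noteq> 0" "Y \<noteq> 0" "X * (Y - Z) = 0" "Y * (X - Z) = 0" using XYZ by (auto simp: algebra_simps)
    then have "Y = Z" "X = Z" by auto
    moreover from this have "Z = h \<or> Z = - h" using XYZ by (simp add: power2_eq_iff flip: power2_eq_square)
    ultimately show ?thesis using that(2) False xyz by simp
  qed
qed


section \<open>Recognising three-dimensional Lie algebras\<close>

definition linindep3 :: "'v::real_vector \<Rightarrow> 'v \<Rightarrow> 'v \<Rightarrow> bool" where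
  "linindep3 x y z \<longleftrightarrow> (\<forall>a b c. a *\<^sub>R x + b *\<^sub>R y + c *\<^sub>R z = 0 \<longrightarrow> a = 0 \<and> b = 0 \<and> c = 0)"

lemma linindep3_independent:
  assumes "linindep3 x y z"
  shows "independent {x, y, z}" "card {x, y, z} = 3"
proof -
  have d: "x \<noteq> y" "y \<noteq> z" "x \<noteq> z"
    using assms unfolding linindep3_def
    by (metis add.right_neutral add_0_left add.right_inverse scaleR_minus1_left scaleR_one scaleR_zero_left
        zero_neq_one)+
  then show "card {x, y, z} = 3" by simp
  show "independent {x, y, z}"
  proof (rule independent_if_scalars_zero)
    fix f w assume "(\<Sum>w\<in>{x, y, z}. f w *\<^sub>R w) = 0" and w: "w \<in> {x, y, z}"
    then have "f x *\<^sub>R x + f y *\<^sub>R y + f z *\<^sub>R z = 0" using d by (simp add: add.assoc)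
    then show "f w = 0" using assms w unfolding linindep3_def by blast
  qed simp
qed

lemma span_3: "w \<in> span {x, y, z} \<longleftrightarrow> (\<exists>a b c. w = a *\<^sub>R x + b *\<^sub>R y + c *\<^sub>R z)"
proof -
  have "w \<in> span {x, y, z} \<longleftrightarrow> (\<exists>a b c. w - a *\<^sub>R x - b *\<^sub>R y - c *\<^sub>R z = 0)"
    by (auto simp: span_breakdown_eq)
  also have "\<dots> \<longleftrightarrow> (\<exists>a b c. w = a *\<^sub>R x + b *\<^sub>R y + c *\<^sub>R z)"
    by (simp add: algebra_simps)
  finally show ?thesis .
qed

lemma linindep3_expand:
  fixes x :: "'a::euclidean_space"
  assumes "DIM('a) = 3" "linindep3 x y z"
  obtains a b c where "w = a *\<^sub>R x + b *\<^sub>R y + c *\<^sub>R z"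
proof -
  have "span {x, y, z} = UNIV"
    using linindep3_independent[OF assms(2)] assms(1)
    by (metis card_ge_dim_independent dim_UNIV subset_UNIV le_refl top.extremum_uniqueI)
  then show ?thesis using that span_3[of w x y z] by blast
qed

lemma lie_isomorphic_basis:
  fixes t p q :: "'a::euclidean_space" and t' p' q' :: "'b::real_vector"
  assumes dim: "DIM('a) = 3"
    and br: "bilinear br" "\<And>x. br x x = 0" and br': "bilinear br'" "\<And>x. br' x x = 0"
    and indep: "linindep3 t p q" and indep': "linindep3 t' p' q'"
    and S: "\<And>x. x \<in> S \<longleftrightarrow> (\<exists>a b c. x = a *\<^sub>R t' + b *\<^sub>R p' + c *\<^sub>R q')"
    and c1: "br t p = a1 *\<^sub>R t + a2 *\<^sub>R p + a3 *\<^sub>R q" "br' t' p' = a1 *\<^sub>R t' + a2 *\<^sub>R p' + a3 *\<^sub>R q'"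
    and c2: "br t q = b1 *\<^sub>R t + b2 *\<^sub>R p + b3 *\<^sub>R q" "br' t' q' = b1 *\<^sub>R t' + b2 *\<^sub>R p' + b3 *\<^sub>R q'"
    and c3: "br p q = c1 *\<^sub>R t + c2 *\<^sub>R p + c3 *\<^sub>R q" "br' p' q' = c1 *\<^sub>R t' + c2 *\<^sub>R p' + c3 *\<^sub>R q'"
  shows "lie_isomorphic br S br'"
proof -
  note I = linindep3_independent[OF indep]
  have d: "t \<noteq> p" "p \<noteq> q" "t \<noteq> q" using I(2) by (auto simp: card_insert_if split: if_splits)
  obtain f where f: "linear f"
    and f3: "\<forall>x\<in>{t, p, q}. f x = (if x = t then t' else if x = p then p' else q')"
    using linear_independent_extend[OF I(1), of "\<lambda>x. if x = t then t' else if x = p then p' else q'"]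
    by blast
  have ft: "f t = t'" "f p = p'" "f q = q'" using f3 d by auto
  note fs = linear_add[OF f] linear_scale[OF f] linear_neg[OF f] linear_diff[OF f] ft
  have ex: "\<exists>a b c. x = a *\<^sub>R t + b *\<^sub>R p + c *\<^sub>R q" for x using linindep3_expand[OF dim indep] by metis
  have "x = 0" if "f x = 0" for x
  proof -
    obtain a b c where x: "x = a *\<^sub>R t + b *\<^sub>R p + c *\<^sub>R q" using ex by blast
    then have "a = 0 \<and> b = 0 \<and> c = 0" using that indep' by (simp add: fs linindep3_def)
    then show ?thesis using x by simp
  qed
  then have "inj f" using linear_injective_0[OF f] by blast
  moreover have "range f = S"
  proof (intro set_eqI iffI)
    fix y assume "y \<in> range f"
    then obtain x where x: "y = f x" by blast
    obtain a b c where "x = a *\<^sub>R t + b *\<^sub>R p + c *\<^sub>R q" using ex by blast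
    then have "y = a *\<^sub>R t' + b *\<^sub>R p' + c *\<^sub>R q'" by (simp add: x fs)
    then show "y \<in> S" using S by blast
  next
    fix y assume "y \<in> S"
    then obtain a b c where "y = a *\<^sub>R t' + b *\<^sub>R p' + c *\<^sub>R q'" using S by blast
    then have "y = f (a *\<^sub>R t + b *\<^sub>R p + c *\<^sub>R q)" by (simp add: fs)
    then show "y \<in> range f" by blast
  qed
  moreover have "f (br x y) = br' (f x) (f y)" for x y
  proof -
    have "f (br x y) = br' (f x) (f y)" if "x \<in> {t, p, q}" "y \<in> {t, p, q}" for x y
      using that alternating_skew[OF br, of p t] alternating_skew[OF br, of q t] alternating_skew[OF br, of q p]
        alternating_skew[OF br', of p' t'] alternating_skew[OF br', of q' t'] alternating_skew[OF br', of q' p']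
      by (auto simp: fs c1 c2 c3 br br' linear_0[OF f])
    moreover have "bilinear (\<lambda>x y. f (br x y))" "bilinear (\<lambda>x y. br' (f x) (f y))"
      using f br(1) br'(1) unfolding bilinear_def
      by (auto intro: linear_compose[unfolded o_def] linear_compose[of f, unfolded o_def])
    moreover have "x \<in> span {t, p, q}" for x using ex by (simp add: span_3)
    ultimately show ?thesis
      using bilinear_eq[of "\<lambda>x y. f (br x y)" "\<lambda>x y. br' (f x) (f y)" UNIV "{t, p, q}" UNIV "{t, p, q}" x y]
      by blast
  qed
  ultimately show ?thesis unfolding lie_isomorphic_def using f by blast
qed

lemma so_carrier_iff:
  "A \<in> so_carrier s \<longleftrightarrow> (\<forall>i j. s $ i * A $ i $ j + s $ j * A $ j $ i = 0)"
proof
  assume A: "A \<in> so_carrier s"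
  have ax: "(A *v axis j 1) $ i = A $ i $ j" for i j
    by (simp add: matrix_vector_mult_basis column_def)
  have df: "diag_form s x (axis i 1) = s $ i * x $ i" "diag_form s (axis i 1) x = s $ i * x $ i" for x i
    by (simp_all add: diag_form_def axis_def if_distrib[of "(*) _"] if_distrib[of "\<lambda>z. z * _"] cong: if_cong)
  show "\<forall>i j. s $ i * A $ i $ j + s $ j * A $ j $ i = 0"
  proof (intro allI)
    fix i j
    have "diag_form s (A *v axis j 1) (axis i 1) + diag_form s (axis j 1) (A *v axis i 1) = 0"
      using A unfolding so_carrier_def by blast
    then show "s $ i * A $ i $ j + s $ j * A $ j $ i = 0" by (simp add: df ax)
  qed
next
  assume A: "\<forall>i j. s $ i * A $ i $ j + s $ j * A $ j $ i = 0"
  have "diag_form s (A *v x) y + diag_form s x (A *v y) = 0" for x y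
  proof -
    have "diag_form s (A *v x) y = (\<Sum>i\<in>UNIV. \<Sum>j\<in>UNIV. s $ i * A $ i $ j * x $ j * y $ i)"
      by (simp add: diag_form_def matrix_vector_mult_def sum_distrib_left sum_distrib_right mult.assoc)
    moreover have "diag_form s x (A *v y) = (\<Sum>i\<in>UNIV. \<Sum>j\<in>UNIV. s $ i * A $ i $ j * y $ j * x $ i)"
      by (simp add: diag_form_def matrix_vector_mult_def sum_distrib_left sum_distrib_right mult_ac)
    moreover have "\<dots> = (\<Sum>i\<in>UNIV. \<Sum>j\<in>UNIV. s $ j * A $ j $ i * x $ j * y $ i)"
      by (subst sum.swap) (simp add: mult_ac)
    moreover have "s $ i * A $ i $ j * x $ j * y $ i + s $ j * A $ j $ i * x $ j * y $ i = 0" for i j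
      using A by (metis distrib_right mult_zero_left)
    ultimately show ?thesis by (simp add: sum.distrib[symmetric])
  qed
  then show "A \<in> so_carrier s" by (simp add: so_carrier_def)
qed

lemma bilinear_commutator: "bilinear commutator"
  unfolding bilinear_def commutator_def
  by (auto intro!: linearI simp: vec_eq_iff matrix_matrix_mult_def sum.distrib sum_distrib_left algebra_simps
      sum_subtractf)

lemma commutator_self: "commutator A A = 0"
  by (simp add: commutator_def)

lemma bilinear_e_bracket: "bilinear e_bracket"
  unfolding bilinear_def e_bracket_def
  by (auto intro!: linearI simp: bilinear_simps[OF bilinear_commutator] vec_eq_iff
      matrix_vector_mult_def sum.distrib sum_distrib_left algebra_simps sum_subtractf)

lemma e_bracket_self: "e_bracket p p = 0"
  by (simp add: e_bracket_def commutator_self zero_prod_def)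

lemma is_so3I:
  fixes x y z :: "'a::euclidean_space"
  assumes "DIM('a) = 3" "bilinear br" "\<And>x. br x x = 0" "linindep3 x y z"
    and "br x y = z" "br y z = x" "br z x = y"
  shows "is_so3 br"
proof -
  define X :: "real^3^3" where "X = vector [vector [0, 0, 0], vector [0, 0, -1], vector [0, 1, 0]]"
  define Y :: "real^3^3" where "Y = vector [vector [0, 0, 1], vector [0, 0, 0], vector [-1, 0, 0]]"
  define Z :: "real^3^3" where "Z = vector [vector [0, -1, 0], vector [1, 0, 0], vector [0, 0, 0]]"
  note m = X_def Y_def Z_def vec_eq_iff forall_3
  have "br x z = - y" using alternating_skew[OF assms(2,3), of x z] assms(7) by simp
  then show ?thesis
    unfolding is_so3_def
    by (intro lie_isomorphic_basis[of br commutator x y z X Y Z _ 0 0 1 0 "-1" 0 1 0 0]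
        assms bilinear_commutator commutator_self)
      (auto simp: assms linindep3_def m commutator_def matrix_matrix_mult_def sum_3 so_carrier_iff
        intro: exI[where x = "_ $ 3 $ 2"])
qed

lemma is_so21I:
  fixes x y z :: "'a::euclidean_space"
  assumes "DIM('a) = 3" "bilinear br" "\<And>x. br x x = 0" "linindep3 x y z"
    and "br x y = z" "br y z = - x" "br z x = - y"
  shows "is_so21 br"
proof -
  define X :: "real^3^3" where "X = vector [vector [0, 0, 0], vector [0, 0, 1], vector [0, 1, 0]]"
  define Y :: "real^3^3" where "Y = vector [vector [0, 0, 1], vector [0, 0, 0], vector [1, 0, 0]]"
  define Z :: "real^3^3" where "Z = vector [vector [0, -1, 0], vector [1, 0, 0], vector [0, 0, 0]]"
  note m = X_def Y_def Z_def vec_eq_iff forall_3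
  have "br x z = y" using alternating_skew[OF assms(2,3), of x z] assms(7) by simp
  then show ?thesis
    unfolding is_so21_def
    by (intro lie_isomorphic_basis[of br commutator x y z X Y Z _ 0 0 1 0 1 0 "-1" 0 0]
        assms bilinear_commutator commutator_self)
      (auto simp: assms linindep3_def m commutator_def matrix_matrix_mult_def sum_3 so_carrier_iff
        intro: exI[where x = "_ $ 3 $ 2"])
qed

lemma is_e2I:
  fixes t p q :: "'a::euclidean_space"
  assumes "DIM('a) = 3" "bilinear br" "\<And>x. br x x = 0" "linindep3 t p q"
    and "br t p = q" "br t q = - p" "br p q = 0"
  shows "is_e2 br"
proof -
  define T :: "(real^2^2) \<times> (real^2)" where "T = (vector [vector [0, -1], vector [1, 0]], 0)"
  define P :: "(real^2^2) \<times> (real^2)" where "P = (0, vector [1, 0])"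
  define Q :: "(real^2^2) \<times> (real^2)" where "Q = (0, vector [0, 1])"
  note m = T_def P_def Q_def vec_eq_iff forall_2 prod_eq_iff
  show ?thesis
    unfolding is_e2_def
    by (intro lie_isomorphic_basis[of br e_bracket t p q T P Q _ 0 0 1 0 "-1" 0 0 0 0]
        assms bilinear_e_bracket e_bracket_self)
      (auto simp: assms linindep3_def m commutator_def e_bracket_def matrix_matrix_mult_def
        matrix_vector_mult_def sum_2 so_carrier_iff e_carrier_def mem_Times_iff)
qed

lemma is_e11I:
  fixes t p q :: "'a::euclidean_space"
  assumes "DIM('a) = 3" "bilinear br" "\<And>x. br x x = 0" "linindep3 t p q"
    and "br t p = p" "br t q = - q" "br p q = 0"
  shows "is_e11 br"
proof -
  define T :: "(real^2^2) \<times> (real^2)" where "T = (vector [vector [0, 1], vector [1, 0]], 0)"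
  define P :: "(real^2^2) \<times> (real^2)" where "P = (0, vector [1, 1])"
  define Q :: "(real^2^2) \<times> (real^2)" where "Q = (0, vector [1, -1])"
  note m = T_def P_def Q_def vec_eq_iff forall_2 prod_eq_iff
  have sum_diff: "\<exists>b c. x = b + c \<and> y = b - c" for x y :: real
    by (intro exI[where x = "(x + y) / 2"] exI[where x = "(x - y) / 2"]) (simp add: field_simps)
  show ?thesis
    unfolding is_e11_def
    by (intro lie_isomorphic_basis[of br e_bracket t p q T P Q _ 0 1 0 0 0 "-1" 0 0 0]
        assms bilinear_e_bracket e_bracket_self)
      (auto simp: assms linindep3_def m commutator_def e_bracket_def matrix_matrix_mult_def
        matrix_vector_mult_def sum_2 so_carrier_iff e_carrier_def mem_Times_iff sum_diff)
qed

lemma is_e11I_hyperbolic: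
  fixes t p q :: "'a::euclidean_space"
  assumes dim: "DIM('a) = 3" and br: "bilinear br" "\<And>x. br x x = 0" and indep: "linindep3 t p q"
    and c: "br t p = x *\<^sub>R p + y *\<^sub>R q" "br t q = z *\<^sub>R p - x *\<^sub>R q" "br p q = 0"
    and \<kappa>: "x ^ 2 + y * z = \<kappa> ^ 2" "\<kappa> \<noteq> 0" and y: "y \<noteq> 0"
  shows "is_e11 br"
proof (rule is_e11I[OF dim br])
  let ?t = "(1 / \<kappa>) *\<^sub>R t" and ?u = "br t p"
  note bs = bilinear_simps[OF br(1)]
  have tu: "br t ?u = \<kappa> ^ 2 *\<^sub>R p"
    by (simp add: c bs algebra_simps flip: \<kappa>(1) scaleR_add_left) (simp add: power2_eq_square)
  show "br ?t (\<kappa> *\<^sub>R p + ?u) = \<kappa> *\<^sub>R p + ?u" "br ?t (\<kappa> *\<^sub>R p - ?u) = - (\<kappa> *\<^sub>R p - ?u)"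
    using \<kappa>(2) by (simp_all add: bs tu algebra_simps power2_eq_square)
  have "br p ?u = 0" by (simp add: c bs br)
  moreover from this have "br ?u p = 0" using alternating_skew[OF br, of ?u p] by simp
  ultimately show "br (\<kappa> *\<^sub>R p + ?u) (\<kappa> *\<^sub>R p - ?u) = 0"
    by (simp add: bs br)
  show "linindep3 ?t (\<kappa> *\<^sub>R p + ?u) (\<kappa> *\<^sub>R p - ?u)"
    unfolding linindep3_def
  proof (intro allI impI)
    fix a b d assume "a *\<^sub>R ?t + b *\<^sub>R (\<kappa> *\<^sub>R p + ?u) + d *\<^sub>R (\<kappa> *\<^sub>R p - ?u) = 0"
    then have "(a / \<kappa>) *\<^sub>R t + ((b + d) * \<kappa> + (b - d) * x) *\<^sub>R p + ((b - d) * y) *\<^sub>R q = 0"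
      by (simp add: c algebra_simps)
    then have "a / \<kappa> = 0" "(b + d) * \<kappa> + (b - d) * x = 0" "(b - d) * y = 0"
      using indep unfolding linindep3_def by blast+
    then show "a = 0 \<and> b = 0 \<and> d = 0" using \<kappa>(2) y by auto
  qed
qed

lemma is_heisenbergI:
  fixes x y z :: "'a::euclidean_space"
  assumes "DIM('a) = 3" "bilinear br" "\<And>x. br x x = 0" "linindep3 x y z"
    and "br x y = z" "br x z = 0" "br y z = 0"
  shows "is_heisenberg br"
proof -
  define X :: "real^3" where "X = vector [1, 0, 0]"
  define Y :: "real^3" where "Y = vector [0, 1, 0]"
  define Z :: "real^3" where "Z = vector [0, 0, 1]"
  note m = X_def Y_def Z_def vec_eq_iff forall_3 heisenberg_bracket_def
  have "bilinear heisenberg_bracket"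
    unfolding bilinear_def by (auto intro!: linearI simp: m algebra_simps)
  moreover have "heisenberg_bracket x x = 0" for x
    by (simp add: m mult.commute)
  ultimately show ?thesis
    unfolding is_heisenberg_def
    by (intro lie_isomorphic_basis[of br heisenberg_bracket x y z X Y Z _ 0 0 1 0 0 0 0 0 0] assms)
      (auto simp: assms linindep3_def m)
qed

text \<open>
  On \<open>so(3)\<close> every \<open>ad x\<close> is skew for the invariant inner product, so its square has no positive
  eigenvalue.
\<close>

lemma not_is_so3I:
  assumes "br x (br x y) = c *\<^sub>R y" "c > 0" "y \<noteq> 0"
  shows "\<not> is_so3 br"
proof
  assume "is_so3 br"
  then obtain f where f: "linear f" "inj f" "range f = so_carrier (vector [1, 1, 1] :: real^3)"
    "\<And>x y. f (br x y) = commutator (f x) (f y)"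
    unfolding is_so3_def lie_isomorphic_def by blast
  define X Y where "X = f x" and "Y = f y"
  have XY: "X \<in> so_carrier (vector [1, 1, 1])" "Y \<in> so_carrier (vector [1, 1, 1])"
    using f(3) X_def Y_def by blast+
  have e: "commutator X (commutator X Y) = c *\<^sub>R Y"
    using assms(1) f(4) linear_scale[OF f(1)] X_def Y_def by metis
  have sk: "A$1$1 = 0 \<and> A$2$2 = 0 \<and> A$3$3 = 0 \<and> A$1$2 = - A$2$1 \<and> A$3$1 = - A$1$3 \<and> A$2$3 = - A$3$2"
    if "A \<in> so_carrier (vector [1, 1, 1])" for A :: "real^3^3"
    using that by (auto simp: so_carrier_iff forall_3)
  define x1 x2 x3 y1 y2 y3 where d: "x1 = X$3$2" "x2 = X$1$3" "x3 = X$2$1" "y1 = Y$3$2" "y2 = Y$1$3" "y3 = Y$2$1"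
  define k1 k2 k3 where k: "k1 = x2 * y3 - x3 * y2" "k2 = x3 * y1 - x1 * y3" "k3 = x1 * y2 - x2 * y1"
  have XE: "X$1$1 = 0" "X$2$2 = 0" "X$3$3 = 0" "X$3$2 = x1" "X$2$3 = - x1" "X$1$3 = x2" "X$3$1 = - x2"
    "X$2$1 = x3" "X$1$2 = - x3" using sk[OF XY(1)] d by simp_all
  have YE: "Y$1$1 = 0" "Y$2$2 = 0" "Y$3$3 = 0" "Y$3$2 = y1" "Y$2$3 = - y1" "Y$1$3 = y2" "Y$3$1 = - y2"
    "Y$2$1 = y3" "Y$1$2 = - y3" using sk[OF XY(2)] d by simp_all
  have E: "commutator X (commutator X Y) $ i $ j = c * Y $ i $ j" for i j using e by simp
  have "commutator X (commutator X Y) $ 3 $ 2 = x2 * k3 - x3 * k2"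
    "commutator X (commutator X Y) $ 1 $ 3 = x3 * k1 - x1 * k3"
    "commutator X (commutator X Y) $ 2 $ 1 = x1 * k2 - x2 * k1"
    by (simp_all add: commutator_def matrix_matrix_mult_def sum_3 XE YE k algebra_simps)
  then have "x2 * k3 - x3 * k2 = c * y1" "x3 * k1 - x1 * k3 = c * y2" "x1 * k2 - x2 * k1 = c * y3"
    unfolding E YE by simp_all
  then have "c * (y1 ^ 2 + y2 ^ 2 + y3 ^ 2) = - (k1 ^ 2 + k2 ^ 2 + k3 ^ 2)"
    unfolding k by algebra
  then have "c * (y1 ^ 2 + y2 ^ 2 + y3 ^ 2) \<le> 0"
    using zero_le_power2[of k1] zero_le_power2[of k2] zero_le_power2[of k3] by linarith
  then have "y1 ^ 2 + y2 ^ 2 + y3 ^ 2 \<le> 0" using assms(2) by (simp add: mult_le_0_iff)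
  then have "y1 = 0" "y2 = 0" "y3 = 0"
    using zero_le_power2[of y1] zero_le_power2[of y2] zero_le_power2[of y3]
    by (smt (verit) power2_eq_iff_nonneg zero_eq_power2)+
  then have "Y = 0" using sk[OF XY(2)] by (simp add: vec_eq_iff forall_3 d)
  then have "y = 0" using f(1,2) Y_def by (metis linear_0 injD)
  then show False using assms(3) by simp
qed


section \<open>Orthonormal frames and eigenvectors of symmetric endomorphisms\<close>

definition orthonormal_set :: "('a::real_vector \<Rightarrow> 'a \<Rightarrow> real) \<Rightarrow> 'a set \<Rightarrow> bool" where
  "orthonormal_set g S \<longleftrightarrow> (\<forall>x\<in>S. g x x * g x x = 1) \<and> (\<forall>x\<in>S. \<forall>y\<in>S. x \<noteq> y \<longrightarrow> g x y = 0)"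

lemma pseudo_metricD:
  assumes "pseudo_metric g"
  shows "bilinear g" "g x y = g y x" "(\<And>y. g x y = 0) \<Longrightarrow> x = 0"
  using assms unfolding pseudo_metric_def by blast+

lemma g_sum_orthonormal_set:
  assumes g: "bilinear g" and S: "orthonormal_set g S" "finite S" "x \<in> S"
  shows "g (\<Sum>y\<in>S. c y *\<^sub>R y) x = c x * g x x"
proof -
  have "g (\<Sum>y\<in>S. c y *\<^sub>R y) x = (\<Sum>y\<in>S. c y * g y x)" by (simp add: bilinear_sum_left[OF g])
  also have "\<dots> = (\<Sum>y\<in>S. if y = x then c x * g x x else 0)"
    using S by (intro sum.cong) (auto simp: orthonormal_set_def)
  finally show ?thesis using S by simp
qed

lemma independent_orthonormal_set:
  assumes g: "bilinear g" and S: "orthonormal_set g S" "finite S"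
  shows "independent S"
proof (rule independent_if_scalars_zero[OF S(2)])
  fix f x assume s: "(\<Sum>x\<in>S. f x *\<^sub>R x) = 0" and x: "x \<in> S"
  have "f x * g x x = 0"
    using g_sum_orthonormal_set[OF g S x, of f] s by (simp add: bilinear_simps[OF g])
  then show "f x = 0" using S x by (auto simp: orthonormal_set_def)
qed

lemma orthonormal_set_insert:
  fixes y :: "'a::real_vector"
  assumes g: "bilinear g" "\<And>x y. g x y = g y x" and S: "orthonormal_set g S"
    and y: "g y y \<noteq> 0" "\<And>x. x \<in> S \<Longrightarrow> g y x = 0"
  defines "y' \<equiv> (1 / sqrt \<bar>g y y\<bar>) *\<^sub>R y"
  shows "orthonormal_set g (insert y' S)" "y' \<notin> S"
proof -
  define k where "k = 1 / sqrt \<bar>g y y\<bar>"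
  have k: "k * k = 1 / \<bar>g y y\<bar>" by (simp add: k_def)
  have "g y' y' = k * k * g y y" by (simp add: y'_def k_def bilinear_simps[OF g(1)])
  also have "\<dots> = g y y / \<bar>g y y\<bar>" by (simp add: k)
  finally have 1: "g y' y' * g y' y' = 1" using y(1) by (simp add: abs_if)
  have 2: "g y' x = 0" "g x y' = 0" if "x \<in> S" for x
    using y(2)[OF that] g(2)[of x y] by (simp_all add: y'_def bilinear_simps[OF g(1)])
  show "orthonormal_set g (insert y' S)" using S 1 2 by (auto simp: orthonormal_set_def)
  show "y' \<notin> S" using 1 2(1)[of y'] by auto
qed

text \<open>
  Project an eigenbasis to the orthogonal complement of \<open>S\<close>: the images are eigenvectors, and either
  one of them or a sum of two with equal eigenvalues is not null.
\<close>

lemma orthonormal_eigenvector_extend: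
  fixes g :: "'a::euclidean_space \<Rightarrow> 'a \<Rightarrow> real"
  assumes g: "pseudo_metric g" and L: "linear L" "\<And>x y. g (L x) y = g x (L y)" "diagonalizable L"
    and S: "orthonormal_set g S" "finite S" "\<And>x. x \<in> S \<Longrightarrow> \<exists>c. L x = c *\<^sub>R x" and ne: "span S \<noteq> UNIV"
  shows "\<exists>y. y \<notin> S \<and> orthonormal_set g (insert y S) \<and> (\<exists>c. L y = c *\<^sub>R y)"
proof -
  note gb = pseudo_metricD(1)[OF g] and gc = pseudo_metricD(2)[OF g]
  note bs = bilinear_simps[OF gb]
  obtain B where B: "span B = UNIV" "\<And>b. b \<in> B \<Longrightarrow> \<exists>c. L b = c *\<^sub>R b"
    using L(3) unfolding diagonalizable_def by blast
  define \<pi> where "\<pi> y = y - (\<Sum>x\<in>S. (g y x * g x x) *\<^sub>R x)" for y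
  have \<pi>_orth: "g (\<pi> y) x = 0" if "x \<in> S" for x y
    using S that by (simp add: \<pi>_def bs g_sum_orthonormal_set[OF gb S(1,2) that] mult.assoc orthonormal_set_def)
  have \<pi>_g: "g (\<pi> y) (\<pi> z) = g (\<pi> y) z" for y z
    unfolding \<pi>_def[of z] by (simp add: bs bilinear_sum_right[OF gb] \<pi>_orth)
  have \<pi>_eigen: "L (\<pi> b) = c *\<^sub>R \<pi> b" if "L b = c *\<^sub>R b" for b c
  proof -
    have "L (\<pi> b) = c *\<^sub>R b - (\<Sum>x\<in>S. (g b x * g x x) *\<^sub>R L x)"
      by (simp add: \<pi>_def linear_diff[OF L(1)] linear_sum[OF L(1)] linear_scale[OF L(1)] that)
    also have "(\<Sum>x\<in>S. (g b x * g x x) *\<^sub>R L x) = (\<Sum>x\<in>S. c *\<^sub>R (g b x * g x x) *\<^sub>R x)"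
    proof (rule sum.cong[OF refl])
      fix x assume "x \<in> S"
      then obtain d where d: "L x = d *\<^sub>R x" using S(3) by blast
      then have "c * g b x = d * g b x" using L(2)[of b x] that by (simp add: bs)
      then show "(g b x * g x x) *\<^sub>R L x = c *\<^sub>R (g b x * g x x) *\<^sub>R x" by (auto simp: d algebra_simps)
    qed
    finally show ?thesis by (simp add: \<pi>_def scaleR_sum_right scaleR_diff_right)
  qed
  have hit: "\<exists>b\<in>B. g u (\<pi> b) \<noteq> 0" if u: "\<pi> u = u" "u \<noteq> 0" for u
  proof (rule ccontr)
    assume "\<not> (\<exists>b\<in>B. g u (\<pi> b) \<noteq> 0)"
    then have "g u b = 0" if "b \<in> B" for b using that \<pi>_g[of u b] u by simp
    then have "g u z = 0" for z
      using linear_eq_0_on_span[OF bilinear_linear_right[OF gb], of B u z] B(1) by auto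
    then show False using u pseudo_metricD(3)[OF g, of u] by simp
  qed
  have idem: "\<pi> (\<pi> y) = \<pi> y" for y
    unfolding \<pi>_def[of "\<pi> y"] by (simp add: \<pi>_orth)
  obtain y0 where y0: "y0 \<notin> span S" using ne by blast
  have "(\<Sum>x\<in>S. (g y0 x * g x x) *\<^sub>R x) \<in> span S"
    by (intro span_sum span_scale span_base)
  with y0 have "\<pi> y0 \<noteq> 0" unfolding \<pi>_def by auto
  then obtain b where b: "b \<in> B" "g (\<pi> y0) (\<pi> b) \<noteq> 0" using hit idem by blast
  then have "\<pi> b \<noteq> 0" by (auto simp: bs)
  then obtain b' where b': "b' \<in> B" "g (\<pi> b) (\<pi> b') \<noteq> 0" using hit idem by blast
  obtain c c' where c: "L (\<pi> b) = c *\<^sub>R \<pi> b" "L (\<pi> b') = c' *\<^sub>R \<pi> b'"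
    using B(2) b(1) b'(1) \<pi>_eigen by metis
  have "c * g (\<pi> b) (\<pi> b') = c' * g (\<pi> b) (\<pi> b')" using L(2)[of "\<pi> b" "\<pi> b'"] c by (simp add: bs)
  then have cc: "c = c'" using b'(2) by simp
  have "\<exists>y. g y y \<noteq> 0 \<and> (\<forall>x\<in>S. g y x = 0) \<and> L y = c *\<^sub>R y"
  proof (cases "g (\<pi> b) (\<pi> b) = 0 \<and> g (\<pi> b') (\<pi> b') = 0")
    case True
    then have "g (\<pi> b + \<pi> b') (\<pi> b + \<pi> b') \<noteq> 0" using b'(2) gc[of "\<pi> b'" "\<pi> b"] by (simp add: bs)
    then show ?thesis
      using c cc by (intro exI[of _ "\<pi> b + \<pi> b'"]) (simp add: bs \<pi>_orth linear_add[OF L(1)] scaleR_add_right)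
  next
    case False
    then show ?thesis using c cc \<pi>_orth by blast
  qed
  then obtain y where y: "g y y \<noteq> 0" "\<And>x. x \<in> S \<Longrightarrow> g y x = 0" "L y = c *\<^sub>R y" by blast
  show ?thesis
    using orthonormal_set_insert[OF gb gc S(1) y(1,2)] y(3)
    by (intro exI[of _ "(1 / sqrt \<bar>g y y\<bar>) *\<^sub>R y"]) (auto simp: linear_scale[OF L(1)] intro!: exI[of _ c])
qed

lemma orthonormal_eigenbasis_extend:
  fixes g :: "'a::euclidean_space \<Rightarrow> 'a \<Rightarrow> real"
  assumes g: "pseudo_metric g" and L: "linear L" "\<And>x y. g (L x) y = g x (L y)" "diagonalizable L"
    and S: "orthonormal_set g S" "finite S" "\<And>x. x \<in> S \<Longrightarrow> \<exists>c. L x = c *\<^sub>R x"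
  obtains T where "S \<subseteq> T" "orthonormal_set g T" "finite T" "card T = DIM('a)"
    "\<And>x. x \<in> T \<Longrightarrow> \<exists>c. L x = c *\<^sub>R x"
proof -
  have "\<exists>T. S \<subseteq> T \<and> orthonormal_set g T \<and> finite T \<and> card T = DIM('a) \<and> (\<forall>x\<in>T. \<exists>c. L x = c *\<^sub>R x)"
    if "DIM('a) - card S = k" "orthonormal_set g S" "finite S" "\<forall>x\<in>S. \<exists>c. L x = c *\<^sub>R x" for k S
    using that
  proof (induction k arbitrary: S)
    case (0 S)
    have "independent S" using independent_orthonormal_set[OF pseudo_metricD(1)[OF g]] 0 by blast
    then have "card S \<le> DIM('a)" by (rule independent_bound[THEN conjunct2])
    then show ?case using 0 by (intro exI[of _ S]) auto
  next
    case (Suc k S)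
    have "span S \<noteq> UNIV"
      using Suc.prems dim_le_card'[of S] dim_span[of S] dim_UNIV by (metis diff_is_0_eq nat.simps(3))
    then obtain y where y: "y \<notin> S" "orthonormal_set g (insert y S)" "\<exists>c. L y = c *\<^sub>R y"
      using orthonormal_eigenvector_extend[OF g L Suc.prems(2,3)] Suc.prems(4) by blast
    then have "DIM('a) - card (insert y S) = k" using Suc.prems by simp
    then show ?case using Suc.IH[of "insert y S"] Suc.prems y by auto
  qed
  then show ?thesis using that S by metis
qed

lemma diagonalizable_id: "diagonalizable (\<lambda>x::'a::euclidean_space. x)"
  unfolding diagonalizable_def
  by (intro exI[of _ Basis]) (auto simp: independent_Basis intro!: exI[of _ 1])

lemma orthonormal_basis_extend:
  fixes g :: "'a::euclidean_space \<Rightarrow> 'a \<Rightarrow> real"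
  assumes g: "pseudo_metric g" and S: "orthonormal_set g S" "finite S"
  obtains T where "S \<subseteq> T" "orthonormal_set g T" "finite T" "card T = DIM('a)"
proof -
  have "\<exists>c. x = c *\<^sub>R x" for x :: 'a by (rule exI[of _ 1]) simp
  then show ?thesis
    using orthonormal_eigenbasis_extend[OF g linear_ident _ diagonalizable_id S] that by blast
qed

lemma metric_frameI:
  fixes g :: "'a::euclidean_space \<Rightarrow> 'a \<Rightarrow> real"
  assumes dim: "DIM('a) = 3" and g: "pseudo_metric g"
    and o: "g (v 1) (v 2) = 0" "g (v 1) (v 3) = 0" "g (v 2) (v 3) = 0" and s: "\<And>a. g (v a) (v a) * g (v a) (v a) = 1"
  shows "metric_frame g v (\<lambda>a. g (v a) (v a))"
proof
  show "g (v a) (v b) = (if a = b then g (v a) (v a) else 0)" for a b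
    using exhaust_3[of a] exhaust_3[of b] o pseudo_metricD(2)[OF g] by auto
qed (use assms pseudo_metricD[OF g] in auto)

lemma orthonormal_eigenframe:
  fixes g :: "'a::euclidean_space \<Rightarrow> 'a \<Rightarrow> real"
  assumes dim: "DIM('a) = 3" and g: "pseudo_metric g"
    and L: "linear L" "\<And>x y. g (L x) y = g x (L y)" "diagonalizable L"
  obtains v where "metric_frame g v (\<lambda>a. g (v a) (v a))" "\<And>a. \<exists>c. L (v a) = c *\<^sub>R v a"
proof -
  obtain T where T: "orthonormal_set g T" "finite T" "card T = 3" "\<And>x. x \<in> T \<Longrightarrow> \<exists>c. L x = c *\<^sub>R x"
    using orthonormal_eigenbasis_extend[OF g L, of "{}"] dim by (auto simp: orthonormal_set_def)
  then obtain x y z where xyz: "T = {x, y, z}" "x \<noteq> y" "y \<noteq> z" "x \<noteq> z" by (metis card_3_iff)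
  define v :: "3 \<Rightarrow> 'a" where "v = ($) (vector [x, y, z])"
  have v: "v 1 = x" "v 2 = y" "v 3 = z" by (simp_all add: v_def)
  have vT: "v a \<in> T" for a using exhaust_3[of a] v xyz by auto
  have "metric_frame g v (\<lambda>a. g (v a) (v a))"
  proof (rule metric_frameI[OF dim g])
    show "g (v a) (v a) * g (v a) (v a) = 1" for a
      using T(1) vT[of a] unfolding orthonormal_set_def by blast
  qed (use T(1) xyz in \<open>auto simp: orthonormal_set_def v\<close>)
  then show ?thesis using that T(4) vT by blast
qed

lemma metric_frame_neg:
  assumes "metric_frame g v \<epsilon>" shows "metric_frame g (\<lambda>a. - v a) \<epsilon>"
proof -
  interpret metric_frame g v \<epsilon> by fact
  show ?thesis
    by unfold_locales (use dim3 g_bilinear g_commute sign orthonormal in \<open>auto simp: bilinear_simps[OF g_bilinear]\<close>)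
qed

lemma oriented_frame_or_neg:
  assumes "metric_frame g v \<epsilon>" and \<omega>: "orientation \<omega>"
  shows "oriented_frame g v \<epsilon> \<omega> \<or> oriented_frame g (\<lambda>a. - v a) \<epsilon> \<omega>"
proof -
  interpret metric_frame g v \<epsilon> by fact
  have f: "three_form \<omega>" using \<omega> by (simp add: orientation_def)
  then have "\<omega> (v 1) (v 2) (v 3) \<noteq> 0"
    using three_form_eq_frame_volume[OF f] \<omega> unfolding orientation_def by (metis mult_zero_left)
  moreover have "\<omega> (- v 1) (- v 2) (- v 3) = - \<omega> (v 1) (v 2) (v 3)"
    using three_form_linear[OF f, THEN linear_neg] by simp
  ultimately have "\<omega> (v 1) (v 2) (v 3) > 0 \<or> \<omega> (- v 1) (- v 2) (- v 3) > 0" by linarith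
  then show ?thesis
    using metric_frame_neg[OF assms(1)] assms(1) f
    by (simp add: oriented_frame_def oriented_frame_axioms_def)
qed

lemma cubic_root:
  fixes c0 c1 c2 :: real
  shows "\<exists>t. c0 + c1 * t + c2 * t ^ 2 - t ^ 3 = 0"
proof -
  define p where "p t = c0 + c1 * t + c2 * t ^ 2 - t ^ 3" for t
  define T where "T = 1 + \<bar>c0\<bar> + \<bar>c1\<bar> + \<bar>c2\<bar>"
  have T: "T \<ge> 1" by (simp add: T_def)
  then have "T \<le> T ^ 2" by (simp add: power2_eq_square mult_left_le)
  with T have T2: "1 \<le> T ^ 2" by linarith
  have "\<bar>c0\<bar> \<le> \<bar>c0\<bar> * T ^ 2" "\<bar>c1\<bar> * T \<le> \<bar>c1\<bar> * T ^ 2"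
    using T2 \<open>T \<le> T ^ 2\<close> by (simp_all add: mult_le_cancel_left1 mult_left_mono)
  moreover have "T ^ 3 = T ^ 2 + \<bar>c0\<bar> * T ^ 2 + \<bar>c1\<bar> * T ^ 2 + \<bar>c2\<bar> * T ^ 2"
    unfolding power3_eq_cube power2_eq_square by (subst T_def) (simp add: algebra_simps)
  moreover have "\<bar>c1 * T\<bar> = \<bar>c1\<bar> * T" "\<bar>c2 * T ^ 2\<bar> = \<bar>c2\<bar> * T ^ 2"
    using T by (simp_all add: abs_mult)
  ultimately have "p T \<le> 0" "p (- T) \<ge> 0"
    using T2 unfolding p_def by (simp_all add: power3_eq_cube power2_eq_square) linarith+
  moreover have "continuous_on {- T..T} p" unfolding p_def by (intro continuous_intros)
  ultimately obtain t where "p t = 0" using IVT2'[of p T 0 "- T"] T by auto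
  then show ?thesis unfolding p_def by blast
qed

lemma three_form_compose:
  assumes \<omega>: "three_form \<omega>" and K: "linear K"
  shows "three_form (\<lambda>x y z. \<omega> (K x) (K y) (K z))"
  unfolding three_form_def
  using three_form_linear[OF \<omega>, THEN linear_compose[OF K, unfolded o_def]] three_form_repeat[OF \<omega>]
  by blast

context metric_frame
begin

lemma exists_eigenvector:
  assumes L: "linear (L :: 'a \<Rightarrow> 'a)"
  obtains c x where "x \<noteq> 0" "L x = c *\<^sub>R x"
proof -
  note V = three_form_frame_volume
  note Vl = three_form_linear[OF V]
  define \<eta> where "\<eta> t x y z = frame_volume (L x - t *\<^sub>R x) (L y - t *\<^sub>R y) (L z - t *\<^sub>R z)" for t x y z
  let ?x = "v 1" and ?y = "v 2" and ?z = "v 3"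
  let ?V = frame_volume
  have f: "linear (\<lambda>x. L x - t *\<^sub>R x)" for t
    by (rule linearI) (simp_all add: linear_add[OF L] linear_scale[OF L] algebra_simps)
  have \<eta>: "three_form (\<eta> t)" for t
    unfolding \<eta>_def by (rule three_form_compose[OF V f])
  have "\<eta> t ?x ?y ?z = ?V (L ?x) (L ?y) (L ?z) +
      - (?V ?x (L ?y) (L ?z) + ?V (L ?x) ?y (L ?z) + ?V (L ?x) (L ?y) ?z) * t +
      (?V ?x ?y (L ?z) + ?V ?x (L ?y) ?z + ?V (L ?x) ?y ?z) * t ^ 2 - t ^ 3" for t
    by (simp add: \<eta>_def Vl[THEN linear_diff] three_form_scale[OF V] frame_volume_frame levi_simps
        algebra_simps power2_eq_square power3_eq_cube)
  then obtain t where t: "\<eta> t ?x ?y ?z = 0" using cubic_root by metis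
  let ?f = "\<lambda>x. L x - t *\<^sub>R x"
  have "\<not> inj ?f"
  proof
    assume "inj ?f"
    then have "surj ?f" using linear_injective_imp_surjective[OF f[of t]] by blast
    then have z: "?V (?f x) (?f y) (?f z) = 0" for x y z
      using three_form_eq_frame_volume[OF \<eta>, of t x y z] t by (simp add: \<eta>_def)
    obtain x y z where "?x = ?f x" "?y = ?f y" "?z = ?f z" using \<open>surj ?f\<close> by (meson surjD)
    then have "?V ?x ?y ?z = 0" using z[of x y z] by simp
    then show False using frame_volume_frame[of 1 2 3] by (simp add: levi_simps)
  qed
  then obtain x where "?f x = 0" "x \<noteq> 0" using linear_injective_0[OF f[of t]] by blast
  then show ?thesis using that[of x t] by simp
qed

end


section \<open>Normal forms of non-diagonalizable symmetric endomorphisms\<close>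

definition lorentz_frame :: "('a::real_vector \<Rightarrow> 'a \<Rightarrow> real) \<Rightarrow> real \<Rightarrow> (3 \<Rightarrow> 'a) \<Rightarrow> bool" where
  "lorentz_frame g s v \<longleftrightarrow> s * s = 1 \<and> g (v 1) (v 1) = s \<and> g (v 2) (v 2) = s \<and> g (v 3) (v 3) = - s \<and>
     g (v 1) (v 2) = 0 \<and> g (v 1) (v 3) = 0 \<and> g (v 2) (v 3) = 0"

definition triple :: "'a::zero \<Rightarrow> 'a \<Rightarrow> 'a \<Rightarrow> 3 \<Rightarrow> 'a" where
  "triple x y z = ($) (vector [x, y, z])"

lemma triple_simps [simp]: "triple x y z 1 = x" "triple x y z 2 = y" "triple x y z 3 = z"
  by (simp_all add: triple_def)

lemma metric_frame_lorentz:
  fixes g :: "'a::euclidean_space \<Rightarrow> 'a \<Rightarrow> real"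
  assumes "DIM('a) = 3" "pseudo_metric g" "lorentz_frame g s v"
  shows "metric_frame g v (\<lambda>a. g (v a) (v a))"
proof (rule metric_frameI[OF assms(1,2)])
  show "g (v a) (v a) * g (v a) (v a) = 1" for a
    using assms(3) exhaust_3[of a] by (auto simp: lorentz_frame_def)
qed (use assms(3) in \<open>auto simp: lorentz_frame_def\<close>)

lemma (in metric_frame) linindep3_frame: "linindep3 (v 1) (v 2) (v 3)"
  unfolding linindep3_def
proof (intro allI impI)
  fix a b c assume *: "a *\<^sub>R v 1 + b *\<^sub>R v 2 + c *\<^sub>R v 3 = 0"
  have "g (a *\<^sub>R v 1 + b *\<^sub>R v 2 + c *\<^sub>R v 3) (v k) = 0" for k
    unfolding * by (simp add: bilinear_simps[OF g_bilinear])
  from this[of 1] this[of 2] this[of 3] show "a = 0 \<and> b = 0 \<and> c = 0"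
    by (simp add: bilinear_simps[OF g_bilinear] orthonormal distinct_3 sign_nonzero)
qed

lemma diagonalizableI3:
  fixes x y z :: "'a::euclidean_space"
  assumes "DIM('a) = 3" "linindep3 x y z" "L x = a *\<^sub>R x" "L y = b *\<^sub>R y" "L z = c *\<^sub>R z"
  shows "diagonalizable L"
  unfolding diagonalizable_def
proof (intro exI[of _ "{x, y, z}"] conjI)
  show "span {x, y, z} = UNIV"
    using linindep3_expand[OF assms(1,2)] span_3[of _ x y z] by (metis UNIV_eq_I)
qed (use assms linindep3_independent in auto)

lemma diagonalizable_plane:
  fixes u p q :: "'a::euclidean_space"
  assumes dim: "DIM('a) = 3" and indep: "linindep3 u p q" and L: "linear L"
    and e: "L u = l *\<^sub>R u" "L p = a *\<^sub>R p + b *\<^sub>R q" "L q = c *\<^sub>R p + d *\<^sub>R q"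
    and b: "b \<noteq> 0" and disc: "(a - d) ^ 2 + 4 * b * c > 0"
  shows "diagonalizable L"
proof -
  define r where "r = sqrt ((a - d) ^ 2 + 4 * b * c)"
  have r: "r ^ 2 = (a - d) ^ 2 + 4 * b * c" "r > 0" using disc by (simp_all add: r_def)
  have eig: "L ((a - (a + d - t) / 2) *\<^sub>R p + b *\<^sub>R q) =
      ((a + d + t) / 2) *\<^sub>R ((a - (a + d - t) / 2) *\<^sub>R p + b *\<^sub>R q)" if "t ^ 2 = r ^ 2" for t
  proof -
    have 1: "(a - (a + d - t) / 2) * a + b * c = (a + d + t) / 2 * (a - (a + d - t) / 2)"
      using that r(1) by (simp add: power2_eq_square field_simps)
    have 2: "(a - (a + d - t) / 2) * b + b * d = (a + d + t) / 2 * b"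
      by (simp add: field_simps)
    have "L ((a - (a + d - t) / 2) *\<^sub>R p + b *\<^sub>R q) =
        ((a - (a + d - t) / 2) * a + b * c) *\<^sub>R p + ((a - (a + d - t) / 2) * b + b * d) *\<^sub>R q"
      by (simp only: linear_add[OF L] linear_scale[OF L] e scaleR_add_right scaleR_add_left scaleR_scaleR add_ac)
    then show ?thesis unfolding 1 2 by (simp add: scaleR_add_right)
  qed
  let ?P = "(a - (a + d - r) / 2) *\<^sub>R p + b *\<^sub>R q" and ?Q = "(a - (a + d - (- r)) / 2) *\<^sub>R p + b *\<^sub>R q"
  have "linindep3 u ?P ?Q"
    unfolding linindep3_def
  proof (intro allI impI)
    fix x y z assume "x *\<^sub>R u + y *\<^sub>R ?P + z *\<^sub>R ?Q = 0"
    moreover have "x *\<^sub>R u + y *\<^sub>R ?P + z *\<^sub>R ?Q =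
        x *\<^sub>R u + (y * (a - (a + d - r) / 2) + z * (a - (a + d - (- r)) / 2)) *\<^sub>R p + ((y + z) * b) *\<^sub>R q"
      by (simp only: scaleR_add_right scaleR_add_left scaleR_scaleR distrib_right add_ac)
    ultimately have *: "x = 0" "y * (a - (a + d - r) / 2) + z * (a - (a + d - (- r)) / 2) = 0" "(y + z) * b = 0"
      using indep unfolding linindep3_def by metis+
    then have "z = - y" using b by auto
    then have "y * r = 0" using *(2) by (simp add: field_simps)
    then show "x = 0 \<and> y = 0 \<and> z = 0" using r(2) \<open>z = - y\<close> *(1) by simp
  qed
  then show ?thesis
    by (rule diagonalizableI3[OF dim _ e(1) eig[of r] eig[of "- r"]]) simp_all
qed

locale symmetric_endo =
  fixes g :: "'a::euclidean_space \<Rightarrow> 'a \<Rightarrow> real" and L :: "'a \<Rightarrow> 'a"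
  assumes dim: "DIM('a) = 3" and metric: "pseudo_metric g" and L: "linear L" and sym: "g (L x) y = g x (L y)"
begin

lemmas gb = pseudo_metricD(1)[OF metric] and gc = pseudo_metricD(2)[OF metric]
lemmas bs = bilinear_simps[OF gb]
lemmas Ls = linear_add[OF L] linear_scale[OF L] linear_neg[OF L] linear_diff[OF L]

definition block_form :: "(3 \<Rightarrow> 'a) \<Rightarrow> real \<Rightarrow> real \<Rightarrow> real \<Rightarrow> real \<Rightarrow> bool" where
  "block_form v l a b d \<longleftrightarrow> L (v 1) = l *\<^sub>R v 1 \<and> L (v 2) = a *\<^sub>R v 2 - b *\<^sub>R v 3 \<and> L (v 3) = b *\<^sub>R v 2 + d *\<^sub>R v 3"

definition null_form :: "(3 \<Rightarrow> 'a) \<Rightarrow> real \<Rightarrow> real \<Rightarrow> bool" where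
  "null_form v l n \<longleftrightarrow> L (v 1) = l *\<^sub>R v 1 + n *\<^sub>R v 2 \<and> L (v 2) = n *\<^sub>R v 1 + l *\<^sub>R v 2 - n *\<^sub>R v 3 \<and>
     L (v 3) = n *\<^sub>R v 2 + l *\<^sub>R v 3"

lemma block_form_exists:
  assumes nd: "\<not> diagonalizable L" and x: "L x = l *\<^sub>R x" "g x x \<noteq> 0"
  shows "\<exists>s v a b d. lorentz_frame g s v \<and> block_form v l a b d \<and> b \<noteq> 0 \<and> (a - d) ^ 2 \<le> 4 * b ^ 2"
proof -
  define u where "u = (1 / sqrt \<bar>g x x\<bar>) *\<^sub>R x"
  have "orthonormal_set g {}" by (simp add: orthonormal_set_def)
  then have "orthonormal_set g {u}"
    using orthonormal_set_insert(1)[OF gb gc, of "{}" x] x(2) by (simp add: u_def)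
  then obtain T where T: "{u} \<subseteq> T" "orthonormal_set g T" "finite T" "card T = 3"
    using orthonormal_basis_extend[OF metric, of "{u}"] dim by auto
  then have "card (T - {u}) = 2" by simp
  then obtain p q where pq: "T - {u} = {p, q}" "p \<noteq> q" by (metis card_2_iff)
  then have m: "u \<in> T" "p \<in> T" "q \<in> T" "u \<noteq> p" "u \<noteq> q" using T(1) by auto
  have Lu: "L u = l *\<^sub>R u" by (simp add: u_def Ls x)
  have main: "g q q = - g p p \<and> (g p p = g u u \<longrightarrow>
      (\<exists>v a b d. lorentz_frame g (g u u) v \<and> block_form v l a b d \<and> b \<noteq> 0 \<and> (a - d) ^ 2 \<le> 4 * b ^ 2))"
    if s: "p \<in> T" "q \<in> T" "u \<noteq> p" "u \<noteq> q" "p \<noteq> q" for p q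
  proof -
    note o = T(2)[unfolded orthonormal_set_def]
    define s t r where "s = g u u" and "t = g p p" and "r = g q q"
    have gg: "g u p = 0" "g p u = 0" "g u q = 0" "g q u = 0" "g p q = 0" "g q p = 0"
      and sq: "s * s = 1" "t * t = 1" "r * r = 1"
      using o m s by (auto simp: s_def t_def r_def)
    have fr: "metric_frame g (triple u p q) (\<lambda>a. g (triple u p q a) (triple u p q a))"
    proof (rule metric_frameI[OF dim metric])
      show "g (triple u p q a) (triple u p q a) * g (triple u p q a) (triple u p q a) = 1" for a
        using sq exhaust_3[of a] by (auto simp: s_def t_def r_def)
    qed (simp_all add: gg)
    interpret metric_frame g "triple u p q" "\<lambda>a. g (triple u p q a) (triple u p q a)" by (rule fr)
    have ex: "w = (s * g w u) *\<^sub>R u + (t * g w p) *\<^sub>R p + (r * g w q) *\<^sub>R q" for w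
      using frame_expand[of w] by (simp add: sum_3 s_def r_def t_def)
    have gu: "g (L p) u = 0" "g (L q) u = 0" by (simp_all add: sym Lu bs gg)
    define a b d where "a = t * g (L p) p" and "b = r * g (L p) q" and "d = r * g (L q) q"
    have Lp: "L p = a *\<^sub>R p + b *\<^sub>R q" using ex[of "L p"] by (simp add: gu a_def b_def)
    have Lq: "L q = (t * r * b) *\<^sub>R p + d *\<^sub>R q"
    proof -
      have "t * r * b = (r * r) * t * g (L p) q" by (simp add: b_def)
      also have "\<dots> = t * g (L q) p" using sq(3) sym[of p q] gc[of p "L q"] by simp
      finally have "t * r * b = t * g (L q) p" .
      then show ?thesis using ex[of "L q"] by (simp only: gu d_def mult_zero_right scaleR_zero_left add_0_left)
    qed
    have indep: "linindep3 u p q" using linindep3_frame by simp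
    have b: "b \<noteq> 0"
    proof
      assume "b = 0"
      then have "L p = a *\<^sub>R p" "L q = d *\<^sub>R q" using Lp Lq by simp_all
      then show False using diagonalizableI3[OF dim indep, of L] Lu nd by blast
    qed
    then have disc: "(a - d) ^ 2 + 4 * b * (t * r * b) \<le> 0"
      using diagonalizable_plane[OF dim indep L Lu Lp Lq] nd by linarith
    have tr: "r = t \<or> r = - t" using sq by (simp add: square_eq_iff[symmetric])
    moreover have "r \<noteq> t"
    proof
      assume "r = t"
      then have "(a - d) ^ 2 + 4 * b ^ 2 \<le> 0"
        using disc sq(2) by (simp add: power2_eq_square)
      then show False using b zero_le_power2[of "a - d"] zero_less_power2[of b] by linarith
    qed
    ultimately have r: "r = - t" by simp
    then have trm: "t * r = - 1" using sq(2) by simp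
    have "\<exists>v a b d. lorentz_frame g s v \<and> block_form v l a b d \<and> b \<noteq> 0 \<and> (a - d) ^ 2 \<le> 4 * b ^ 2" if "t = s"
    proof (intro exI conjI)
      show "lorentz_frame g s (triple u p q)"
        using gg sq(1) that r by (simp add: lorentz_frame_def s_def[symmetric] t_def[symmetric] r_def[symmetric])
      show "block_form (triple u p q) l a (- b) d"
        using Lu Lp Lq trm by (simp add: block_form_def)
      show "(a - d) ^ 2 \<le> 4 * (- b) ^ 2" using disc by (simp add: trm power2_eq_square)
      show "- b \<noteq> 0" using b by simp
    qed
    then show ?thesis using r by (simp add: s_def t_def r_def)
  qed
  have "g p p = g u u \<or> g q q = g u u"
  proof -
    have "g p p * g p p = g u u * g u u" using T(2) m unfolding orthonormal_set_def by auto
    then have "g p p = g u u \<or> g p p = - g u u" by (simp only: square_eq_iff)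
    then show ?thesis using main[OF m(2-5) pq(2), THEN conjunct1] by (metis minus_minus)
  qed
  then show ?thesis using main[OF m(2-5) pq(2)] main[OF m(3,2,5,4) pq(2)[symmetric]] by blast
qed

text \<open>
  Complete the null eigenvector \<open>n\<close> to a basis \<open>n, m, e\<close> with \<open>m\<close> null, \<open>g n m = 1\<close> and \<open>e\<close> a unit vector
  orthogonal to both. The plane orthogonal to \<open>n\<close> is invariant, and \<open>L\<close> has the eigenvalue of \<open>n\<close> on its
  quotient by \<open>n\<close> as well, for otherwise the plane would contain an eigenvector that is not null.
  A null rotation fixing \<open>n\<close> then removes the \<open>n\<close>-component of \<open>L m\<close>.
\<close>

lemma null_form_exists:
  assumes null: "\<And>c x. L x = c *\<^sub>R x \<Longrightarrow> g x x \<noteq> 0 \<Longrightarrow> False"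
  shows "\<exists>s v l n. lorentz_frame g s v \<and> null_form v l n \<and> n \<noteq> 0"
proof -
  obtain v0 where "metric_frame g v0 (\<lambda>a. g (v0 a) (v0 a))"
    using orthonormal_eigenframe[OF dim metric linear_ident _ diagonalizable_id] by auto
  then obtain l n where n: "n \<noteq> 0" "L n = l *\<^sub>R n"
    using metric_frame.exists_eigenvector[OF _ L] by metis
  have nn: "g n n = 0" using null n(2) by blast
  obtain y where y: "g n y = 1"
  proof -
    obtain y where y: "g n y \<noteq> 0" using pseudo_metricD(3)[OF metric, of n] n(1) by blast
    then have "g n ((1 / g n y) *\<^sub>R y) = 1" by (simp add: bs)
    then show ?thesis using that by blast
  qed
  define m where "m = y - (g y y / 2) *\<^sub>R n"
  have m: "g m m = 0" "g n m = 1" "g m n = 1"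
    using y nn gc[of y n] by (simp_all add: m_def bs)
  define k where "k = 1 / sqrt 2"
  have k: "k * k = 1 / 2" by (simp add: k_def)
  define u w where "u = k *\<^sub>R (n + m)" and "w = k *\<^sub>R (n - m)"
  have uw: "g u u = 1" "g w w = - 1" "g u w = 0" "g w u = 0"
    using k by (simp_all add: u_def w_def bs nn m algebra_simps)
  then have "orthonormal_set g {u, w}" by (simp add: orthonormal_set_def)
  then obtain T where T: "{u, w} \<subseteq> T" "orthonormal_set g T" "finite T" "card T = 3"
    using orthonormal_basis_extend[OF metric, of "{u, w}"] dim by auto
  have "u \<noteq> w" using uw by auto
  then have "card (T - {u, w}) = 1" using T by (simp add: card_Diff_subset)
  then obtain e where "T - {u, w} = {e}" by (metis card_1_singletonE)
  then have eT: "e \<in> T" "e \<noteq> u" "e \<noteq> w" by auto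
  define s where "s = g e e"
  have es: "g e u = 0" "g e w = 0" "g u e = 0" "g w e = 0" "s * s = 1"
    using T(1,2) eT unfolding orthonormal_set_def s_def by auto
  have fr: "metric_frame g (triple u w e) (\<lambda>a. g (triple u w e a) (triple u w e a))"
  proof (rule metric_frameI[OF dim metric])
    show "g (triple u w e a) (triple u w e a) * g (triple u w e a) (triple u w e a) = 1" for a
      using es uw exhaust_3[of a] by (auto simp: s_def)
  qed (simp_all add: es uw)
  interpret metric_frame g "triple u w e" "\<lambda>a. g (triple u w e a) (triple u w e a)" by (rule fr)
  have kk: "(k * k) *\<^sub>R (x + x) = x" for x :: 'a by (simp add: k flip: scaleR_2)
  have nm: "n = k *\<^sub>R (u + w)" "m = k *\<^sub>R (u - w)"
    by (simp_all add: u_def w_def kk flip: scaleR_add_right scaleR_diff_right)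
  have ge: "g e n = 0" "g e m = 0" "g n e = 0" "g m e = 0"
    by (simp_all add: nm bs es)
  have ex: "x = g x m *\<^sub>R n + g x n *\<^sub>R m + (s * g x e) *\<^sub>R e" for x
  proof -
    have "x = g x u *\<^sub>R u - g x w *\<^sub>R w + (s * g x e) *\<^sub>R e"
      using frame_expand[of x] by (simp add: sum_3 s_def uw)
    also have "g x u *\<^sub>R u - g x w *\<^sub>R w = (k * k) *\<^sub>R ((g x n + g x m) *\<^sub>R (n + m) - (g x n - g x m) *\<^sub>R (n - m))"
      by (simp add: u_def w_def bs algebra_simps)
    also have "\<dots> = (k * k * 2) *\<^sub>R (g x m *\<^sub>R n + g x n *\<^sub>R m)"
      by (simp add: algebra_simps flip: scaleR_2 mult_2 mult_2_right)
    finally show ?thesis by (simp add: k)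
  qed
  have se: "s \<noteq> 0" using es(5) by auto
  define \<mu> \<beta> \<gamma> where "\<mu> = s * g (L e) e" and "\<beta> = g (L e) m" and "\<gamma> = g (L m) m"
  have "g (L e) n = 0" using sym[of e n] n(2) ge by (simp add: bs)
  then have Le: "L e = \<beta> *\<^sub>R n + \<mu> *\<^sub>R e" using ex[of "L e"] by (simp add: \<mu>_def \<beta>_def)
  have "g (L m) n = l" using sym[of m n] n(2) m by (simp add: bs)
  moreover have "g (L m) e = \<beta>" using sym[of m e] gc[of m "L e"] by (simp add: \<beta>_def)
  ultimately have Lm: "L m = \<gamma> *\<^sub>R n + l *\<^sub>R m + (s * \<beta>) *\<^sub>R e" using ex[of "L m"] by (simp add: \<gamma>_def)
  have \<mu>: "\<mu> = l"
  proof (rule ccontr)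
    assume ne: "\<mu> \<noteq> l"
    define x where "x = \<beta> / (\<mu> - l)"
    have "\<beta> + x * l = \<mu> * x" using ne by (simp add: x_def field_simps)
    then have "L (e + x *\<^sub>R n) = \<mu> *\<^sub>R (e + x *\<^sub>R n)"
      by (simp add: Ls Le n scaleR_add_right flip: scaleR_add_left add.assoc)
    moreover have "g (e + x *\<^sub>R n) (e + x *\<^sub>R n) = s" by (simp add: bs ge nn s_def)
    ultimately show False using null se by blast
  qed
  have \<beta>: "\<beta> \<noteq> 0"
  proof
    assume "\<beta> = 0"
    then have "L e = \<mu> *\<^sub>R e" by (simp add: Le)
    then show False using null se s_def by blast
  qed
  define t where "t = \<gamma> / (2 * s * \<beta>)"
  define e' m' where "e' = e + t *\<^sub>R n" and "m' = m - (s * t) *\<^sub>R e - (s * t ^ 2 / 2) *\<^sub>R n"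
  have sx: "s * (s * x) = x" for x using es(5) by (metis mult.assoc mult_1)
  have g': "g e' e' = s" "g e' n = 0" "g n e' = 0" "g e' m' = 0" "g m' e' = 0" "g m' m' = 0" "g n m' = 1" "g m' n = 1"
    using es(5) by (simp_all add: e'_def m'_def bs ge nn m s_def[symmetric] sx power2_eq_square algebra_simps)
  have Le': "L e' = \<beta> *\<^sub>R n + l *\<^sub>R e'"
    by (simp add: e'_def Ls Le n \<mu> algebra_simps)
  have "\<gamma> = s * t * \<beta> + s * t * \<beta>" using se \<beta> by (simp add: t_def)
  then have "\<gamma> *\<^sub>R n = (\<beta> * (s * t)) *\<^sub>R n + (\<beta> * (s * t)) *\<^sub>R n"
    by (simp add: mult_ac flip: scaleR_add_left)
  then have Lm': "L m' = l *\<^sub>R m' + (s * \<beta>) *\<^sub>R e'"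
    by (simp add: m'_def e'_def Ls Le Lm n \<mu> algebra_simps)
  define v where "v = triple (s *\<^sub>R m' + (1/2) *\<^sub>R n) e' (s *\<^sub>R m' - (1/2) *\<^sub>R n)"
  have "lorentz_frame g s v"
    by (simp add: lorentz_frame_def v_def bs g' nn es(5))
  moreover have "null_form v l \<beta>"
    by (simp add: null_form_def v_def Ls Le' Lm' n sx es(5) algebra_simps flip: scaleR_add_left)
  ultimately show ?thesis using \<beta> by blast
qed

lemma represented_by_L3: "represented_by L v (L3 \<alpha>) \<longleftrightarrow> block_form v 0 (\<alpha> + 1/2) (1/2) (\<alpha> - 1/2)"
  and represented_by_L4: "represented_by L v (L4 \<alpha>) \<longleftrightarrow> block_form v 0 (\<alpha> - 1/2) (- 1/2) (\<alpha> + 1/2)"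
  and represented_by_L5: "represented_by L v L5 \<longleftrightarrow> null_form v 0 (1 / sqrt 2)"
  by (simp_all add: represented_by_def L3_def L4_def L5_def block_form_def null_form_def sum_3 forall_3
      add.commute)

lemma double_eqD: "(u::'a) + u = w + w \<Longrightarrow> u = w"
  by (simp flip: scaleR_2)

lemma boost:
  assumes xy: "g x x = s" "g y y = - s" "g x y = 0" and \<kappa>: "\<kappa> \<noteq> 0"
  obtains x' y' where "g x' x' = s" "g y' y' = - s" "g x' y' = 0" "x' - y' = \<kappa> *\<^sub>R (x - y)"
    "x' + y' = (1 / \<kappa>) *\<^sub>R (x + y)" "\<And>z. g z x = 0 \<Longrightarrow> g z y = 0 \<Longrightarrow> g z x' = 0 \<and> g z y' = 0"
proof -
  define n p where "n = (\<kappa> / 2) *\<^sub>R (x - y)" and "p = (1 / (2 * \<kappa>)) *\<^sub>R (x + y)"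
  have np: "g n n = 0" "g p p = 0" "g n p = s / 2" "g p n = s / 2"
    using xy gc[of y x] \<kappa> by (simp_all add: n_def p_def bs)
  show ?thesis
  proof (rule that[of "p + n" "p - n"])
    show "p + n - (p - n) = \<kappa> *\<^sub>R (x - y)" by (simp add: n_def flip: scaleR_2)
    show "p + n + (p - n) = (1 / \<kappa>) *\<^sub>R (x + y)" by (simp add: p_def flip: scaleR_2)
  qed (simp_all add: np bs, simp_all add: n_def p_def bs)
qed

lemma block_form_normalize:
  assumes v: "lorentz_frame g s v" and Lv: "block_form v 0 a b d" and b: "b \<noteq> 0" "(a - d) ^ 2 = 4 * b ^ 2"
  shows "\<exists>v' \<alpha>. lorentz_frame g s v' \<and> (represented_by L v' (L3 \<alpha>) \<or> represented_by L v' (L4 \<alpha>))"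
proof -
  have "\<exists>v b. lorentz_frame g s v \<and> block_form v 0 a b d \<and> b \<noteq> 0 \<and> a - d = 2 * b"
  proof (cases "a - d = 2 * b")
    case True
    then show ?thesis using v Lv b by blast
  next
    case False
    have "(a - d) ^ 2 = (2 * b) ^ 2" using b(2) by (simp add: power_mult_distrib)
    then have "a - d = 2 * b \<or> a - d = - (2 * b)" by (rule power2_eq_iff[THEN iffD1])
    with False have "a - d = 2 * (- b)" by simp
    moreover have "lorentz_frame g s (triple (v 1) (v 2) (- v 3))"
      using v by (simp add: lorentz_frame_def bs)
    moreover have "block_form (triple (v 1) (v 2) (- v 3)) 0 a (- b) d"
      using Lv by (simp add: block_form_def Ls)
    ultimately show ?thesis using b(1) by (metis neg_equal_0_iff_equal)
  qed
  then obtain v b where v: "lorentz_frame g s v" and Lv: "block_form v 0 a b d" and b: "b \<noteq> 0" "a - d = 2 * b"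
    by blast
  define \<kappa> \<alpha> \<beta> where "\<kappa> = sqrt (2 * \<bar>b\<bar>)" and "\<alpha> = a - b" and "\<beta> = (if b > 0 then 1/2 else - 1/2 :: real)"
  have \<kappa>: "\<kappa> \<noteq> 0" "\<kappa> * \<kappa> = 2 * \<bar>b\<bar>" using b by (simp_all add: \<kappa>_def)
  obtain x y where xy: "g x x = s" "g y y = - s" "g x y = 0" "x - y = \<kappa> *\<^sub>R (v 2 - v 3)"
    "x + y = (1 / \<kappa>) *\<^sub>R (v 2 + v 3)" "\<And>z. g z (v 2) = 0 \<Longrightarrow> g z (v 3) = 0 \<Longrightarrow> g z x = 0 \<and> g z y = 0"
    using boost[of "v 2" s "v 3" \<kappa>] v \<kappa>(1) unfolding lorentz_frame_def by metis
  have "a = \<alpha> + b" "d = \<alpha> - b" using b(2) by (simp_all add: \<alpha>_def)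
  then have Lv23: "L (v 2) = (\<alpha> + b) *\<^sub>R v 2 - b *\<^sub>R v 3" "L (v 3) = b *\<^sub>R v 2 + (\<alpha> - b) *\<^sub>R v 3"
    using Lv by (simp_all add: block_form_def)
  have lf: "lorentz_frame g s (triple (v 1) x y)"
    using v xy by (simp add: lorentz_frame_def)
  have minus: "L (x - y) = \<alpha> *\<^sub>R (x - y)"
  proof -
    have "L (v 2 - v 3) = \<alpha> *\<^sub>R (v 2 - v 3)"
      by (simp only: Ls Lv23 algebra_simps scaleR_add_left scaleR_add_right scaleR_diff_left scaleR_diff_right)
    then show ?thesis by (simp add: xy(4) Ls(2) scaleR_left_commute)
  qed
  have plus: "L (x + y) = \<alpha> *\<^sub>R (x + y) + (\<beta> + \<beta>) *\<^sub>R (x - y)"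
  proof -
    have "L (v 2 + v 3) = \<alpha> *\<^sub>R (v 2 + v 3) + (b + b) *\<^sub>R (v 2 - v 3)"
      by (simp only: Ls Lv23 algebra_simps scaleR_add_left scaleR_add_right scaleR_diff_left scaleR_diff_right)
    moreover have "(1 / \<kappa>) * (b + b) = (\<beta> + \<beta>) * \<kappa>"
      using \<kappa> by (simp add: \<beta>_def field_simps)
    ultimately show ?thesis
      unfolding xy(4,5) Ls(2)
      by (simp only: scaleR_add_right scaleR_scaleR mult.commute[of "1 / \<kappa>" \<alpha>])
  qed
  have "block_form (triple (v 1) x y) 0 (\<alpha> + \<beta>) \<beta> (\<alpha> - \<beta>)"
  proof -
    have 2: "L x + L x = L (x + y) + L (x - y)" "L y + L y = L (x + y) - L (x - y)"
      by (simp_all add: Ls)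
    have "L x = (\<alpha> + \<beta>) *\<^sub>R x - \<beta> *\<^sub>R y" "L y = \<beta> *\<^sub>R x + (\<alpha> - \<beta>) *\<^sub>R y"
      by (rule double_eqD; simp only: 2 plus minus algebra_simps scaleR_add_left scaleR_add_right scaleR_diff_left scaleR_diff_right)+
    then show ?thesis using Lv by (simp add: block_form_def)
  qed
  then show ?thesis
    using lf represented_by_L3[of "triple (v 1) x y" \<alpha>] represented_by_L4[of "triple (v 1) x y" \<alpha>]
    unfolding \<beta>_def by (cases "b > 0") auto
qed

lemma null_form_normalize:
  assumes v: "lorentz_frame g s v" and Lv: "null_form v 0 n" and n: "n \<noteq> 0"
  shows "\<exists>v'. lorentz_frame g s v' \<and> represented_by L v' L5"
proof -
  define \<kappa> where "\<kappa> = sqrt 2 * n"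
  have \<kappa>: "\<kappa> \<noteq> 0" "n / \<kappa> = 1 / sqrt 2" using n by (simp_all add: \<kappa>_def)
  obtain x y where xy: "g x x = s" "g y y = - s" "g x y = 0" "x - y = \<kappa> *\<^sub>R (v 1 - v 3)"
    "x + y = (1 / \<kappa>) *\<^sub>R (v 1 + v 3)" "\<And>z. g z (v 1) = 0 \<Longrightarrow> g z (v 3) = 0 \<Longrightarrow> g z x = 0 \<and> g z y = 0"
    using boost[of "v 1" s "v 3" \<kappa>] v \<kappa>(1) unfolding lorentz_frame_def by metis
  have o: "g (v 2) x = 0" "g (v 2) y = 0" "g x (v 2) = 0"
    using xy(6)[of "v 2"] v gc[of "v 2" "v 1"] gc[of x "v 2"] unfolding lorentz_frame_def by simp_all
  have "lorentz_frame g s (triple x (v 2) y)"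
    using v xy o by (simp add: lorentz_frame_def)
  moreover have "null_form (triple x (v 2) y) 0 (1 / sqrt 2)"
  proof -
    define \<nu> where "\<nu> = 1 / sqrt 2"
    have Lv': "L (v 1) = n *\<^sub>R v 2" "L (v 3) = n *\<^sub>R v 2" "L (v 2) = n *\<^sub>R (v 1 - v 3)"
      using Lv by (simp_all add: null_form_def algebra_simps)
    have "L (x - y) = 0" "L (x + y) = (n / \<kappa>) *\<^sub>R v 2 + (n / \<kappa>) *\<^sub>R v 2"
      unfolding xy(4,5) by (simp_all add: Ls Lv' scaleR_add_right)
    then have "L (x - y) = 0" "L (x + y) = \<nu> *\<^sub>R v 2 + \<nu> *\<^sub>R v 2"
      unfolding \<kappa>(2) \<nu>_def by simp_all
    then have "L x = \<nu> *\<^sub>R v 2" "L y = \<nu> *\<^sub>R v 2"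
      by (auto simp: Ls intro!: double_eqD)
    moreover have "L (v 2) = (n / \<kappa>) *\<^sub>R (x - y)"
      using \<kappa>(1) by (simp add: Lv' xy(4))
    ultimately show ?thesis
      unfolding \<kappa>(2) by (simp add: null_form_def scaleR_diff_right \<nu>_def)
  qed
  ultimately show ?thesis using represented_by_L5 by blast
qed

end


section \<open>Einstein structures with diagonalizable structure endomorphism exist\<close>

lemma cyclic_cases:
  assumes "cyclic \<sigma>"
  obtains "\<sigma> 1 = 1" "\<sigma> 2 = 2" "\<sigma> 3 = 3" | "\<sigma> 1 = 2" "\<sigma> 2 = 3" "\<sigma> 3 = 1" | "\<sigma> 1 = 3" "\<sigma> 2 = 1" "\<sigma> 3 = 2"
  using assms unfolding cyclic_def by auto

lemma levi_cyclic: "cyclic \<sigma> \<Longrightarrow> levi (\<sigma> 1) (\<sigma> 2) c = (if c = \<sigma> 3 then 1 else 0)"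
  using exhaust_3[of c] by (elim cyclic_cases disjE) (simp_all add: levi_simps distinct_3)

lemma (in oriented_frame) cross_product_cyclic:
  "cyclic \<sigma> \<Longrightarrow> cross_product g \<omega> (v (\<sigma> 1)) (v (\<sigma> 2)) = \<epsilon> (\<sigma> 3) *\<^sub>R v (\<sigma> 3)"
  by (simp add: cross_product_frame levi_cyclic if_distrib[of "\<lambda>x. x * _"] if_distrib[of "\<lambda>x. x *\<^sub>R _"]
      cong: if_cong)

lemma diag_equations_of_values:
  assumes "values1 \<alpha> h \<or> values2 \<alpha> h \<or> (\<exists>\<sigma>. values3 \<sigma> \<alpha> h)" "a \<noteq> b" "b \<noteq> c" "a \<noteq> c"
  shows "\<alpha> a ^ 2 - (\<alpha> b - \<alpha> c) ^ 2 - h ^ 2 = 0"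
  using assms(1)
proof (elim disjE exE)
  assume "values1 \<alpha> h"
  then have "\<alpha> k = 0" "h = 0" for k using exhaust_3[of k] by (auto simp: values1_def)
  then show ?thesis by simp
next
  assume v: "values2 \<alpha> h"
  then have "\<alpha> k = \<alpha> 1" for k using exhaust_3[of k] by (auto simp: values2_def)
  then have "\<alpha> a = \<alpha> 1" "\<alpha> b = \<alpha> 1" "\<alpha> c = \<alpha> 1" by blast+
  moreover have "\<alpha> 1 ^ 2 = h ^ 2" using v unfolding values2_def by (metis power2_minus)
  ultimately show ?thesis by simp
next
  fix \<sigma> assume v: "values3 \<sigma> \<alpha> h"
  then have "cyclic \<sigma>" by (simp add: values3_def)
  then show ?thesis
    using v assms(2-4) exhaust_3[of a] exhaust_3[of b] exhaust_3[of c]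
    by (elim cyclic_cases disjE) (simp_all add: values3_def)
qed

lemma diagonal_einstein_exists:
  fixes \<epsilon> \<alpha> :: "3 \<Rightarrow> real"
  assumes dim: "DIM('a::euclidean_space) = 3"
    and \<epsilon>: "\<And>a. \<epsilon> a = 1 \<or> \<epsilon> a = -1" "\<epsilon> 1 = \<epsilon> 2"
    and eqs: "\<And>a b c. a \<noteq> b \<Longrightarrow> b \<noteq> c \<Longrightarrow> a \<noteq> c \<Longrightarrow> \<alpha> a ^ 2 - (\<alpha> b - \<alpha> c) ^ 2 - h ^ 2 = 0"
  shows "\<exists>(br :: 'a \<Rightarrow> 'a \<Rightarrow> 'a) g \<omega> H \<delta> v.
    lie_algebra br \<and> unimodular br \<and> orientation \<omega> \<and> pseudo_metric g \<and>
    gen_einstein br g H \<delta> \<and> diagonalizable (structure_endo br g \<omega>) \<and>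
    adapted_basis br g \<omega> H v \<alpha> h \<and> (\<forall>a. g (v a) (v a) = \<epsilon> a)"
proof -
  obtain v where v: "bij_betw v (UNIV :: 3 set) (Basis :: 'a set)"
    using finite_same_card_bij[of "UNIV :: 3 set" "Basis :: 'a set"] dim by auto
  have on: "v a \<bullet> v b = (if a = b then 1 else 0)" for a b
    using v bij_betwE[OF v] by (auto simp: inner_Basis bij_betw_def inj_eq)
  define g where "g x y = (\<Sum>a\<in>UNIV. \<epsilon> a * (x \<bullet> v a) * (y \<bullet> v a))" for x y
  have gv: "g x (v b) = \<epsilon> b * (x \<bullet> v b)" for x b
    by (simp add: g_def on if_distrib cong: if_cong)
  have sign: "\<epsilon> a * \<epsilon> a = 1" for a using \<epsilon>(1)[of a] by auto
  have mf: "metric_frame g v \<epsilon>"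
  proof
    show "bilinear g"
      unfolding bilinear_def g_def
      by (auto intro!: linearI simp: inner_simps algebra_simps sum.distrib sum_distrib_left)
    show "g x y = g y x" for x y by (simp add: g_def mult_ac)
    show "g (v a) (v b) = (if a = b then \<epsilon> a else 0)" for a b by (simp add: gv on)
  qed (use dim sign in auto)
  interpret oriented_frame g v \<epsilon> "metric_frame.frame_volume g v \<epsilon>"
    by (intro oriented_frame.intro oriented_frame_axioms.intro mf metric_frame.three_form_frame_volume[OF mf])
      (simp add: metric_frame.frame_volume_frame[OF mf] levi_simps)
  let ?\<omega> = frame_volume
  note V = three_form_frame_volume
  define L where "L x = (\<Sum>a\<in>UNIV. (\<alpha> a * (x \<bullet> v a)) *\<^sub>R v a)" for x
  have L: "linear L"
    unfolding L_def by (rule linearI) (simp_all add: inner_simps algebra_simps sum.distrib scaleR_sum_right)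
  have Lv: "L (v a) = \<alpha> a *\<^sub>R v a" for a
    by (simp add: L_def on if_distrib[of "\<lambda>x. _ * x"] if_distrib[of "\<lambda>x. x *\<^sub>R _"] cong: if_cong)
  have sym: "g (L x) y = g x (L y)" for x y
  proof (rule bilinear_eq_frame[where f = "\<lambda>x y. g (L x) y" and f' = "\<lambda>x y. g x (L y)"])
    show "bilinear (\<lambda>x y. g (L x) y)" "bilinear (\<lambda>x y. g x (L y))"
      using g_bilinear L unfolding bilinear_def by (auto intro: linear_compose[unfolded o_def])
    show "g (L (v a)) (v b) = g (v a) (L (v b))" for a b
      by (simp add: Lv bilinear_simps[OF g_bilinear] orthonormal)
  qed
  define br where "br x y = L (cross_product g ?\<omega> x y)" for x y
  have br: "bilinear br"
    unfolding br_def using bilinear_cross_product L unfolding bilinear_def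
    by (auto intro: linear_compose[unfolded o_def])
  have cross0: "cross_product g ?\<omega> x x = 0" for x
    by (simp add: eq_iff_g g_cross_product three_form_repeat[OF V] bilinear_simps[OF g_bilinear])
  have br0: "br x x = 0" for x by (simp add: br_def cross0 linear_0[OF L])
  note bb = bilinear_simps[OF br]
  have skew: "br x y = - br y x" for x y by (rule alternating_skew[OF br br0])
  have endo: "structure_endo br g ?\<omega> = L" using L sym by (intro structure_endo_eqI) (auto simp: br_def)
  have "lie_algebra br"
    unfolding lie_algebra_def
  proof (intro conjI allI br br0)
    fix x y z
    let ?J = "\<lambda>x y z. br x (br y z) + br y (br z x) + br z (br x y)"
    have "g (?J x y z) u = 0" for u
    proof -
      have "three_form (\<lambda>x y z. g (?J x y z) u)"
        unfolding three_form_def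
      proof (intro conjI allI)
        fix x y
        show "g (?J x x y) u = 0" using skew[of x y] by (simp add: bb br0 bilinear_simps[OF g_bilinear])
        show "g (?J x y y) u = 0" using skew[of x y] by (simp add: bb br0 bilinear_simps[OF g_bilinear])
        show "g (?J x y x) u = 0" using skew[of x y] by (simp add: bb br0 bilinear_simps[OF g_bilinear])
      qed (auto intro!: linearI simp: bb bilinear_simps[OF g_bilinear] algebra_simps)
      then have "g (?J x y z) u = g (?J (v 1) (v 2) (v 3)) u * frame_volume x y z"
        by (rule three_form_eq_frame_volume)
      moreover have "br (v 2) (v 3) = (\<epsilon> 1 * \<alpha> 1) *\<^sub>R v 1" "br (v 3) (v 1) = (\<epsilon> 2 * \<alpha> 2) *\<^sub>R v 2"
        "br (v 1) (v 2) = (\<epsilon> 3 * \<alpha> 3) *\<^sub>R v 3"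
        by (simp_all add: br_def cross_product_frame sum_3 levi_simps linear_scale[OF L] Lv)
      ultimately show ?thesis by (simp add: bb br0 bilinear_simps[OF g_bilinear])
    qed
    then show "?J x y z = 0" by (intro g_nondegenerate)
  qed
  moreover have "unimodular br"
    unfolding unimodular_def
  proof
    fix x
    have "g (br x (v d)) (v d) = 0" for d
      by (simp add: br_def sym Lv bilinear_simps[OF g_bilinear] g_cross_product three_form_repeat[OF V])
    then show "trace_on UNIV (br x) = 0" by (simp add: trace_on_UNIV_frame[OF bilinear_linear_right[OF br]])
  qed
  moreover have "orientation ?\<omega>"
    unfolding orientation_def using V frame_volume_frame[of 1 2 3]
    by (metis levi_simps(4) zero_neq_one)
  moreover note pseudo_metric
  moreover define H where "H x y z = h * ?\<omega> x y z" for x y z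
  have H: "three_form H"
    unfolding three_form_def H_def
    using three_form_repeat[OF V] three_form_add[OF V] three_form_scale[OF V]
    by (auto intro!: linearI simp: algebra_simps)
  have H1: "H (v 1) (v 2) (v 3) = h" by (simp add: H_def frame_volume_frame levi_simps)
  have "gen_einstein br g H (\<lambda>u. 0)"
  proof -
    interpret structure_frame g v \<epsilon> br H "\<lambda>k d. g (L (v k)) (v d)" h
      using structure_frame[OF br br0 L br_def H] H1 by simp
    have M: "g (L (v a)) (v b) = (if a = b then \<epsilon> a * \<alpha> a else 0)" for a b
      by (simp add: Lv bilinear_simps[OF g_bilinear] orthonormal)
    have M': "g (L (v a)) (v b) = (if a = b then - \<epsilon> a * - \<alpha> a else 0)" for a b
      by (simp add: M)
    have sign': "- \<epsilon> a * - \<epsilon> a = 1" for a by (simp add: sign)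
    have "ric_coord \<epsilon> (\<lambda>k d. g (L (v k)) (v d)) h (\<lambda>a. 0) a b = 0 \<and>
      ric_coord (\<lambda>a. - \<epsilon> a) (\<lambda>k d. g (L (v k)) (v d)) h (\<lambda>a. 0) a b = 0" for a b
    proof (cases "a = b")
      case True
      obtain p q where pq: "a \<noteq> p" "p \<noteq> q" "a \<noteq> q" using exhaust_3[of a] distinct_3 by metis
      show ?thesis
        using ric_coord_diag(2)[of \<epsilon>, OF sign M pq, of h "\<lambda>a. 0"]
          ric_coord_diag(2)[of "\<lambda>a. - \<epsilon> a", OF sign' M' pq, of h "\<lambda>a. 0"] eqs[OF pq] True
        by (simp add: power2_commute[of "\<alpha> q"])
    next
      case False
      obtain c where c: "b \<noteq> c" "a \<noteq> c" using exhaust_3[of a] exhaust_3[of b] False distinct_3 by metis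
      show ?thesis
        using ric_coord_diag(1)[of \<epsilon>, OF sign M False c, of h "\<lambda>a. 0"]
          ric_coord_diag(1)[of "\<lambda>a. - \<epsilon> a", OF sign' M' False c, of h "\<lambda>a. 0"]
        by simp
    qed
    then show ?thesis
      unfolding gen_einstein_iff comp_plus_def comp_minus_def by (auto simp: linear_zero)
  qed
  moreover have "diagonalizable (structure_endo br g ?\<omega>)"
    unfolding endo by (rule diagonalizableI3[OF dim linindep3_frame Lv Lv Lv])
  moreover have "adapted_basis br g ?\<omega> H v \<alpha> h"
    unfolding adapted_basis_def
  proof (intro conjI allI impI oriented_onb)
    fix \<sigma> assume "cyclic \<sigma>"
    then show "br (v (\<sigma> 1)) (v (\<sigma> 2)) = (\<alpha> (\<sigma> 3) * g (v (\<sigma> 3)) (v (\<sigma> 3))) *\<^sub>R v (\<sigma> 3)"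
      by (simp add: br_def cross_product_cyclic linear_scale[OF L] Lv orthonormal mult.commute)
  qed (auto simp: fun_eq_iff H_def volume_form_eq orthonormal \<epsilon>(2))
  moreover have "\<forall>a. g (v a) (v a) = \<epsilon> a" by (simp add: orthonormal)
  ultimately show ?thesis by blast
qed


section \<open>The non-diagonalizable case\<close>

locale einstein_lie_algebra =
  fixes br :: "'a::euclidean_space \<Rightarrow> 'a \<Rightarrow> 'a" and g :: "'a \<Rightarrow> 'a \<Rightarrow> real"
    and \<omega> H :: "'a \<Rightarrow> 'a \<Rightarrow> 'a \<Rightarrow> real" and \<delta> :: "'a gen \<Rightarrow> real" and L :: "'a \<Rightarrow> 'a"
  assumes dim: "DIM('a) = 3" and lie: "lie_algebra br" and unimod: "unimodular br"
    and ori: "orientation \<omega>" and metric: "pseudo_metric g" and einstein: "gen_einstein br g H \<delta>"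
    and L_def: "L = structure_endo br g \<omega>"
begin

lemma br: "bilinear br" "br x x = 0"
  using lie by (auto simp: lie_algebra_def)

lemma H_three_form: "three_form H" and linear_\<delta>: "linear \<delta>"
  using einstein by (auto simp: gen_einstein_def)

lemma oriented_frame_onb:
  assumes "oriented_onb g \<omega> v" shows "oriented_frame g v (\<lambda>a. g (v a) (v a)) \<omega>"
  using metric_frame_oriented_onb[OF dim metric assms] assms ori
  by (simp add: oriented_frame_def oriented_frame_axioms_def oriented_onb_def orientation_def)

lemma symmetric_endo: "symmetric_endo g L"
proof -
  obtain v where "metric_frame g v (\<lambda>a. g (v a) (v a))"
    using orthonormal_eigenframe[OF dim metric linear_ident _ diagonalizable_id] by auto
  then obtain w where "oriented_frame g w (\<lambda>a. g (v a) (v a)) \<omega>"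
    using oriented_frame_or_neg[OF _ ori] by blast
  then interpret oriented_frame g w "\<lambda>a. g (v a) (v a)" \<omega> .
  show ?thesis
    unfolding symmetric_endo_def L_def
    using dim metric structure_endo(1,2)[OF br unimod] by blast
qed

sublocale symmetric_endo g L by (rule symmetric_endo)

lemma br_cross: assumes "oriented_onb g \<omega> v" shows "br x y = L (cross_product g \<omega> x y)"
  unfolding L_def by (rule oriented_frame.structure_endo(3)[OF oriented_frame_onb[OF assms] br unimod])

lemma br_cyclic:
  assumes v: "oriented_onb g \<omega> v" and "cyclic \<sigma>"
  shows "br (v (\<sigma> 1)) (v (\<sigma> 2)) = g (v (\<sigma> 3)) (v (\<sigma> 3)) *\<^sub>R L (v (\<sigma> 3))"
  using oriented_frame.cross_product_cyclic[OF oriented_frame_onb[OF v] assms(2)]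
  by (simp add: br_cross[OF v] Ls)

lemma br_onb:
  assumes v: "oriented_onb g \<omega> v"
  shows "br (v 1) (v 2) = g (v 3) (v 3) *\<^sub>R L (v 3)" "br (v 2) (v 3) = g (v 1) (v 1) *\<^sub>R L (v 1)"
    "br (v 3) (v 1) = g (v 2) (v 2) *\<^sub>R L (v 2)"
  using br_cyclic[OF v, of id] br_cyclic[OF v, of "triple 2 3 1"] br_cyclic[OF v, of "triple 3 1 2"]
  by (simp_all add: cyclic_def)

lemma structure_frame_onb:
  assumes v: "oriented_onb g \<omega> v"
  shows "structure_frame g v (\<lambda>a. g (v a) (v a)) br H (\<lambda>k d. g (L (v k)) (v d)) (H (v 1) (v 2) (v 3))"
  by (rule oriented_frame.structure_frame[OF oriented_frame_onb[OF v] br L br_cross[OF v] H_three_form])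

lemma ric_onb:
  assumes v: "oriented_onb g \<omega> v"
  shows "ric_coord (\<lambda>a. g (v a) (v a)) (\<lambda>k d. g (L (v k)) (v d)) (H (v 1) (v 2) (v 3)) (comp_plus g \<delta> v) a b = 0"
    "ric_coord (\<lambda>a. - g (v a) (v a)) (\<lambda>k d. g (L (v k)) (v d)) (H (v 1) (v 2) (v 3)) (comp_minus g \<delta> v) a b = 0"
  using structure_frame.gen_einstein_iff[OF structure_frame_onb[OF v]] einstein by blast+

lemma H_onb: "oriented_onb g \<omega> v \<Longrightarrow> H = (\<lambda>x y z. H (v 1) (v 2) (v 3) * volume_form g \<omega> x y z)"
  by (rule oriented_frame.three_form_eq_volume_form[OF oriented_frame_onb H_three_form])

lemma lorentz_frame_orient:
  assumes "lorentz_frame g s v"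
  obtains t where "t = 1 \<or> t = - 1" "oriented_onb g \<omega> (\<lambda>a. t *\<^sub>R v a)" "lorentz_frame g s (\<lambda>a. t *\<^sub>R v a)"
proof -
  have "\<exists>t. (t = 1 \<or> t = - 1) \<and> oriented_onb g \<omega> (\<lambda>a. t *\<^sub>R v a)"
    using oriented_frame_or_neg[OF metric_frame_lorentz[OF dim metric assms] ori]
      oriented_frame.oriented_onb
    by (metis (no_types, lifting) ext scaleR_minus1_left scaleR_one)
  then obtain t where t: "t = 1 \<or> t = - 1" "oriented_onb g \<omega> (\<lambda>a. t *\<^sub>R v a)" by blast
  moreover have "lorentz_frame g s (\<lambda>a. t *\<^sub>R v a)"
    using t(1) assms by (auto simp: lorentz_frame_def bs)
  ultimately show ?thesis using that by blast
qed

lemma block_form_scale: "block_form v l a b d \<Longrightarrow> block_form (\<lambda>k. t *\<^sub>R v k) l a b d"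
  by (simp add: block_form_def Ls scaleR_add_right scaleR_diff_right mult.commute)

lemma null_form_scale: "null_form v l n \<Longrightarrow> null_form (\<lambda>k. t *\<^sub>R v k) l n"
  by (simp add: null_form_def Ls scaleR_add_right scaleR_diff_right mult.commute)

lemma represented_by_scale: "represented_by L v M \<Longrightarrow> represented_by L (\<lambda>k. t *\<^sub>R v k) M"
  by (simp add: represented_by_def Ls scaleR_sum_right mult.commute)

lemma block_entries:
  assumes "lorentz_frame g s v" "block_form v l a b d"
  shows "g (L (v 1)) (v 1) = s * l" "g (L (v 1)) (v 2) = 0" "g (L (v 1)) (v 3) = 0" "g (L (v 2)) (v 1) = 0"
    "g (L (v 3)) (v 1) = 0" "g (L (v 2)) (v 2) = s * a" "g (L (v 2)) (v 3) = s * b" "g (L (v 3)) (v 2) = s * b"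
    "g (L (v 3)) (v 3) = - s * d"
  using assms gc[of "v 2" "v 1"] gc[of "v 3" "v 1"] gc[of "v 3" "v 2"]
  by (simp_all add: lorentz_frame_def block_form_def bs)

lemma null_entries:
  assumes "lorentz_frame g s v" "null_form v l n"
  shows "g (L (v 1)) (v 1) = s * l" "g (L (v 1)) (v 2) = s * n" "g (L (v 1)) (v 3) = 0" "g (L (v 2)) (v 1) = s * n"
    "g (L (v 3)) (v 1) = 0" "g (L (v 2)) (v 2) = s * l" "g (L (v 2)) (v 3) = s * n" "g (L (v 3)) (v 2) = s * n"
    "g (L (v 3)) (v 3) = - s * l"
  using assms gc[of "v 2" "v 1"] gc[of "v 3" "v 1"] gc[of "v 3" "v 2"]
  by (simp_all add: lorentz_frame_def null_form_def bs)

lemma lorentz_signs: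
  assumes "lorentz_frame g s v"
  shows "g (v 1) (v 1) = s" "g (v 2) (v 2) = s" "g (v 3) (v 3) = - s" "s * s = 1"
  using assms by (simp_all add: lorentz_frame_def)

lemma block_form_einstein:
  assumes v: "oriented_onb g \<omega> v" "lorentz_frame g s v" and Lv: "block_form v l a b d"
    and b: "b \<noteq> 0" "(a - d) ^ 2 \<le> 4 * b ^ 2"
  shows "l = 0" "H = (\<lambda>x y z. 0)" "(a - d) ^ 2 = 4 * b ^ 2"
proof -
  note * = block_einstein[where \<epsilon> = "\<lambda>a. g (v a) (v a)" and M = "\<lambda>k d. g (L (v k)) (v d)",
      OF lorentz_signs[OF v(2)] block_entries[OF v(2) Lv] b ric_onb[OF v(1)]]
  show "l = 0" "(a - d) ^ 2 = 4 * b ^ 2" by (rule *)+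
  show "H = (\<lambda>x y z. 0)" using H_onb[OF v(1)] *(2) by simp
qed

lemma null_form_einstein:
  assumes v: "oriented_onb g \<omega> v" "lorentz_frame g s v" and Lv: "null_form v l n" and n: "n \<noteq> 0"
  shows "l = 0" "H = (\<lambda>x y z. 0)"
proof -
  note * = null_einstein[where \<epsilon> = "\<lambda>a. g (v a) (v a)" and M = "\<lambda>k d. g (L (v k)) (v d)",
      OF lorentz_signs[OF v(2)] null_entries[OF v(2) Lv] n ric_onb[OF v(1)]]
  show "l = 0" by (rule *)
  show "H = (\<lambda>x y z. 0)" using H_onb[OF v(1)] *(2) by simp
qed

lemma nondiagonalizable_normal_form:
  assumes nd: "\<not> diagonalizable L"
  shows "H = (\<lambda>x y z. 0) \<and> (\<exists>s v. oriented_onb g \<omega> v \<and> lorentz_frame g s v \<and>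
    ((\<exists>\<alpha>. represented_by L v (L3 \<alpha>)) \<or> (\<exists>\<alpha>. represented_by L v (L4 \<alpha>)) \<or> represented_by L v L5))"
proof -
  have "H = (\<lambda>x y z. 0) \<and> (\<exists>s v. lorentz_frame g s v \<and>
    ((\<exists>\<alpha>. represented_by L v (L3 \<alpha>)) \<or> (\<exists>\<alpha>. represented_by L v (L4 \<alpha>)) \<or> represented_by L v L5))"
  proof (cases "\<exists>c x. L x = c *\<^sub>R x \<and> g x x \<noteq> 0")
    case True
    then obtain s v l a b d where v: "lorentz_frame g s v" "block_form v l a b d" "b \<noteq> 0" "(a - d) ^ 2 \<le> 4 * b ^ 2"
      using block_form_exists[OF nd] by blast
    obtain t where t: "t = 1 \<or> t = - 1" "oriented_onb g \<omega> (\<lambda>a. t *\<^sub>R v a)" "lorentz_frame g s (\<lambda>a. t *\<^sub>R v a)"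
      using lorentz_frame_orient[OF v(1)] .
    note E = block_form_einstein[OF t(2,3) block_form_scale[OF v(2)] v(3,4)]
    show ?thesis
      using E(2) block_form_normalize[OF v(1) v(2)[unfolded E(1)] v(3) E(3)] by blast
  next
    case False
    then obtain s v l n where v: "lorentz_frame g s v" "null_form v l n" "n \<noteq> 0"
      using null_form_exists by blast
    obtain t where t: "t = 1 \<or> t = - 1" "oriented_onb g \<omega> (\<lambda>a. t *\<^sub>R v a)" "lorentz_frame g s (\<lambda>a. t *\<^sub>R v a)"
      using lorentz_frame_orient[OF v(1)] .
    note E = null_form_einstein[OF t(2,3) null_form_scale[OF v(2)] v(3)]
    show ?thesis
      using E(2) null_form_normalize[OF v(1) v(2)[unfolded E(1)] v(3)] by blast
  qed
  then show ?thesis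
    using lorentz_frame_orient represented_by_scale by metis
qed

lemma linindep3_onb: "oriented_onb g \<omega> v \<Longrightarrow> linindep3 (v 1) (v 2) (v 3)"
  by (rule metric_frame.linindep3_frame[OF metric_frame_oriented_onb[OF dim metric]])

lemma linindep3_swap: "linindep3 x y z \<Longrightarrow> linindep3 x z y" "linindep3 x y z \<Longrightarrow> linindep3 z x y"
  unfolding linindep3_def by (metis add.commute add.left_commute)+

lemma block_form_algebra:
  assumes v: "oriented_onb g \<omega> v" "lorentz_frame g s v" and Lv: "block_form v 0 a b d"
    and b: "b \<noteq> 0" "a - d = 2 * b"
  shows "a + d = 0 \<Longrightarrow> is_heisenberg br" "a + d \<noteq> 0 \<Longrightarrow> is_e11 br"
proof -
  note sg = lorentz_signs[OF v(2)]
  have s: "s \<noteq> 0" using sg(4) by auto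
  have LL: "L (v 1) = 0" "L (v 2) = a *\<^sub>R v 2 - b *\<^sub>R v 3" "L (v 3) = b *\<^sub>R v 2 + d *\<^sub>R v 3"
    using Lv by (simp_all add: block_form_def)
  have br12: "br (v 1) (v 2) = (- (s * b)) *\<^sub>R v 2 + (- (s * d)) *\<^sub>R v 3"
    and br23: "br (v 2) (v 3) = 0"
    and br31: "br (v 3) (v 1) = (s * a) *\<^sub>R v 2 - (s * b) *\<^sub>R v 3"
    unfolding br_onb[OF v(1)] sg LL by (simp_all add: algebra_simps)
  note sk = alternating_skew[OF br]
  have br13: "br (v 1) (v 3) = (s * b) *\<^sub>R v 3 + (- (s * a)) *\<^sub>R v 2"
    using sk[of "v 1" "v 3"] br31 by simp
  have br32: "br (v 3) (v 2) = 0" using sk[of "v 3" "v 2"] br23 by simp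
  note indep = linindep3_onb[OF v(1)]
  have disc: "(s * b) ^ 2 + s * a * (s * d) = ((a + d) / 2) ^ 2"
  proof -
    have "(s * b) ^ 2 + s * a * (s * d) = s * s * (b ^ 2 + a * d)" by (simp add: power2_eq_square algebra_simps)
    moreover have "4 * (b ^ 2 + a * d) = (a + d) ^ 2" using b(2) by algebra
    ultimately show ?thesis by (simp add: sg(4) power_divide)
  qed
  show "is_heisenberg br" if "a + d = 0"
  proof (rule is_heisenbergI[OF dim br])
    have ad: "a = b" "d = - b" using that b(2) by simp_all
    let ?n = "(s * b) *\<^sub>R v 2 - (s * b) *\<^sub>R v 3"
    show "br (v 3) (v 1) = ?n" using br31 ad by simp
    show "br (v 3) ?n = 0" by (simp add: bilinear_simps[OF br(1)] br br32)
    show "br (v 1) ?n = 0" using ad by (simp add: bilinear_simps[OF br(1)] br12 br13 algebra_simps)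
    show "linindep3 (v 3) (v 1) ?n"
      unfolding linindep3_def
    proof (intro allI impI)
      fix x y z assume "x *\<^sub>R v 3 + y *\<^sub>R v 1 + z *\<^sub>R ?n = 0"
      then have "y *\<^sub>R v 1 + (z * (s * b)) *\<^sub>R v 2 + (x - z * (s * b)) *\<^sub>R v 3 = 0" by (simp add: algebra_simps)
      then have "y = 0" "z * (s * b) = 0" "x - z * (s * b) = 0" using indep unfolding linindep3_def by blast+
      then show "x = 0 \<and> y = 0 \<and> z = 0" using s b(1) by simp
    qed
  qed
  show "is_e11 br" if ad: "a + d \<noteq> 0"
  proof (cases "d = 0")
    case False
    show ?thesis
      by (rule is_e11I_hyperbolic[OF dim br indep, of "- (s * b)" "- (s * d)" "- (s * a)" "(a + d) / 2"])
        (use br12 br13 br23 disc ad False s in \<open>simp_all add: mult_ac\<close>)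
  next
    case True
    then have "a \<noteq> 0" using ad by simp
    show ?thesis
      by (rule is_e11I_hyperbolic[OF dim br linindep3_swap(1)[OF indep], of "s * b" "- (s * a)" "- (s * d)" "(a + d) / 2"])
        (use br12 br13 br32 disc ad \<open>a \<noteq> 0\<close> s in \<open>simp_all add: mult_ac\<close>)
  qed
qed

lemma null_form_algebra:
  assumes v: "oriented_onb g \<omega> v" "lorentz_frame g s v" and Lv: "null_form v 0 n" and n: "n \<noteq> 0"
  shows "is_e11 br"
proof (rule is_e11I[OF dim br])
  note sg = lorentz_signs[OF v(2)]
  have s: "s \<noteq> 0" using sg(4) by auto
  have LL: "L (v 1) = n *\<^sub>R v 2" "L (v 2) = n *\<^sub>R v 1 - n *\<^sub>R v 3" "L (v 3) = n *\<^sub>R v 2"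
    using Lv by (simp_all add: null_form_def)
  have br12: "br (v 1) (v 2) = (- (s * n)) *\<^sub>R v 2" and br23: "br (v 2) (v 3) = (s * n) *\<^sub>R v 2"
    and br31: "br (v 3) (v 1) = (s * n) *\<^sub>R (v 1 - v 3)"
    unfolding br_onb[OF v(1)] sg LL by (simp_all add: algebra_simps)
  have br32: "br (v 3) (v 2) = (- (s * n)) *\<^sub>R v 2" using alternating_skew[OF br, of "v 3" "v 2"] br23 by simp
  let ?t = "(1 / (s * n)) *\<^sub>R v 3"
  show "br ?t (v 1 - v 3) = v 1 - v 3" "br ?t (v 2) = - v 2"
    using s n by (simp_all add: bilinear_simps[OF br(1)] br br31 br32)
  show "br (v 1 - v 3) (v 2) = 0" by (simp add: bilinear_simps[OF br(1)] br12 br32)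
  show "linindep3 ?t (v 1 - v 3) (v 2)"
    unfolding linindep3_def
  proof (intro allI impI)
    fix x y z assume "x *\<^sub>R ?t + y *\<^sub>R (v 1 - v 3) + z *\<^sub>R v 2 = 0"
    then have "y *\<^sub>R v 1 + z *\<^sub>R v 2 + (x / (s * n) - y) *\<^sub>R v 3 = 0" by (simp add: algebra_simps)
    then have "y = 0" "z = 0" "x / (s * n) - y = 0" using linindep3_onb[OF v(1)] unfolding linindep3_def by blast+
    then show "x = 0 \<and> y = 0 \<and> z = 0" using s n by simp
  qed
qed

lemma block_form_divergence:
  assumes v: "oriented_onb g \<omega> v" "lorentz_frame g s v" and Lv: "block_form v 0 a b d" and H: "H = (\<lambda>x y z. 0)"
    and P: "P = comp_plus g \<delta> v \<or> P = comp_minus g \<delta> v"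
  shows "P 2 * (a + d) = 0" "P 3 * (a + d) = 0" "2 * b * P 2 = (a - d) * P 3" "- 2 * b * (s * P 1) = a ^ 2 - d ^ 2"
proof -
  note M = block_entries[OF v(2) Lv] and sg = lorentz_signs[OF v(2)]
  note p = block_einstein_divergence[where \<epsilon> = "\<lambda>a. g (v a) (v a)" and M = "\<lambda>k d. g (L (v k)) (v d)" and s = s
      and a = a and b = b and d = d and P = "comp_plus g \<delta> v"]
  note m = block_einstein_divergence[where \<epsilon> = "\<lambda>a. - g (v a) (v a)" and M = "\<lambda>k d. g (L (v k)) (v d)" and s = "- s"
      and a = "- a" and b = "- b" and d = "- d" and P = "comp_minus g \<delta> v"]
  have "comp_plus g \<delta> v 2 * (a + d) = 0 \<and> comp_plus g \<delta> v 3 * (a + d) = 0 \<and>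
     2 * b * comp_plus g \<delta> v 2 = (a - d) * comp_plus g \<delta> v 3 \<and> - 2 * b * (s * comp_plus g \<delta> v 1) = a ^ 2 - d ^ 2"
    using p M sg ric_onb(1)[OF v(1)] by (simp add: H)
  moreover have "comp_minus g \<delta> v 2 * (- a + - d) = 0 \<and> comp_minus g \<delta> v 3 * (- a + - d) = 0 \<and>
     2 * - b * comp_minus g \<delta> v 2 = (- a - - d) * comp_minus g \<delta> v 3 \<and>
     - 2 * - b * (- s * comp_minus g \<delta> v 1) = (- a) ^ 2 - (- d) ^ 2"
    using m M sg ric_onb(2)[OF v(1)] by (simp add: H)
  ultimately show "P 2 * (a + d) = 0" "P 3 * (a + d) = 0" "2 * b * P 2 = (a - d) * P 3"
    "- 2 * b * (s * P 1) = a ^ 2 - d ^ 2"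
    using P by (auto simp: algebra_simps)
qed

lemma null_form_divergence:
  assumes v: "oriented_onb g \<omega> v" "lorentz_frame g s v" and Lv: "null_form v 0 n" and n: "n \<noteq> 0"
    and H: "H = (\<lambda>x y z. 0)" and P: "P = comp_plus g \<delta> v \<or> P = comp_minus g \<delta> v"
  shows "s * P 1 = - 2 * n" "P 2 = 0" "s * P 3 = - 2 * n"
proof -
  note M = null_entries[OF v(2) Lv] and sg = lorentz_signs[OF v(2)]
  note p = null_einstein_divergence[where \<epsilon> = "\<lambda>a. g (v a) (v a)" and M = "\<lambda>k d. g (L (v k)) (v d)" and s = s
      and n = n and P = "comp_plus g \<delta> v"]
  note m = null_einstein_divergence[where \<epsilon> = "\<lambda>a. - g (v a) (v a)" and M = "\<lambda>k d. g (L (v k)) (v d)" and s = "- s"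
      and n = "- n" and P = "comp_minus g \<delta> v"]
  have "s * comp_plus g \<delta> v 1 = - 2 * n \<and> comp_plus g \<delta> v 2 = 0 \<and> s * comp_plus g \<delta> v 3 = - 2 * n"
    using p M sg n ric_onb(1)[OF v(1)] by (simp add: H)
  moreover have "- s * comp_minus g \<delta> v 1 = - 2 * - n \<and> comp_minus g \<delta> v 2 = 0 \<and> - s * comp_minus g \<delta> v 3 = - 2 * - n"
    using m M sg n ric_onb(2)[OF v(1)] by (simp add: H)
  ultimately show "s * P 1 = - 2 * n" "P 2 = 0" "s * P 3 = - 2 * n" using P by auto
qed

lemma nondiagonalizable_consequences:
  assumes nd: "\<not> diagonalizable L" and v: "oriented_onb g \<omega> v" "g (v 1) (v 1) = g (v 2) (v 2)"
      "g (v 2) (v 2) = - g (v 3) (v 3)"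
  shows "(represented_by L v (L3 0) \<or> represented_by L v (L4 0) \<longrightarrow>
       is_heisenberg br \<and> comp_plus g \<delta> v 1 = 0 \<and> comp_minus g \<delta> v 1 = 0 \<and>
       comp_plus g \<delta> v 2 = comp_plus g \<delta> v 3 \<and> comp_minus g \<delta> v 2 = comp_minus g \<delta> v 3) \<and>
    (\<forall>\<alpha>. \<alpha> \<noteq> 0 \<and> (represented_by L v (L3 \<alpha>) \<or> represented_by L v (L4 \<alpha>)) \<longrightarrow>
       is_e11 br \<and> - (1/2) * g (v 1) (v 1) * comp_plus g \<delta> v 1 = \<alpha> \<and>
       - (1/2) * g (v 1) (v 1) * comp_minus g \<delta> v 1 = \<alpha> \<and>
       comp_plus g \<delta> v 2 = 0 \<and> comp_plus g \<delta> v 3 = 0 \<and> comp_minus g \<delta> v 2 = 0 \<and> comp_minus g \<delta> v 3 = 0) \<and>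
    (represented_by L v L5 \<longrightarrow>
       is_e11 br \<and> g (v 1) (v 1) * comp_plus g \<delta> v 1 = - sqrt 2 \<and>
       - g (v 3) (v 3) * comp_plus g \<delta> v 3 = - sqrt 2 \<and> g (v 1) (v 1) * comp_minus g \<delta> v 1 = - sqrt 2 \<and>
       - g (v 3) (v 3) * comp_minus g \<delta> v 3 = - sqrt 2 \<and> comp_plus g \<delta> v 2 = 0 \<and> comp_minus g \<delta> v 2 = 0)"
proof -
  define s where "s = g (v 1) (v 1)"
  have lf: "lorentz_frame g s v"
    using v metric_frame.sign[OF metric_frame_oriented_onb[OF dim metric v(1)], of 1]
    by (simp add: lorentz_frame_def s_def oriented_onb_def)
  note sg = lorentz_signs[OF lf]
  have s: "s \<noteq> 0" using sg(4) by auto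
  have H: "H = (\<lambda>x y z. 0)" using nondiagonalizable_normal_form[OF nd] by blast
  have blk: "\<exists>b. b \<noteq> 0 \<and> block_form v 0 (\<alpha> + b) b (\<alpha> - b)"
    if "represented_by L v (L3 \<alpha>) \<or> represented_by L v (L4 \<alpha>)" for \<alpha>
    using that represented_by_L3[of v \<alpha>] represented_by_L4[of v \<alpha>]
    by (auto intro: exI[of _ "1/2"] exI[of _ "- (1/2)"])
  have div: "is_heisenberg br \<or> \<alpha> \<noteq> 0" "is_e11 br \<or> \<alpha> = 0"
    "P 2 * \<alpha> = 0 \<and> P 3 * \<alpha> = 0 \<and> P 2 = P 3 \<and> s * P 1 = - 2 * \<alpha>"
    if rep: "represented_by L v (L3 \<alpha>) \<or> represented_by L v (L4 \<alpha>)"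
      and P: "P = comp_plus g \<delta> v \<or> P = comp_minus g \<delta> v" for \<alpha> P
  proof -
    obtain b where b: "b \<noteq> 0" "block_form v 0 (\<alpha> + b) b (\<alpha> - b)" using blk[OF rep] by blast
    show "is_heisenberg br \<or> \<alpha> \<noteq> 0" "is_e11 br \<or> \<alpha> = 0"
      using block_form_algebra[OF v(1) lf b(2,1)] by auto
    note D = block_form_divergence[OF v(1) lf b(2) H P]
    have "2 * b * (s * P 1) = 2 * b * (- 2 * \<alpha>)" using D(4) by (simp add: power2_eq_square algebra_simps)
    then have "s * P 1 = - 2 * \<alpha>" using b(1) by (simp only: mult_cancel_left) simp
    then show "P 2 * \<alpha> = 0 \<and> P 3 * \<alpha> = 0 \<and> P 2 = P 3 \<and> s * P 1 = - 2 * \<alpha>"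
      using D(1-3) b(1) by simp
  qed
  note dp = div[where P = "comp_plus g \<delta> v", OF _ disjI1[OF refl]]
    and dm = div[where P = "comp_minus g \<delta> v", OF _ disjI2[OF refl]]
  show ?thesis
  proof (rule conjI[OF impI conjI[OF allI[OF impI] impI]], goal_cases)
    case 1
    then show ?case using dp[of 0] dm[of 0] s by simp
  next
    case (2 \<alpha>)
    then show ?case using dp[of \<alpha>] dm[of \<alpha>] by (simp add: s_def[symmetric])
  next
    case 3
    then have nf: "null_form v 0 (1 / sqrt 2)" using represented_by_L5 by blast
    have n: "1 / sqrt 2 \<noteq> 0" by simp
    have r2: "- 2 * (1 / sqrt 2) = - sqrt 2" by (simp add: real_div_sqrt)
    show ?case
      using null_form_divergence[OF v(1) lf nf n H disjI1[OF refl], unfolded r2]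
        null_form_divergence[OF v(1) lf nf n H disjI2[OF refl], unfolded r2]
        null_form_algebra[OF v(1) lf nf n] sg by simp
  qed
qed

end


section \<open>The diagonalizable case\<close>

lemma cyclic_shifts: "cyclic id" "cyclic (triple 2 3 1)" "cyclic (triple 3 1 2)"
  by (simp_all add: cyclic_def)

lemma cyclic_rotate: "cyclic \<sigma> \<Longrightarrow> cyclic (triple (\<sigma> 2) (\<sigma> 3) (\<sigma> 1))"
  by (auto simp: cyclic_def)

context einstein_lie_algebra
begin

lemma exists_adapted_basis:
  assumes diag: "diagonalizable L"
  shows "\<exists>v \<alpha> h. adapted_basis br g \<omega> H v \<alpha> h"
proof -
  obtain w where w: "metric_frame g w (\<lambda>a. g (w a) (w a))" "\<And>a. \<exists>c. L (w a) = c *\<^sub>R w a"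
    using orthonormal_eigenframe[OF dim metric L sym diag] by blast
  interpret w: metric_frame g w "\<lambda>a. g (w a) (w a)" by (rule w(1))
  have "\<exists>\<sigma>. cyclic \<sigma> \<and> g (w (\<sigma> 1)) (w (\<sigma> 1)) = g (w (\<sigma> 2)) (w (\<sigma> 2))"
  proof -
    have "g (w a) (w a) = 1 \<or> g (w a) (w a) = - 1" for a
      using w.sign[of a] by (simp add: square_eq_1_iff)
    from this[of 1] this[of 2] this[of 3]
    have "g (w 1) (w 1) = g (w 2) (w 2) \<or> g (w 2) (w 2) = g (w 3) (w 3) \<or> g (w 3) (w 3) = g (w 1) (w 1)" by auto
    then show ?thesis
    proof (elim disjE)
      show ?thesis if "g (w 1) (w 1) = g (w 2) (w 2)" using that cyclic_shifts(1) by (intro exI[of _ id]) simp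
      show ?thesis if "g (w 2) (w 2) = g (w 3) (w 3)"
        using that cyclic_shifts(2) by (intro exI[of _ "triple 2 3 1"]) simp
      show ?thesis if "g (w 3) (w 3) = g (w 1) (w 1)"
        using that cyclic_shifts(3) by (intro exI[of _ "triple 3 1 2"]) simp
    qed
  qed
  then obtain \<sigma> where \<sigma>: "cyclic \<sigma>" "g (w (\<sigma> 1)) (w (\<sigma> 1)) = g (w (\<sigma> 2)) (w (\<sigma> 2))" by blast
  let ?u = "\<lambda>a. w (\<sigma> a)"
  have wo: "g (w a) (w b) = 0" if "a \<noteq> b" for a b using w.orthonormal[of a b] that by simp
  have "metric_frame g ?u (\<lambda>a. g (?u a) (?u a))"
  proof (rule metric_frameI[OF dim metric])
    show "g (w (\<sigma> 1)) (w (\<sigma> 2)) = 0" "g (w (\<sigma> 1)) (w (\<sigma> 3)) = 0" "g (w (\<sigma> 2)) (w (\<sigma> 3)) = 0"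
      using \<sigma>(1) by (elim cyclic_cases; simp add: wo)+
  qed (rule w.sign)
  then have "\<exists>v. oriented_onb g \<omega> v \<and> g (v 1) (v 1) = g (v 2) (v 2) \<and> (\<forall>a. \<exists>c. L (v a) = c *\<^sub>R v a)"
  proof (rule oriented_frame_or_neg[OF _ ori, THEN disjE])
    assume "oriented_frame g ?u (\<lambda>a. g (?u a) (?u a)) \<omega>"
    then have "oriented_onb g \<omega> ?u" by (rule oriented_frame.oriented_onb)
    then show ?thesis using \<sigma>(2) w(2) by blast
  next
    assume "oriented_frame g (\<lambda>a. - ?u a) (\<lambda>a. g (?u a) (?u a)) \<omega>"
    then have "oriented_onb g \<omega> (\<lambda>a. - ?u a)" by (rule oriented_frame.oriented_onb)
    moreover have "\<exists>c. L (- ?u a) = c *\<^sub>R (- ?u a)" for a using w(2)[of "\<sigma> a"] by (auto simp: Ls)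
    ultimately show ?thesis using \<sigma>(2) by (intro exI[of _ "\<lambda>a. - ?u a"]) (simp add: bs)
  qed
  then obtain v \<alpha> where v: "oriented_onb g \<omega> v" "g (v 1) (v 1) = g (v 2) (v 2)" "\<And>a. L (v a) = \<alpha> a *\<^sub>R v a"
    by metis
  have "adapted_basis br g \<omega> H v \<alpha> (H (v 1) (v 2) (v 3))"
    unfolding adapted_basis_def
    using v br_cyclic[OF v(1)] H_onb[OF v(1)] by (simp add: mult.commute)
  then show ?thesis by blast
qed

lemma adapted_basis_diagonal:
  assumes ad: "adapted_basis br g \<omega> H v \<alpha> h"
  shows "L (v a) = \<alpha> a *\<^sub>R v a" "H (v 1) (v 2) (v 3) = h"
proof -
  have v: "oriented_onb g \<omega> v" using ad by (simp add: adapted_basis_def)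
  interpret oriented_frame g v "\<lambda>a. g (v a) (v a)" \<omega> by (rule oriented_frame_onb[OF v])
  have "L (v (\<sigma> 3)) = \<alpha> (\<sigma> 3) *\<^sub>R v (\<sigma> 3)" if "cyclic \<sigma>" for \<sigma>
  proof -
    have "g (v (\<sigma> 3)) (v (\<sigma> 3)) *\<^sub>R L (v (\<sigma> 3)) = g (v (\<sigma> 3)) (v (\<sigma> 3)) *\<^sub>R (\<alpha> (\<sigma> 3) *\<^sub>R v (\<sigma> 3))"
      using br_cyclic[OF v that] ad that by (simp add: adapted_basis_def mult.commute)
    then show ?thesis using sign_nonzero[of "\<sigma> 3"] by (simp only: scaleR_cancel_left) simp
  qed
  from this[OF cyclic_shifts(1)] this[OF cyclic_shifts(2)] this[OF cyclic_shifts(3)]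
  show "L (v a) = \<alpha> a *\<^sub>R v a" using exhaust_3[of a] by auto
  have "H (v 1) (v 2) (v 3) = h * volume_form g \<omega> (v 1) (v 2) (v 3)"
    using ad unfolding adapted_basis_def by metis
  then show "H (v 1) (v 2) (v 3) = h" by (simp add: volume_form_eq frame_volume_frame levi_simps)
qed

lemma adapted_basis_equations:
  assumes ad: "adapted_basis br g \<omega> H v \<alpha> h" and abc: "a \<noteq> b" "b \<noteq> c" "a \<noteq> c"
  shows "\<alpha> a ^ 2 - (\<alpha> b - \<alpha> c) ^ 2 - h ^ 2 = 0" "comp_plus g \<delta> v c * (h - \<alpha> a + \<alpha> b + \<alpha> c) = 0"
    "comp_minus g \<delta> v c * (h + \<alpha> a - \<alpha> b - \<alpha> c) = 0"
proof -
  have v: "oriented_onb g \<omega> v" using ad by (simp add: adapted_basis_def)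
  interpret oriented_frame g v "\<lambda>a. g (v a) (v a)" \<omega> by (rule oriented_frame_onb[OF v])
  have M: "g (L (v a)) (v b) = (if a = b then g (v a) (v a) * \<alpha> a else 0)"
    "g (L (v a)) (v b) = (if a = b then - g (v a) (v a) * - \<alpha> a else 0)" for a b
    using adapted_basis_diagonal(1)[OF ad] v by (auto simp: bs oriented_onb_def)
  have sign': "- g (v a) (v a) * - g (v a) (v a) = 1" for a using sign by simp
  have lv: "levi a b c \<noteq> 0" using abc by (simp add: levi_def)
  note R = ric_onb[OF v, unfolded adapted_basis_diagonal(2)[OF ad]]
  note p = ric_coord_diag[of "\<lambda>a. g (v a) (v a)" "\<lambda>k d. g (L (v k)) (v d)" \<alpha>, OF sign M(1) abc]
  note m = ric_coord_diag[of "\<lambda>a. - g (v a) (v a)" "\<lambda>k d. g (L (v k)) (v d)" "\<lambda>a. - \<alpha> a", OF sign' M(2) abc]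
  show "\<alpha> a ^ 2 - (\<alpha> b - \<alpha> c) ^ 2 - h ^ 2 = 0"
    using p(2)[of h "comp_plus g \<delta> v"] R(1) sign_nonzero[of b] sign_nonzero[of c] by simp
  show "comp_plus g \<delta> v c * (h - \<alpha> a + \<alpha> b + \<alpha> c) = 0"
    using p(1)[of h "comp_plus g \<delta> v"] R(1) lv sign_nonzero[of c] by simp
  show "comp_minus g \<delta> v c * (h + \<alpha> a - \<alpha> b - \<alpha> c) = 0"
    using m(1)[of h "comp_minus g \<delta> v"] R(2) lv sign_nonzero[of c] by simp
qed

lemma E_plus_vanish:
  assumes v: "oriented_onb g \<omega> v"
  shows "(\<And>a. comp_plus g \<delta> v a = 0) \<Longrightarrow> u \<in> E_plus g \<Longrightarrow> \<delta> u = 0"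
    and "(\<And>a. comp_minus g \<delta> v a = 0) \<Longrightarrow> u \<in> E_minus g \<Longrightarrow> \<delta> u = 0"
proof -
  interpret structure_frame g v "\<lambda>a. g (v a) (v a)" br H "\<lambda>k d. g (L (v k)) (v d)" "H (v 1) (v 2) (v 3)"
    by (rule structure_frame_onb[OF v])
  have c: "\<delta> (ep a) = comp_plus g \<delta> v a" "\<delta> (em a) = comp_minus g \<delta> v a" for a
    by (simp_all add: comp_plus_def comp_minus_def ep_def em_def)
  show "(\<And>a. comp_plus g \<delta> v a = 0) \<Longrightarrow> u \<in> E_plus g \<Longrightarrow> \<delta> u = 0"
    using linear_of_proj_plus[OF linear_\<delta>, of u] proj_of_plus(2)[of u] by (simp add: c)
  show "(\<And>a. comp_minus g \<delta> v a = 0) \<Longrightarrow> u \<in> E_minus g \<Longrightarrow> \<delta> u = 0"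
    using linear_of_proj_minus[OF linear_\<delta>, of u] proj_of_minus(2)[of u] by (simp add: c)
qed

lemma flat_consequences:
  assumes ad: "adapted_basis br g \<omega> H v \<alpha> h" and val: "values1 \<alpha> h"
  shows "abelian_on UNIV br" "linear \<delta>' \<Longrightarrow> gen_einstein br g H \<delta>'"
proof -
  have v: "oriented_onb g \<omega> v" using ad by (simp add: adapted_basis_def)
  interpret structure_frame g v "\<lambda>a. g (v a) (v a)" br H "\<lambda>k d. g (L (v k)) (v d)" "H (v 1) (v 2) (v 3)"
    by (rule structure_frame_onb[OF v])
  have z: "\<alpha> a = 0" for a using val exhaust_3[of a] by (auto simp: values1_def)
  have Lv: "L (v a) = 0" for a using adapted_basis_diagonal(1)[OF ad] z by simp
  have h: "H (v 1) (v 2) (v 3) = 0" using adapted_basis_diagonal(2)[OF ad] val by (simp add: values1_def)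
  have "L = (\<lambda>x. 0)" by (rule linear_eq_frame[OF L]) (simp_all add: Lv linear_zero)
  then show "abelian_on UNIV br" using br_cross[OF v] by (simp add: abelian_on_def)
  show "gen_einstein br g H \<delta>'" if "linear \<delta>'"
    using that unfolding gen_einstein_iff
    by (simp add: ric_coord_def dorfman_coord_def structure_coord_def Lv h bs)
qed

lemma definite_on_UNIV_iff:
  assumes v: "oriented_onb g \<omega> v" and e: "g (v 1) (v 1) = g (v 2) (v 2)"
  shows "definite_on UNIV g \<longleftrightarrow> g (v 3) (v 3) = g (v 1) (v 1)"
proof -
  interpret oriented_frame g v "\<lambda>a. g (v a) (v a)" \<omega> by (rule oriented_frame_onb[OF v])
  have pm: "g (v a) (v a) = 1 \<or> g (v a) (v a) = - 1" for a using v by (simp add: oriented_onb_def)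
  show ?thesis
  proof
    assume d: "definite_on UNIV g"
    have "v 1 \<noteq> 0" "v 3 \<noteq> 0" using sign_nonzero[of 1] sign_nonzero[of 3] by (auto simp: bs)
    then have "g (v 1) (v 1) > 0 \<and> g (v 3) (v 3) > 0 \<or> g (v 1) (v 1) < 0 \<and> g (v 3) (v 3) < 0"
      using d unfolding definite_on_def by blast
    then show "g (v 3) (v 3) = g (v 1) (v 1)" using pm[of 1] pm[of 3] by auto
  next
    assume e3: "g (v 3) (v 3) = g (v 1) (v 1)"
    then have all: "g (v a) (v a) = g (v 1) (v 1)" for a using e exhaust_3[of a] by auto
    have gx: "g x x = g (v 1) (v 1) * (\<Sum>a\<in>UNIV. (g x (v a)) ^ 2)" for x
    proof -
      have "g x x = (\<Sum>a\<in>UNIV. g (v a) (v a) * g x (v a) * g x (v a))" by (rule g_expand)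
      also have "\<dots> = (\<Sum>a\<in>UNIV. g (v 1) (v 1) * (g x (v a)) ^ 2)"
      proof (intro sum.cong refl)
        fix a show "g (v a) (v a) * g x (v a) * g x (v a) = g (v 1) (v 1) * (g x (v a)) ^ 2"
          using all[of a] by (simp add: power2_eq_square)
      qed
      finally show ?thesis by (simp add: sum_distrib_left)
    qed
    have pos: "(\<Sum>a\<in>UNIV. (g x (v a)) ^ 2) > 0" if "x \<noteq> 0" for x
    proof -
      have "\<not> (\<forall>b. g x (v b) = 0)" using g_nondegenerate[of x] that by blast
      then obtain b where b: "g x (v b) \<noteq> 0" by blast
      show ?thesis by (rule sum_pos2[of _ b]) (use b in auto)
    qed
    show "definite_on UNIV g"
      using pm[of 1]
    proof
      assume "g (v 1) (v 1) = 1"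
      then have "g x x = (\<Sum>a\<in>UNIV. (g x (v a)) ^ 2)" for x using gx[of x] by (metis mult_1)
      then have "g x x > 0" if "x \<noteq> 0" for x using pos[OF that] by metis
      then show ?thesis unfolding definite_on_def by blast
    next
      assume "g (v 1) (v 1) = - 1"
      then have "g x x = - (\<Sum>a\<in>UNIV. (g x (v a)) ^ 2)" for x using gx[of x] by (metis mult_minus1)
      then have "g x x < 0" if "x \<noteq> 0" for x using pos[OF that] by (metis neg_less_0_iff_less)
      then show ?thesis unfolding definite_on_def by blast
    qed
  qed
qed

lemma simple_consequences:
  assumes ad: "adapted_basis br g \<omega> H v \<alpha> h" and val: "values2 \<alpha> h"
  shows "is_so21 br \<or> is_so3 br" "is_so3 br \<longleftrightarrow> definite_on UNIV g"
    "\<alpha> 1 = h \<Longrightarrow> u \<in> E_plus g \<Longrightarrow> \<delta> u = 0" "\<alpha> 1 = - h \<Longrightarrow> w \<in> E_minus g \<Longrightarrow> \<delta> w = 0"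
proof -
  have v: "oriented_onb g \<omega> v" and e: "g (v 1) (v 1) = g (v 2) (v 2)" using ad by (simp_all add: adapted_basis_def)
  interpret oriented_frame g v "\<lambda>a. g (v a) (v a)" \<omega> by (rule oriented_frame_onb[OF v])
  have \<alpha>: "\<alpha> a = \<alpha> 1" for a using val exhaust_3[of a] by (auto simp: values2_def)
  have h: "h \<noteq> 0" and \<alpha>0: "\<alpha> 1 \<noteq> 0" using val by (auto simp: values2_def)
  define s where "s = g (v 1) (v 1)"
  have ss: "s * s = 1" and s0: "s \<noteq> 0" using sign[of 1] by (auto simp: s_def)
  have Lv: "L (v a) = \<alpha> 1 *\<^sub>R v a" for a using adapted_basis_diagonal(1)[OF ad, of a] \<alpha>[of a] by simp
  have b: "br (v 1) (v 2) = (g (v 3) (v 3) * \<alpha> 1) *\<^sub>R v 3" "br (v 2) (v 3) = (s * \<alpha> 1) *\<^sub>R v 1"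
    "br (v 3) (v 1) = (s * \<alpha> 1) *\<^sub>R v 2"
    unfolding br_onb[OF v] Lv by (simp_all add: s_def e)
  have scale: "linindep3 (k *\<^sub>R v 1) (k *\<^sub>R v 2) (k *\<^sub>R v 3)" if "k \<noteq> 0" for k
    unfolding linindep3_def
  proof (intro allI impI)
    fix a b c assume "a *\<^sub>R k *\<^sub>R v 1 + b *\<^sub>R k *\<^sub>R v 2 + c *\<^sub>R k *\<^sub>R v 3 = 0"
    then have "(a * k) *\<^sub>R v 1 + (b * k) *\<^sub>R v 2 + (c * k) *\<^sub>R v 3 = 0" by simp
    then have "a * k = 0" "b * k = 0" "c * k = 0" using linindep3_onb[OF v] unfolding linindep3_def by blast+
    then show "a = 0 \<and> b = 0 \<and> c = 0" using that by simp
  qed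
  note bb = bilinear_simps[OF br(1)]
  have dist: "\<exists>a b :: 3. a \<noteq> b \<and> b \<noteq> c \<and> a \<noteq> c" for c :: 3
    using exhaust_3[of c] distinct_3 by (elim disjE; blast)
  show "\<delta> u = 0" if "\<alpha> 1 = h" "u \<in> E_plus g"
  proof (rule E_plus_vanish(1)[OF v _ that(2)])
    fix c :: 3 obtain a b where "a \<noteq> b" "b \<noteq> c" "a \<noteq> c" using dist[of c] by blast
    from adapted_basis_equations(2)[OF ad this] show "comp_plus g \<delta> v c = 0"
      using h that(1) \<alpha>[of a] \<alpha>[of b] \<alpha>[of c] by simp
  qed
  show "\<delta> w = 0" if "\<alpha> 1 = - h" "w \<in> E_minus g"
  proof (rule E_plus_vanish(2)[OF v _ that(2)])
    fix c :: 3 obtain a b where "a \<noteq> b" "b \<noteq> c" "a \<noteq> c" using dist[of c] by blast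
    from adapted_basis_equations(3)[OF ad this] show "comp_minus g \<delta> v c = 0"
      using h that(1) \<alpha>[of a] \<alpha>[of b] \<alpha>[of c] by simp
  qed
  have "g (v 3) (v 3) = s \<or> g (v 3) (v 3) = - s"
    using v unfolding oriented_onb_def s_def by (metis minus_minus)
  then have "(is_so21 br \<or> is_so3 br) \<and> (is_so3 br \<longleftrightarrow> definite_on UNIV g)"
  proof
    assume e3: "g (v 3) (v 3) = s"
    let ?k = "s / \<alpha> 1"
    have k: "?k * ?k * (s * \<alpha> 1) = ?k"
      using ss \<alpha>0 by (simp add: field_simps)
    have "is_so3 br"
      using \<alpha>0 s0 k by (intro is_so3I[OF dim br scale[of ?k]]) (simp_all add: bb b e3)
    then show ?thesis using definite_on_UNIV_iff[OF v e] e3 s_def by simp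
  next
    assume e3: "g (v 3) (v 3) = - s"
    let ?k = "- s / \<alpha> 1"
    have k: "?k * ?k * (- s * \<alpha> 1) = ?k"
      using ss \<alpha>0 by (simp add: field_simps)
    have "is_so21 br"
      using \<alpha>0 s0 k by (intro is_so21I[OF dim br scale[of ?k]]) (simp_all add: bb b e3)
    moreover have "\<not> is_so3 br"
    proof (rule not_is_so3I)
      have b13: "br (v 1) (v 3) = - ((s * \<alpha> 1) *\<^sub>R v 2)" using alternating_skew[OF br, of "v 1" "v 3"] b(3) by simp
      have "br (v 1) (br (v 1) (v 2)) = ((s * s) * (\<alpha> 1 * \<alpha> 1)) *\<^sub>R v 2"
        by (simp add: b(1) e3 bb b13 mult_ac)
      then show "br (v 1) (br (v 1) (v 2)) = (\<alpha> 1 * \<alpha> 1) *\<^sub>R v 2"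
        unfolding ss by simp
      show "\<alpha> 1 * \<alpha> 1 > 0" using \<alpha>0 by (auto simp: zero_less_mult_iff linorder_neq_iff)
      show "v 2 \<noteq> 0" using sign_nonzero[of 2] by (auto simp: bs)
    qed
    moreover have "\<not> definite_on UNIV g" using definite_on_UNIV_iff[OF v e] e3 s0 s_def by simp
    ultimately show ?thesis by blast
  qed
  then show "is_so21 br \<or> is_so3 br" "is_so3 br \<longleftrightarrow> definite_on UNIV g" by blast+
qed

lemma metabelian_consequences:
  assumes ad: "adapted_basis br g \<omega> H v \<alpha> h" and val: "values3 \<sigma> \<alpha> h"
  shows "abelian_on (derived_algebra br) br" "dim (derived_algebra br) = 2"
    "(is_e2 br \<and> definite_on (derived_algebra br) g) \<or> (is_e11 br \<and> indefinite_on (derived_algebra br) g)"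
    "comp_plus g \<delta> v (\<sigma> 1) = 0" "comp_plus g \<delta> v (\<sigma> 2) = 0"
    "comp_minus g \<delta> v (\<sigma> 1) = 0" "comp_minus g \<delta> v (\<sigma> 2) = 0"
proof -
  have v: "oriented_onb g \<omega> v" using ad by (simp add: adapted_basis_def)
  interpret oriented_frame g v "\<lambda>a. g (v a) (v a)" \<omega> by (rule oriented_frame_onb[OF v])
  have \<sigma>: "cyclic \<sigma>" and h: "h = 0" and \<alpha>: "\<alpha> (\<sigma> 1) = \<alpha> (\<sigma> 2)" "\<alpha> (\<sigma> 2) \<noteq> 0" "\<alpha> (\<sigma> 3) = 0"
    using val by (auto simp: values3_def)
  have d: "\<sigma> 1 \<noteq> \<sigma> 2" "\<sigma> 2 \<noteq> \<sigma> 3" "\<sigma> 1 \<noteq> \<sigma> 3" using \<sigma> by (elim cyclic_cases; simp)+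
  show "comp_plus g \<delta> v (\<sigma> 1) = 0" "comp_minus g \<delta> v (\<sigma> 1) = 0"
    using adapted_basis_equations(2,3)[OF ad, of "\<sigma> 3" "\<sigma> 2" "\<sigma> 1"] d \<alpha> h by auto
  show "comp_plus g \<delta> v (\<sigma> 2) = 0" "comp_minus g \<delta> v (\<sigma> 2) = 0"
    using adapted_basis_equations(2,3)[OF ad, of "\<sigma> 3" "\<sigma> 1" "\<sigma> 2"] d \<alpha> h by auto
  define x y z \<beta> s t where "x = v (\<sigma> 1)" and "y = v (\<sigma> 2)" and "z = v (\<sigma> 3)" and "\<beta> = \<alpha> (\<sigma> 2)"
    and "s = g x x" and "t = g y y"
  have st: "s = 1 \<or> s = - 1" "t = 1 \<or> t = - 1"
    using v by (simp_all add: oriented_onb_def s_def t_def x_def y_def)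
  have gxy: "g x y = 0" "g y x = 0" using d v by (simp_all add: oriented_onb_def x_def y_def)
  have \<beta>: "\<beta> \<noteq> 0" using \<alpha> by (simp add: \<beta>_def)
  have Lv: "L x = \<beta> *\<^sub>R x" "L y = \<beta> *\<^sub>R y" "L z = 0"
    using adapted_basis_diagonal(1)[OF ad] \<alpha> by (simp_all add: x_def y_def z_def \<beta>_def)
  note \<sigma>' = cyclic_rotate[OF \<sigma>] cyclic_rotate[OF cyclic_rotate[OF \<sigma>]]
  have b: "br x y = 0" "br y z = (s * \<beta>) *\<^sub>R x" "br z x = (t * \<beta>) *\<^sub>R y"
    using br_cyclic[OF v \<sigma>] br_cyclic[OF v \<sigma>'(1)] br_cyclic[OF v \<sigma>'(2)] Lv
    by (simp_all add: x_def[symmetric] y_def[symmetric] z_def[symmetric] s_def t_def)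
  note sk = alternating_skew[OF br] and bb = bilinear_simps[OF br(1)]
  have b': "br y x = 0" "br z y = (- (s * \<beta>)) *\<^sub>R x" "br x z = (- (t * \<beta>)) *\<^sub>R y"
    using sk[of y x] sk[of z y] sk[of x z] b by simp_all
  have indep: "linindep3 x y z"
    using linindep3_onb[OF v] linindep3_swap(2) \<sigma> unfolding x_def y_def z_def
    by (elim cyclic_cases) auto
  have der: "derived_algebra br = span {x, y}"
  proof
    have "br u w \<in> span {x, y}" for u w
    proof -
      obtain a1 a2 a3 where u: "u = a1 *\<^sub>R x + a2 *\<^sub>R y + a3 *\<^sub>R z" using linindep3_expand[OF dim indep] .
      obtain c1 c2 c3 where w: "w = c1 *\<^sub>R x + c2 *\<^sub>R y + c3 *\<^sub>R z" using linindep3_expand[OF dim indep] .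
      show ?thesis
        unfolding u w by (simp add: bb br b b') (intro span_add span_diff span_neg span_scale span_base; simp)
    qed
    then show "derived_algebra br \<subseteq> span {x, y}"
      unfolding derived_algebra_def by (intro span_minimal subspace_span) blast
    have "x = br y ((1 / (s * \<beta>)) *\<^sub>R z)" "y = br z ((1 / (t * \<beta>)) *\<^sub>R x)"
      using \<beta> st by (auto simp: bb b)
    then have "{x, y} \<subseteq> derived_algebra br"
      unfolding derived_algebra_def using span_base[of _ "{br x y |x y. True}"] by blast
    then show "span {x, y} \<subseteq> derived_algebra br"
      by (metis derived_algebra_def span_minimal subspace_span)
  qed
  have sp: "\<exists>a c. u = a *\<^sub>R x + c *\<^sub>R y" if "u \<in> derived_algebra br" for u
    using that span_3[of u x y y] by (auto simp: der add.assoc simp flip: scaleR_add_left)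
  show "abelian_on (derived_algebra br) br"
    unfolding abelian_on_def
  proof (intro ballI)
    fix u w assume "u \<in> derived_algebra br" "w \<in> derived_algebra br"
    then obtain a c a' c' where "u = a *\<^sub>R x + c *\<^sub>R y" "w = a' *\<^sub>R x + c' *\<^sub>R y" using sp by metis
    then show "br u w = 0" by (simp add: bb br b b')
  qed
  have "independent {x, y}"
    using linindep3_independent(1)[OF indep] by (rule independent_mono) auto
  moreover have "x \<noteq> y" using linindep3_independent(2)[OF indep] by (auto simp: card_insert_if split: if_splits)
  ultimately show "dim (derived_algebra br) = 2" by (simp add: der dim_eq_card_independent)
  have xy: "x \<in> derived_algebra br" "y \<in> derived_algebra br" by (simp_all add: der span_base)
  have zxy: "linindep3 (k *\<^sub>R z) x y" if "k \<noteq> 0" for k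
    unfolding linindep3_def
  proof (intro allI impI)
    fix a b c assume "a *\<^sub>R k *\<^sub>R z + b *\<^sub>R x + c *\<^sub>R y = 0"
    then have "b *\<^sub>R x + c *\<^sub>R y + (a * k) *\<^sub>R z = 0" by (simp add: ac_simps)
    then have "b = 0" "c = 0" "a * k = 0" using indep unfolding linindep3_def by blast+
    then show "a = 0 \<and> b = 0 \<and> c = 0" using that by simp
  qed
  have t0: "t \<noteq> 0" using st by auto
  have "s = t \<or> s = - t" using st by auto
  then show "(is_e2 br \<and> definite_on (derived_algebra br) g) \<or> (is_e11 br \<and> indefinite_on (derived_algebra br) g)"
  proof
    assume s: "s = t"
    have "is_e2 br"
      by (rule is_e2I[OF dim br zxy[of "1 / (t * \<beta>)"]]) (use \<beta> t0 s in \<open>simp_all add: bb b b'\<close>)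
    moreover have "definite_on (derived_algebra br) g"
    proof -
      have q: "\<exists>r > 0. g u u = t * r" if u: "u \<in> derived_algebra br" "u \<noteq> 0" for u
      proof -
        obtain a c where ac: "u = a *\<^sub>R x + c *\<^sub>R y" using sp u(1) by blast
        then have "g u u = t * (a ^ 2 + c ^ 2)"
          by (simp add: bs gxy s_def[symmetric] t_def[symmetric] s power2_eq_square algebra_simps)
        moreover have "a ^ 2 + c ^ 2 > 0" using ac u(2) by (auto simp: sum_power2_gt_zero_iff)
        ultimately show ?thesis by blast
      qed
      have "(t = 1 \<longrightarrow> (\<forall>u\<in>derived_algebra br. u \<noteq> 0 \<longrightarrow> g u u > 0)) \<and>
        (t = - 1 \<longrightarrow> (\<forall>u\<in>derived_algebra br. u \<noteq> 0 \<longrightarrow> g u u < 0))"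
        using q by fastforce
      then show ?thesis unfolding definite_on_def using st(2) by blast
    qed
    ultimately show ?thesis by blast
  next
    assume s: "s = - t"
    have "is_e11 br"
    proof (rule is_e11I_hyperbolic[OF dim br zxy[of "1 / (t * \<beta>)"], of 0 1 1 1])
    qed (use \<beta> t0 s in \<open>simp_all add: bb b b'\<close>)
    moreover have "indefinite_on (derived_algebra br) g"
      unfolding indefinite_on_def using st(2) s xy s_def t_def
      by (metis neg_0_less_iff_less neg_less_0_iff_less zero_less_one minus_minus)
    ultimately show ?thesis by blast
  qed
qed

lemma adapted_basis_cases:
  assumes ad: "adapted_basis br g \<omega> H v \<alpha> h"
  shows "values1 \<alpha> h \<or> values2 \<alpha> h \<or> (\<exists>\<sigma>. values3 \<sigma> \<alpha> h)"
proof (rule diag_einstein_cases[of "\<alpha> 1" "\<alpha> 2" "\<alpha> 3" h])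
  show "\<alpha> 1 ^ 2 - (\<alpha> 2 - \<alpha> 3) ^ 2 - h ^ 2 = 0" "\<alpha> 2 ^ 2 - (\<alpha> 3 - \<alpha> 1) ^ 2 - h ^ 2 = 0"
    "\<alpha> 3 ^ 2 - (\<alpha> 1 - \<alpha> 2) ^ 2 - h ^ 2 = 0"
    by (rule adapted_basis_equations(1)[OF ad]; simp)+
qed (use cyclic_shifts in \<open>auto simp: values1_def values2_def values3_def
    intro: exI[of _ id] exI[of _ "triple 2 3 1"] exI[of _ "triple 3 1 2"]\<close>)

end

theorem theorem3p12:
  fixes br :: "'a::euclidean_space \<Rightarrow> 'a \<Rightarrow> 'a"
    and g :: "'a \<Rightarrow> 'a \<Rightarrow> real"
    and \<omega> H :: "'a \<Rightarrow> 'a \<Rightarrow> 'a \<Rightarrow> real"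
    and \<delta> :: "'a gen \<Rightarrow> real"
    and L :: "'a \<Rightarrow> 'a"
  assumes dim3: "DIM('a) = 3"
    and lie: "lie_algebra br"
    and unimod: "unimodular br"
    and ori: "orientation \<omega>"
    and metric: "pseudo_metric g"
    and einstein: "gen_einstein br g H \<delta>"
    and L: "L = structure_endo br g \<omega>"
  shows
    "(diagonalizable L \<longrightarrow>
       (\<exists>v \<alpha> h. adapted_basis br g \<omega> H v \<alpha> h) \<and>
       (\<forall>v \<alpha> h. adapted_basis br g \<omega> H v \<alpha> h \<longrightarrow>
          (values1 \<alpha> h \<and> abelian_on UNIV br \<and>
             (\<forall>\<delta>'. linear \<delta>' \<longrightarrow> gen_einstein br g H \<delta>')) \<or>
          (values2 \<alpha> h \<and> (is_so21 br \<or> is_so3 br) \<and> (is_so3 br \<longleftrightarrow> definite_on UNIV g) \<and>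
             (\<alpha> 1 = h \<longrightarrow> (\<forall>u\<in>E_plus g. \<delta> u = 0)) \<and>
             (\<alpha> 1 = - h \<longrightarrow> (\<forall>u\<in>E_minus g. \<delta> u = 0))) \<or>
          (\<exists>\<sigma>. values3 \<sigma> \<alpha> h \<and>
             abelian_on (derived_algebra br) br \<and> dim (derived_algebra br) = 2 \<and>
             ((is_e2 br \<and> definite_on (derived_algebra br) g) \<or>
              (is_e11 br \<and> indefinite_on (derived_algebra br) g)) \<and>
             comp_plus g \<delta> v (\<sigma> 1) = 0 \<and> comp_plus g \<delta> v (\<sigma> 2) = 0 \<and>
             comp_minus g \<delta> v (\<sigma> 1) = 0 \<and> comp_minus g \<delta> v (\<sigma> 2) = 0))) \<and>
     (\<forall>\<epsilon> \<alpha> h.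
       (\<forall>a. \<epsilon> a = 1 \<or> \<epsilon> a = -1) \<and> \<epsilon> 1 = \<epsilon> 2 \<and>
       (values1 \<alpha> h \<or> values2 \<alpha> h \<or> (\<exists>\<sigma>. values3 \<sigma> \<alpha> h)) \<longrightarrow>
       (\<exists>(br' :: 'a \<Rightarrow> 'a \<Rightarrow> 'a) g' \<omega>' H' \<delta>' v.
          lie_algebra br' \<and> unimodular br' \<and> orientation \<omega>' \<and> pseudo_metric g' \<and>
          gen_einstein br' g' H' \<delta>' \<and> diagonalizable (structure_endo br' g' \<omega>') \<and>
          adapted_basis br' g' \<omega>' H' v \<alpha> h \<and> (\<forall>a. g' (v a) (v a) = \<epsilon> a))) \<and>
     (\<not> diagonalizable L \<longrightarrow>
       H = (\<lambda>x y z. 0) \<and>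
       (\<exists>v. oriented_onb g \<omega> v \<and> g (v 1) (v 1) = g (v 2) (v 2) \<and> g (v 2) (v 2) = - g (v 3) (v 3) \<and>
          ((\<exists>\<alpha>. represented_by L v (L3 \<alpha>)) \<or> (\<exists>\<alpha>. represented_by L v (L4 \<alpha>)) \<or>
           represented_by L v L5)) \<and>
       (\<forall>v. oriented_onb g \<omega> v \<and> g (v 1) (v 1) = g (v 2) (v 2) \<and> g (v 2) (v 2) = - g (v 3) (v 3) \<longrightarrow>
          (represented_by L v (L3 0) \<or> represented_by L v (L4 0) \<longrightarrow>
             is_heisenberg br \<and>
             comp_plus g \<delta> v 1 = 0 \<and> comp_minus g \<delta> v 1 = 0 \<and>
             comp_plus g \<delta> v 2 = comp_plus g \<delta> v 3 \<and>
             comp_minus g \<delta> v 2 = comp_minus g \<delta> v 3) \<and>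
          (\<forall>\<alpha>. \<alpha> \<noteq> 0 \<and> (represented_by L v (L3 \<alpha>) \<or> represented_by L v (L4 \<alpha>)) \<longrightarrow>
             is_e11 br \<and>
             - (1/2) * g (v 1) (v 1) * comp_plus g \<delta> v 1 = \<alpha> \<and>
             - (1/2) * g (v 1) (v 1) * comp_minus g \<delta> v 1 = \<alpha> \<and>
             comp_plus g \<delta> v 2 = 0 \<and> comp_plus g \<delta> v 3 = 0 \<and>
             comp_minus g \<delta> v 2 = 0 \<and> comp_minus g \<delta> v 3 = 0) \<and>
          (represented_by L v L5 \<longrightarrow>
             is_e11 br \<and>
             g (v 1) (v 1) * comp_plus g \<delta> v 1 = - sqrt 2 \<and>
             - g (v 3) (v 3) * comp_plus g \<delta> v 3 = - sqrt 2 \<and>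
             g (v 1) (v 1) * comp_minus g \<delta> v 1 = - sqrt 2 \<and>
             - g (v 3) (v 3) * comp_minus g \<delta> v 3 = - sqrt 2 \<and>
             comp_plus g \<delta> v 2 = 0 \<and> comp_minus g \<delta> v 2 = 0)))"
proof -
  interpret einstein_lie_algebra br g \<omega> H \<delta> L
    using assms by unfold_locales
  show ?thesis
  proof (intro conjI impI, goal_cases)
    case 1
    then show ?case by (rule exists_adapted_basis)
  next
    case 2
    show ?case
    proof (intro allI impI, goal_cases)
      case ad: (1 v \<alpha> h)
      from adapted_basis_cases[OF ad] show ?case
        using flat_consequences[OF ad] simple_consequences[OF ad] metabelian_consequences[OF ad]
        by (elim disjE exE) metis+
    qed
  next
    case 3
    show ?case using diagonal_einstein_exists[OF dim3] diag_equations_of_values by blast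
  next
    case 4
    then show ?case using nondiagonalizable_normal_form by blast
  next
    case 5
    then obtain s v where "oriented_onb g \<omega> v" "lorentz_frame g s v"
      "(\<exists>\<alpha>. represented_by L v (L3 \<alpha>)) \<or> (\<exists>\<alpha>. represented_by L v (L4 \<alpha>)) \<or> represented_by L v L5"
      using nondiagonalizable_normal_form by blast
    then show ?case by (intro exI[of _ v]) (simp add: lorentz_frame_def)
  next
    case 6
    then show ?case using nondiagonalizable_consequences by blast
  qed
qed

end
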